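(* Let $G$ be a finitely generated group. Then the following conditions are equivalent. 1) $G$ is lacunary hyperbolic. 2) There exists a scaling sequence $d=(d_n)$ such that $\mathrm{Con}^\omega(G,d)$ is an $\mathbb R$-tree for any non-principal ultrafilter $\omega$. 3) $G$ is the direct limit of a sequence of hyperbolic groups $G_i=\langle S_i\rangle$ ($S_i$ is finite) and epimorphisms $$G_1\stackrel{\alpha_1}\longrightarrow G_2\stackrel{\alpha_2}\longrightarrow\cdots,$$ where $\alpha_i(S_i)=S_{i+1}$, and the hyperbolicity constant of $G_i$ (relative to $S_i$) is $o(r_i)$ as $i\to\infty$, where $r_i$ is the injectivity radius of $\alpha_i$ with respect to $S_i$.
   Context: A scaling sequence is an unbounded non-decreasing sequence $d=(d_n)_{n\in\mathbb N}$ of positive real numbers; ultrafilters are on $\mathbb N$. For a finitely generated group $G$ with the word metric $\mathrm{dist}$ of a finite generating set and a non-principal ultrafilter $\omega$, the asymptotic cone $\mathrm{Con}^\omega(G,d)$ is the set of sequences $(g_n)$ in $G$ with $\mathrm{dist}(1,g_n)/d_n$ bounded, modulo the relation $\lim^\omega \mathrm{dist}(g_n,h_n)/d_n=0$, with the metric $\lim^\omega \mathrm{dist}(g_n,h_n)/d_n$. A finitely generated group is lacunary hyperbolic if at least one of its asymptotic cones (for some non-principal ultrafilter and some scaling sequence) is an $\mathbb R$-tree; this does not depend on the finite generating set. A geodesic space is $\delta$-hyperbolic if each side of every geodesic triangle is contained in the closed $\delta$-neighborhood of the union of the other two sides; such a $\delta$ is called a hyperbolicity constant. A group $H$ generated by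 a finite set $S$ is ($\delta$-)hyperbolic if its Cayley graph $\Gamma(H,S)$ is $\delta$-hyperbolic (for some $\delta$). The injectivity radius of a homomorphism $\alpha:H\to H'$ with respect to a generating set $S$ of $H$ is the maximal radius of a ball in $\Gamma(H,S)$ on which $\alpha$ is injective (it is $\infty$ if $\alpha$ is injective). The condition $\delta_i=o(r_i)$ means that for every $\varepsilon>0$, $\delta_i\le\varepsilon r_i$ for all sufficiently large $i$. *)

theory Defs
  imports "HOL-Analysis.Analysis" "HOL-Algebra.Generated_Groups"
begin

section \<open>Geodesic spaces, hyperbolicity and real trees\<close>

definition geodesic_segment ::
    "'p set \<Rightarrow> ('p \<Rightarrow> 'p \<Rightarrow> real) \<Rightarrow> 'p \<Rightarrow> 'p \<Rightarrow> 'p set \<Rightarrow> bool" where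
  "geodesic_segment M d x y A \<longleftrightarrow>
     (\<exists>\<gamma>. \<gamma> ` {0..d x y} \<subseteq> M \<and> \<gamma> 0 = x \<and> \<gamma> (d x y) = y \<and>
        (\<forall>s\<in>{0..d x y}. \<forall>t\<in>{0..d x y}. d (\<gamma> s) (\<gamma> t) = \<bar>s - t\<bar>) \<and>
        A = \<gamma> ` {0..d x y})"

definition geodesic_space :: "'p set \<Rightarrow> ('p \<Rightarrow> 'p \<Rightarrow> real) \<Rightarrow> bool" where
  "geodesic_space M d \<longleftrightarrow>
     Metric_space M d \<and> (\<forall>x\<in>M. \<forall>y\<in>M. \<exists>A. geodesic_segment M d x y A)"

text \<open>Only applied to geodesic segments and unions of two of them; these are compact, so the
  infimum distance to such a set is attained and this is the usual closed neighbourhood.\<close>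

definition closed_nbhd :: "'p set \<Rightarrow> ('p \<Rightarrow> 'p \<Rightarrow> real) \<Rightarrow> real \<Rightarrow> 'p set \<Rightarrow> 'p set" where
  "closed_nbhd M d \<delta> A = {p \<in> M. \<exists>q\<in>A. d p q \<le> \<delta>}"

definition hyperbolic_space :: "'p set \<Rightarrow> ('p \<Rightarrow> 'p \<Rightarrow> real) \<Rightarrow> real \<Rightarrow> bool" where
  "hyperbolic_space M d \<delta> \<longleftrightarrow>
     geodesic_space M d \<and>
     (\<forall>x\<in>M. \<forall>y\<in>M. \<forall>z\<in>M. \<forall>A B C.
        geodesic_segment M d x y A \<and> geodesic_segment M d y z B \<and> geodesic_segment M d z x C \<longrightarrow>
        A \<subseteq> closed_nbhd M d \<delta> (B \<union> C) \<and>
        B \<subseteq> closed_nbhd M d \<delta> (C \<union> A) \<and>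
        C \<subseteq> closed_nbhd M d \<delta> (A \<union> B))"

text \<open>The definition of an \<open>\<real>\<close>-tree of Bridson and Haefliger: a metric space in which any two
  points are joined by a unique geodesic segment, and in which two segments meeting exactly in a
  common endpoint concatenate to a segment.\<close>

definition real_tree :: "'p set \<Rightarrow> ('p \<Rightarrow> 'p \<Rightarrow> real) \<Rightarrow> bool" where
  "real_tree M d \<longleftrightarrow>
     Metric_space M d \<and>
     (\<forall>x\<in>M. \<forall>y\<in>M. \<exists>!A. geodesic_segment M d x y A) \<and>
     (\<forall>x\<in>M. \<forall>y\<in>M. \<forall>z\<in>M. \<forall>A B.
        geodesic_segment M d y x A \<and> geodesic_segment M d x z B \<and> A \<inter> B = {x} \<longrightarrow>
        geodesic_segment M d y z (A \<union> B))"


section \<open>Word metrics and Cayley graphs\<close>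

definition finite_generating_set :: "('a, 'm) monoid_scheme \<Rightarrow> 'a set \<Rightarrow> bool" where
  "finite_generating_set G S \<longleftrightarrow> finite S \<and> S \<subseteq> carrier G \<and> generate G S = carrier G"

definition word_length :: "('a, 'm) monoid_scheme \<Rightarrow> 'a set \<Rightarrow> 'a \<Rightarrow> nat" where
  "word_length G S g =
     (LEAST n. \<exists>ws. length ws = n \<and> set ws \<subseteq> S \<union> (\<lambda>s. inv\<^bsub>G\<^esub> s) ` S \<and>
        foldr (\<otimes>\<^bsub>G\<^esub>) ws \<one>\<^bsub>G\<^esub> = g)"

definition word_dist :: "('a, 'm) monoid_scheme \<Rightarrow> 'a set \<Rightarrow> 'a \<Rightarrow> 'a \<Rightarrow> nat" where
  "word_dist G S g h = word_length G S (inv\<^bsub>G\<^esub> g \<otimes>\<^bsub>G\<^esub> h)"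

text \<open>The Cayley graph as a metric graph, with one edge of length 1 from \<open>g\<close> to \<open>g s\<close> for each
  \<open>g\<close> in the group and \<open>s \<in> S\<close>. The point \<open>EdgePt g s t\<close> is the interior point of that edge
  at distance \<open>t\<close> from its origin \<open>g\<close>.\<close>

datatype 'a cayley_point = Vertex 'a | EdgePt 'a 'a real

definition cayley_points :: "('a, 'm) monoid_scheme \<Rightarrow> 'a set \<Rightarrow> 'a cayley_point set" where
  "cayley_points G S =
     Vertex ` carrier G \<union> {EdgePt g s t | g s t. g \<in> carrier G \<and> s \<in> S \<and> 0 < t \<and> t < 1}"

text \<open>The vertices at which a path may leave the (closed) edge containing a point, each with its
  distance from the point along that edge.\<close>

primrec exits :: "('a, 'm) monoid_scheme \<Rightarrow> 'a cayley_point \<Rightarrow> ('a \<times> real) set" where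
  "exits G (Vertex g) = {(g, 0)}"
| "exits G (EdgePt g s t) = {(g, t), (g \<otimes>\<^bsub>G\<^esub> s, 1 - t)}"

text \<open>The path metric: a shortest path passes through exits of both points or stays inside
  one edge. Here and in \<open>cone_dist\<close> the value is \<open>0\<close> outside the set of points
  because \<open>Metric_space\<close> demands a symmetric nonnegative function on the whole type.\<close>

definition cayley_dist ::
    "('a, 'm) monoid_scheme \<Rightarrow> 'a set \<Rightarrow> 'a cayley_point \<Rightarrow> 'a cayley_point \<Rightarrow> real" where
  "cayley_dist G S p q =
     (if p \<in> cayley_points G S \<and> q \<in> cayley_points G S
      then Min ({a + real (word_dist G S u v) + b | u a v b.
                   (u, a) \<in> exits G p \<and> (v, b) \<in> exits G q} \<union>
                {\<bar>t - t'\<bar> | g s t t'. p = EdgePt g s t \<and> q = EdgePt g s t'})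
      else 0)"

definition hyperbolic_group_with ::
    "('a, 'm) monoid_scheme \<Rightarrow> 'a set \<Rightarrow> real \<Rightarrow> bool" where
  "hyperbolic_group_with H S \<delta> \<longleftrightarrow>
     group H \<and> finite_generating_set H S \<and>
     hyperbolic_space (cayley_points H S) (cayley_dist H S) \<delta>"


section \<open>Asymptotic cones\<close>

definition scaling_sequence :: "(nat \<Rightarrow> real) \<Rightarrow> bool" where
  "scaling_sequence d \<longleftrightarrow> (\<forall>n. 0 < d n) \<and> mono d \<and> \<not> bdd_above (range d)"

definition nonprincipal_ultrafilter :: "nat filter \<Rightarrow> bool" where
  "nonprincipal_ultrafilter \<omega> \<longleftrightarrow>
     \<omega> \<noteq> bot \<and>
     (\<forall>P. eventually P \<omega> \<or> eventually (\<lambda>n. \<not> P n) \<omega>) \<and>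
     (\<forall>n. \<omega> \<noteq> principal {n})"

definition cone_sequences ::
    "('a, 'm) monoid_scheme \<Rightarrow> 'a set \<Rightarrow> (nat \<Rightarrow> real) \<Rightarrow> (nat \<Rightarrow> 'a) set" where
  "cone_sequences G S d =
     {g. (\<forall>n. g n \<in> carrier G) \<and> (\<exists>C. \<forall>n. real (word_dist G S \<one>\<^bsub>G\<^esub> (g n)) / d n \<le> C)}"

definition cone_rel ::
    "('a, 'm) monoid_scheme \<Rightarrow> 'a set \<Rightarrow> nat filter \<Rightarrow> (nat \<Rightarrow> real) \<Rightarrow> (nat \<Rightarrow> 'a) rel" where
  "cone_rel G S \<omega> d =
     {(g, h). g \<in> cone_sequences G S d \<and> h \<in> cone_sequences G S d \<and>
        ((\<lambda>n. real (word_dist G S (g n) (h n)) / d n) \<longlongrightarrow> 0) \<omega>}"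

definition cone_points ::
    "('a, 'm) monoid_scheme \<Rightarrow> 'a set \<Rightarrow> nat filter \<Rightarrow> (nat \<Rightarrow> real) \<Rightarrow> (nat \<Rightarrow> 'a) set set" where
  "cone_points G S \<omega> d = cone_sequences G S d // cone_rel G S \<omega> d"

definition cone_dist ::
    "('a, 'm) monoid_scheme \<Rightarrow> 'a set \<Rightarrow> nat filter \<Rightarrow> (nat \<Rightarrow> real) \<Rightarrow>
       (nat \<Rightarrow> 'a) set \<Rightarrow> (nat \<Rightarrow> 'a) set \<Rightarrow> real" where
  "cone_dist G S \<omega> d A B =
     (if A \<in> cone_points G S \<omega> d \<and> B \<in> cone_points G S \<omega> d
      then THE r. \<forall>g\<in>A. \<forall>h\<in>B. ((\<lambda>n. real (word_dist G S (g n) (h n)) / d n) \<longlongrightarrow> r) \<omega>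
      else 0)"

definition cone_is_real_tree ::
    "('a, 'm) monoid_scheme \<Rightarrow> 'a set \<Rightarrow> nat filter \<Rightarrow> (nat \<Rightarrow> real) \<Rightarrow> bool" where
  "cone_is_real_tree G S \<omega> d \<longleftrightarrow> real_tree (cone_points G S \<omega> d) (cone_dist G S \<omega> d)"

definition lacunary_hyperbolic :: "('a, 'm) monoid_scheme \<Rightarrow> bool" where
  "lacunary_hyperbolic G \<longleftrightarrow>
     group G \<and>
     (\<exists>S \<omega> d. finite_generating_set G S \<and> nonprincipal_ultrafilter \<omega> \<and> scaling_sequence d \<and>
        cone_is_real_tree G S \<omega> d)"


section \<open>Direct limits of sequences of groups\<close>

text \<open>For \<open>i \<le> j\<close> this is the composite \<open>\<alpha> (j - 1) \<circ> \<dots> \<circ> \<alpha> i\<close>.\<close>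

primrec transition :: "(nat \<Rightarrow> 'b \<Rightarrow> 'b) \<Rightarrow> nat \<Rightarrow> nat \<Rightarrow> 'b \<Rightarrow> 'b" where
  "transition \<alpha> i 0 = id"
| "transition \<alpha> i (Suc j) = (if i \<le> j then \<alpha> j \<circ> transition \<alpha> i j else id)"

definition direct_limit_rel ::
    "(nat \<Rightarrow> 'b monoid) \<Rightarrow> (nat \<Rightarrow> 'b \<Rightarrow> 'b) \<Rightarrow> (nat \<times> 'b) rel" where
  "direct_limit_rel H \<alpha> =
     {((i, x), (j, y)). x \<in> carrier (H i) \<and> y \<in> carrier (H j) \<and>
        (\<exists>k. i \<le> k \<and> j \<le> k \<and> transition \<alpha> i k x = transition \<alpha> j k y)}"

text \<open>The union in \<open>mult\<close> runs over all representatives, which all give the same class.\<close>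

definition direct_limit ::
    "(nat \<Rightarrow> 'b monoid) \<Rightarrow> (nat \<Rightarrow> 'b \<Rightarrow> 'b) \<Rightarrow> (nat \<times> 'b) set monoid" where
  "direct_limit H \<alpha> =
     \<lparr>carrier = (SIGMA i:UNIV. carrier (H i)) // direct_limit_rel H \<alpha>,
      mult = (\<lambda>A B. \<Union>(i, x)\<in>A. \<Union>(j, y)\<in>B.
        direct_limit_rel H \<alpha> ``
          {(max i j, transition \<alpha> i (max i j) x \<otimes>\<^bsub>H (max i j)\<^esub> transition \<alpha> j (max i j) y)}),
      one = direct_limit_rel H \<alpha> `` {(0, \<one>\<^bsub>H 0\<^esub>)}\<rparr>"

text \<open>Balls are balls of group elements about \<open>1\<close>; a homomorphism injective on one ball of radius
  \<open>n\<close> is injective on all of them. The supremum is over a set of natural numbers containing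
  \<open>0\<close>, so it is a maximum unless \<open>\<alpha>\<close> is injective, when it is \<open>\<infinity>\<close>.\<close>

definition injectivity_radius ::
    "('a, 'm) monoid_scheme \<Rightarrow> 'a set \<Rightarrow> ('a \<Rightarrow> 'c) \<Rightarrow> ereal" where
  "injectivity_radius H S \<alpha> =
     Sup {ereal (real n) | n. inj_on \<alpha> {h \<in> carrier H. word_length H S h \<le> n}}"

text \<open>The sequence is indexed from \<open>0\<close>. The type \<open>'b\<close> is where the elements of the
  groups in the sequence live; finitely generated groups are countable, so up to isomorphism every
  such sequence has a copy in any given infinite type.\<close>

definition lacunary_limit_of_hyperbolic :: "'b itself \<Rightarrow> ('a, 'm) monoid_scheme \<Rightarrow> bool" where
  "lacunary_limit_of_hyperbolic (_ :: 'b itself) G \<longleftrightarrow>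
     (\<exists>(H :: nat \<Rightarrow> 'b monoid) (S :: nat \<Rightarrow> 'b set) (\<alpha> :: nat \<Rightarrow> 'b \<Rightarrow> 'b) (\<delta> :: nat \<Rightarrow> real).
        (\<forall>i. hyperbolic_group_with (H i) (S i) (\<delta> i)) \<and>
        (\<forall>i. \<alpha> i \<in> epi (H i) (H (Suc i))) \<and>
        (\<forall>i. \<alpha> i ` S i = S (Suc i)) \<and>
        direct_limit H \<alpha> \<cong> G \<and>
        (\<forall>\<epsilon>>0. \<forall>\<^sub>F i in sequentially.
           ereal (\<delta> i) \<le> ereal \<epsilon> * injectivity_radius (H i) (S i) (\<alpha> i)))"

end

theory Submission
  imports Defs
begin

text \<open>
  Lacunary hyperbolicity and the limit condition are both equivalent to one on finite balls
  (\<open>lacunary_scales\<close>): for all \<open>m\<close> and \<open>L\<close> there is \<open>D \<ge> L\<close> such that the ball of radius \<open>m * D\<close> in \<open>G\<close>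
  satisfies Gromov's four-point condition with constant \<open>D\<close>. Choosing such \<open>D\<close> for \<open>m = 1, 2, \<dots>\<close> gives a
  scaling sequence along which every cone is \<open>0\<close>-hyperbolic and geodesic, hence a real tree; conversely,
  quadruples violating the condition at all large scales would have a limit violating it in the cone. A
  change of the generators is a bi-Lipschitz change of the metric of the cone, and a geodesic metric that
  is bi-Lipschitz equivalent to a real tree is a real tree.

  From balls to groups: identify words over the generators whenever they are connected by
  substitutions that replace a subword by another one of the same value in \<open>G\<close>, both short
  compared with the radius of the ball.
  The quotient is locally hyperbolic, and it is hyperbolic by a Cartan--Hadamard argument. In a locally
  hyperbolic space a local quasi-geodesic can be straightened; straightening while appending the letters
  of a word one by one develops the word into a straight path. A short relator does not change that path up
  to bounded distance, so the path depends only on the group element, and triangles of geodesics are thin.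
  Conversely, if \<open>G\<close> is the limit of hyperbolic groups \<open>H i\<close> with constants \<open>o(r i)\<close>, then for suitable \<open>i\<close>
  the map from \<open>H i\<close> to \<open>G\<close> is an isometry on a ball whose radius is a large multiple of the constant.
\<close>

section \<open>Discrete paths in locally hyperbolic spaces\<close>

text \<open>Hyperbolicity is known only on balls, so long paths can be compared only piece by piece,
  and the danger is that errors add up. Three devices prevent this. Paths are sequences of group
  elements and all defects are additive, so there is no multiplicative constant that could grow.
  Appending a letter to a straight path raises its defect from 0 to at most 2, and straightening
  resets it to 0. Closeness is a discrete Frechet distance, which tells which pieces of two paths
  correspond; for local quasi-geodesics with a common origin and nearby ends, any bound up to
  \<open>1000 * D\<close> improves itself to \<open>270 * D\<close>. Each construction step costs a
  fixed multiple of \<open>D\<close>, and this contraction pays it back before the next step.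

  All scales are multiples of \<open>D\<close>: the four-point condition reaches to
  \<open>100000 * D\<close>, windows have length \<open>20000 * D\<close>, and a relation equates
  two words of length at most \<open>20 * D\<close>. To transfer the condition from \<open>G\<close>
  to the quotient, a ball of radius \<open>400000 * D\<close> is used. The free factor
  \<open>m\<close> in \<open>lacunary_scales\<close> supplies it, and letting \<open>m\<close> grow
  along the sequence makes the constants \<open>o(r i)\<close>.\<close>

lemma nat_intermediate:
  fixes f :: "nat \<Rightarrow> nat"
  assumes "a \<le> b" "\<And>i. a \<le> i \<Longrightarrow> i < b \<Longrightarrow> f (Suc i) \<le> f i + 1" "f a \<le> v" "v \<le> f b"
  shows "\<exists>i. a \<le> i \<and> i \<le> b \<and> f i = v"
proof -
  define i where "i = (LEAST i. a \<le> i \<and> v \<le> f i)"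
  have ex: "a \<le> b \<and> v \<le> f b" using assms by simp
  have i: "a \<le> i" "v \<le> f i" using LeastI[of "\<lambda>i. a \<le> i \<and> v \<le> f i", OF ex] by (auto simp: i_def)
  have ib: "i \<le> b" unfolding i_def using ex by (rule Least_le)
  have "f i \<le> v"
  proof (cases "i = a")
    case False
    then obtain i' where i': "i = Suc i'" "a \<le> i'" using i(1) by (cases i) auto
    have "\<not> (a \<le> i' \<and> v \<le> f i')" using not_less_Least[of i' "\<lambda>i. a \<le> i \<and> v \<le> f i"] i' by (auto simp: i_def)
    then show ?thesis using assms(2)[of i'] i' ib by auto
  qed (use assms in simp)
  with i ib show ?thesis by (auto intro: exI[of _ i])
qed

text \<open>A monotone staircase through the index pairs that advances one path at a time: the
  discrete Frechet distance. It tolerates paths of different speed and length, and unlike a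
  Hausdorff bound it says which initial pieces correspond, so that an induction can run along both
  paths.\<close>

inductive frechet :: "('a \<Rightarrow> 'a \<Rightarrow> nat) \<Rightarrow> nat \<Rightarrow> (nat \<Rightarrow> 'a) \<Rightarrow> (nat \<Rightarrow> 'a) \<Rightarrow> nat \<Rightarrow> nat \<Rightarrow> bool"
  for d :: "'a \<Rightarrow> 'a \<Rightarrow> nat" and E p q where
  start: "d (p 0) (q 0) \<le> E \<Longrightarrow> frechet d E p q 0 0"
| left: "frechet d E p q i j \<Longrightarrow> d (p (Suc i)) (q j) \<le> E \<Longrightarrow> frechet d E p q (Suc i) j"
| right: "frechet d E p q i j \<Longrightarrow> d (p i) (q (Suc j)) \<le> E \<Longrightarrow> frechet d E p q i (Suc j)"

lemma frechet_dist: "frechet d E p q i j \<Longrightarrow> d (p i) (q j) \<le> E"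
  by (induction rule: frechet.induct) auto

lemma frechet_cong:
  assumes "frechet d E p q i j" "\<And>l. l \<le> i \<Longrightarrow> p l = p' l" "\<And>l. l \<le> j \<Longrightarrow> q l = q' l"
  shows "frechet d E p' q' i j"
  using assms
proof (induction rule: frechet.induct)
  case start
  then show ?case by (metis frechet.start le_refl)
next
  case (left i j)
  then have "frechet d E p' q' i j" "d (p' (Suc i)) (q' j) \<le> E" by auto
  then show ?case by (rule frechet.left)
next
  case (right i j)
  then have "frechet d E p' q' i j" "d (p' i) (q' (Suc j)) \<le> E" by auto
  then show ?case by (rule frechet.right)
qed

lemma frechet_meets_left:
  "frechet d E p q i j \<Longrightarrow> t \<le> i \<Longrightarrow> \<exists>s\<le>j. d (p t) (q s) \<le> E"
proof (induction rule: frechet.induct)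
  case (left i j)
  then show ?case by (cases "t \<le> i") (auto simp: le_Suc_eq)
qed (use le_SucI in blast)+

section \<open>Integer-valued metrics and additive quasi-geodesics\<close>

locale nat_metric =
  fixes X :: "'a set" and d :: "'a \<Rightarrow> 'a \<Rightarrow> nat"
  assumes d_self: "x \<in> X \<Longrightarrow> d x x = 0"
    and d_eq: "x \<in> X \<Longrightarrow> y \<in> X \<Longrightarrow> d x y = 0 \<Longrightarrow> x = y"
    and d_sym: "x \<in> X \<Longrightarrow> y \<in> X \<Longrightarrow> d x y = d y x"
    and d_tri: "x \<in> X \<Longrightarrow> y \<in> X \<Longrightarrow> z \<in> X \<Longrightarrow> d x z \<le> d x y + d y z"
begin

definition path :: "(nat \<Rightarrow> 'a) \<Rightarrow> nat \<Rightarrow> bool" where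
  "path p n \<longleftrightarrow> (\<forall>i\<le>n. p i \<in> X) \<and> (\<forall>i<n. d (p i) (p (Suc i)) \<le> 1)"

text \<open>Every \<open>path\<close> satisfies the opposite bound, so only the lower bound on
  distances is recorded, with additive defect \<open>c\<close> and on stretches of length at most
  \<open>k\<close>.\<close>

definition quasi_geodesic :: "nat \<Rightarrow> nat \<Rightarrow> (nat \<Rightarrow> 'a) \<Rightarrow> nat \<Rightarrow> bool" where
  "quasi_geodesic k c p n \<longleftrightarrow> (\<forall>i j. i \<le> j \<longrightarrow> j \<le> n \<longrightarrow> j \<le> i + k \<longrightarrow> j \<le> i + d (p i) (p j) + c)"

lemma path_in: "path p n \<Longrightarrow> i \<le> n \<Longrightarrow> p i \<in> X"
  by (simp add: path_def)

lemma path_step: "path p n \<Longrightarrow> i < n \<Longrightarrow> d (p i) (p (Suc i)) \<le> 1"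
  by (simp add: path_def)

lemma path_dist:
  assumes "path p n" "i \<le> j" "j \<le> n"
  shows "d (p i) (p j) + i \<le> j"
  using assms(2,3)
proof (induction j rule: dec_induct)
  case base
  then show ?case using assms by (simp add: d_self path_def)
next
  case (step j)
  have "d (p i) (p (Suc j)) \<le> d (p i) (p j) + d (p j) (p (Suc j))"
    using step assms(1) by (intro d_tri) (auto simp: path_def)
  moreover have "d (p j) (p (Suc j)) \<le> 1" using step assms(1) by (auto simp: path_def)
  ultimately show ?case using step by simp
qed

lemma quasi_geodesicD:
  "quasi_geodesic k c p n \<Longrightarrow> i \<le> j \<Longrightarrow> j \<le> n \<Longrightarrow> j \<le> i + k \<Longrightarrow> j \<le> i + d (p i) (p j) + c"
  by (simp add: quasi_geodesic_def)

lemma quasi_geodesic_mono: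
  "quasi_geodesic k c p n \<Longrightarrow> c \<le> c' \<Longrightarrow> quasi_geodesic k c' p n"
  unfolding quasi_geodesic_def by (meson add_left_mono le_trans)

lemma frechet_sym:
  assumes "frechet d E p q i j" "\<And>l. l \<le> i \<Longrightarrow> p l \<in> X" "\<And>l. l \<le> j \<Longrightarrow> q l \<in> X"
  shows "frechet d E q p j i"
  using assms
proof (induction rule: frechet.induct)
  case start
  then show ?case by (metis d_sym frechet.start le_refl)
next
  case (left i j)
  then have "frechet d E q p j i" "d (q j) (p (Suc i)) \<le> E" by (auto simp: d_sym)
  then show ?case by (rule frechet.right)
next
  case (right i j)
  then have "frechet d E q p j i" "d (q (Suc j)) (p i) \<le> E" by (auto simp: d_sym)
  then show ?case by (rule frechet.left)
qed

text \<open>The two staircases are synchronised along \<open>q\<close>. The induction strips the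
  last step if it moved \<open>p\<close> or \<open>r\<close>, which is then the last step of the new
  staircase; if both staircases last moved in \<open>q\<close>, that step is dropped from both and
  the claim is unchanged.\<close>

lemma frechet_trans:
  assumes "frechet d E p q i j" "frechet d F q r j l"
    "\<And>s. s \<le> i \<Longrightarrow> p s \<in> X" "\<And>s. s \<le> j \<Longrightarrow> q s \<in> X" "\<And>s. s \<le> l \<Longrightarrow> r s \<in> X"
  shows "frechet d (E + F) p r i l"
  using assms
proof (induction "i + j + l" arbitrary: i j l rule: less_induct)
  case less
  have le: "d (p i) (r l) \<le> E + F"
    using frechet_dist[OF less.prems(1)] frechet_dist[OF less.prems(2)] d_tri[of "p i" "q j" "r l"] less.prems
    by force
  show ?case
  proof (cases rule: frechet.cases[OF less.prems(1)])
    case (2 i')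
    have "frechet d (E + F) p r i' l" by (rule less.hyps[of i' j l]) (use 2 less.prems in auto)
    then show ?thesis using le 2 by (auto intro: frechet.left)
  next
    case 1
    show ?thesis
    proof (cases rule: frechet.cases[OF less.prems(2)])
      case s: 1
      then show ?thesis using le \<open>i = 0\<close> by (auto intro: frechet.start)
    next
      case (3 j' l')
      have "frechet d (E + F) p r i l'"
        by (rule less.hyps[of i j l']) (use 3 less.prems in auto)
      then show ?thesis using le 3 by (auto intro: frechet.right)
    qed (use 1 in auto)
  next
    case (3 _ j')
    show ?thesis
    proof (cases rule: frechet.cases[OF less.prems(2)])
      case (2 j'')
      show ?thesis by (rule less.hyps[of i j' l]) (use 2 3 less.prems in auto)
    next
      case s: (3 _ l')
      have "frechet d (E + F) p r i l'"
        by (rule less.hyps[of i j l']) (use s less.prems in auto)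
      then show ?thesis using le s by (auto intro: frechet.right)
    qed (use 3 in auto)
  qed
qed

end

text \<open>\<open>D\<close> is the hyperbolicity constant and also the unit of every later scale.
  The stretches compared below have length at most \<open>40000 * D\<close>, well inside the range
  \<open>100000 * D\<close>.\<close>

locale locally_hyperbolic = nat_metric +
  fixes D :: nat
  assumes geodesic: "x \<in> X \<Longrightarrow> y \<in> X \<Longrightarrow>
      \<exists>p. path p (d x y) \<and> p 0 = x \<and> p (d x y) = y"
    and D_pos: "1 \<le> D"
    and four_point: "\<lbrakk>x \<in> X; y \<in> X; z \<in> X; w \<in> X;
        d x y \<le> 100000 * D; d x z \<le> 100000 * D; d x w \<le> 100000 * D\<rbrakk> \<Longrightarrow>
      d x y + d z w \<le> d x z + d y w + 2 * D \<or> d x y + d z w \<le> d x w + d y z + 2 * D"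
begin

text \<open>Apply the four-point condition to the ends of the stretch of \<open>p\<close> and the
  two points at time \<open>t\<close>. The paths spend at most \<open>c\<close> more than the
  distance of their ends, so both cross sums exceed \<open>d (p a) (p a')\<close> by at most
  \<open>c + 3 * e\<close>, and what is left bounds the distance of the two points.\<close>

lemma synchronous_close:
  assumes p: "path p n" and q: "path q m"
    and a: "a \<le> a'" "a' \<le> n" "a' \<le> a + d (p a) (p a') + c" "a' \<le> a + 40000 * D"
    and b: "b \<le> b'" "b' \<le> m" "b' \<le> b + d (q b) (q b') + c" "b' \<le> b + 40000 * D"
    and e: "d (p a) (q b) \<le> e" "d (p a') (q b') \<le> e" "e \<le> 1000 * D"
    and t: "a + t \<le> a'" "b + t \<le> b'"
  shows "d (p (a + t)) (q (b + t)) \<le> c + 3 * e + 2 * D"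
proof -
  let ?x = "p a" and ?y = "p a'" and ?x' = "q b" and ?y' = "q b'"
  let ?p = "p (a + t)" and ?q = "q (b + t)"
  have X: "?x \<in> X" "?y \<in> X" "?x' \<in> X" "?y' \<in> X" "?p \<in> X" "?q \<in> X"
    using p q a b t by (auto simp: path_def)
  have 1: "d ?x ?p \<le> t" "d ?p ?y + t + a \<le> a'" "d ?x ?y + a \<le> a'" "d ?x' ?q \<le> t" "d ?q ?y' + t + b \<le> b'"
    using path_dist[OF p, of a "a+t"] path_dist[OF p, of "a+t" a'] path_dist[OF p, of a "a'"]
      path_dist[OF q, of b "b+t"] path_dist[OF q, of "b+t" b'] a b t by auto
  have 2: "d ?x ?q \<le> e + t" using d_tri[of ?x ?x' ?q] X 1 e by linarith
  have 3: "d ?y ?q + t + b \<le> e + b'"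
    using d_tri[of ?y ?y' ?q] d_sym[of ?q ?y'] X 1 e by linarith
  have 4: "d ?x' ?y' \<le> d ?x ?y + 2 * e"
    using d_tri[of ?x' ?x ?y'] d_tri[of ?x ?y ?y'] d_sym[of ?x' ?x] X e by linarith
  have "d ?x ?y + d ?p ?q \<le> d ?x ?p + d ?y ?q + 2 * D \<or> d ?x ?y + d ?p ?q \<le> d ?x ?q + d ?y ?p + 2 * D"
    by (rule four_point[OF X(1) X(2) X(5) X(6)]) (use 1 2 a b e t in linarith)+
  then show ?thesis using 1 2 3 4 a b e d_sym[of ?p ?y] X by linarith
qed

text \<open>Advance both paths at equal speed until the shorter stretch ends, then finish the longer
  one. The rest has length at most \<open>c + 2 * e\<close>, because the distances between the ends
  differ by at most \<open>2 * e\<close>. The third \<open>D\<close> pays for the moments at which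
  only one of the two paths has made its unit step.\<close>

lemma synchronous_frechet:
  assumes p: "path p n" and q: "path q m"
    and a: "a \<le> a'" "a' \<le> n" "a' \<le> a + d (p a) (p a') + c" "a' \<le> a + 40000 * D"
    and b: "b \<le> b'" "b' \<le> m" "b' \<le> b + d (q b) (q b') + c" "b' \<le> b + 40000 * D"
    and e: "d (p a) (q b) \<le> e" "d (p a') (q b') \<le> e" "e \<le> 1000 * D"
    and E: "frechet d E p q a b" "c + 3 * e + 3 * D \<le> E"
  shows "frechet d E p q a' b'"
proof -
  have X: "\<And>i. i \<le> n \<Longrightarrow> p i \<in> X" "\<And>i. i \<le> m \<Longrightarrow> q i \<in> X" using p q by (auto simp: path_def)
  have close: "d (p (a + t)) (q (b + t)) \<le> c + 3 * e + 2 * D" if "a + t \<le> a'" "b + t \<le> b'" for t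
    by (rule synchronous_close[OF p q a b e that])
  have diag: "frechet d E p q (a + t) (b + t)" if "a + t \<le> a'" "b + t \<le> b'" for t
    using that
  proof (induction t)
    case 0
    then show ?case using E by simp
  next
    case (Suc t)
    have "d (p (Suc (a + t))) (q (b + t)) \<le> d (p (Suc (a + t))) (p (a + t)) + d (p (a + t)) (q (b + t))"
      using Suc.prems a b X by (intro d_tri) auto
    moreover have "d (p (Suc (a + t))) (p (a + t)) \<le> 1"
      using path_step[OF p, of "a + t"] Suc.prems a d_sym[OF X(1) X(1), of "Suc (a+t)" "a+t"] by auto
    ultimately have "d (p (Suc (a + t))) (q (b + t)) \<le> E"
      using close[of t] Suc.prems E D_pos by linarith
    then have "frechet d E p q (Suc (a + t)) (b + t)" using Suc by (intro frechet.left) auto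
    moreover have "d (p (Suc (a + t))) (q (Suc (b + t))) \<le> E" using close[of "Suc t"] Suc.prems E by auto
    ultimately show ?case by (simp add: frechet.right)
  qed
  have xx: "d (p a) (p a') \<le> d (q b) (q b') + 2 * e"
    using d_tri[of "p a" "q b" "p a'"] d_tri[of "q b" "q b'" "p a'"] d_sym[of "p a'" "q b'"] X a b e by auto
  have yy: "d (q b) (q b') \<le> d (p a) (p a') + 2 * e"
    using d_tri[of "q b" "p a" "q b'"] d_tri[of "p a" "p a'" "q b'"] d_sym[of "p a" "q b"] X a b e by auto
  have qq: "d (q b) (q b') + b \<le> b'" "d (p a) (p a') + a \<le> a'"
    using path_dist[OF q b(1,2)] path_dist[OF p a(1,2)] by auto
  show ?thesis
  proof (cases "a' - a \<le> b' - b")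
    case True
    define s where "s = a' - a"
    have "frechet d E p q a' (b + s)" using diag[of s] True a b by (simp add: s_def)
    moreover have "frechet d E p q a' j" if "b + s \<le> j" "j \<le> b'" for j
      using that
    proof (induction j rule: dec_induct)
      case base
      then show ?case using diag[of s] True a b by (simp add: s_def)
    next
      case (step j)
      have "d (p a') (q (Suc j)) \<le> d (p a') (q b') + d (q b') (q (Suc j))"
        using step a b X by (intro d_tri) auto
      moreover have "d (q (Suc j)) (q b') + Suc j \<le> b'" using path_dist[OF q, of "Suc j" b'] step b by auto
      moreover have "d (q b') (q (Suc j)) = d (q (Suc j)) (q b')" using step b X by (intro d_sym) auto
      moreover have "a' = a + s" using a s_def by simp
      ultimately have "d (p a') (q (Suc j)) \<le> E" using step(1,2) step.prems a b e yy qq E(2) by linarith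
      then show ?case using step by (intro frechet.right) auto
    qed
    ultimately show ?thesis using True a b s_def by auto
  next
    case False
    define s where "s = b' - b"
    have "frechet d E p q j b'" if "a + s \<le> j" "j \<le> a'" for j
      using that
    proof (induction j rule: dec_induct)
      case base
      then show ?case using diag[of s] False a b by (simp add: s_def)
    next
      case (step j)
      have "d (p (Suc j)) (q b') \<le> d (p (Suc j)) (p a') + d (p a') (q b')"
        using step a b X by (intro d_tri) auto
      moreover have "d (p (Suc j)) (p a') + Suc j \<le> a'" using path_dist[OF p, of "Suc j" a'] step a by auto
      moreover have "b' = b + s" using b s_def by simp
      ultimately have "d (p (Suc j)) (q b') \<le> E" using step(1,2) step.prems a b e xx qq E(2) by linarith
      then show ?case using step by (intro frechet.left) auto
    qed
    then show ?thesis using False a b s_def by auto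
  qed
qed

text \<open>The bound on the distance to the second path does not depend on \<open>E\<close>, the distance between the
  endpoints.\<close>

lemma middle_close:
  assumes p: "path p n" and q: "path q m"
    and a: "a \<le> t" "t \<le> a'" "a' \<le> n" "a' \<le> a + d (p a) (p a') + c" "a' \<le> a + 40000 * D"
    and b: "b \<le> b'" "b' \<le> m" "b' \<le> b + d (q b) (q b') + c"
    and e: "d (p a) (q b) \<le> E" "d (p a') (q b') \<le> E" "E \<le> 1000 * D" "c \<le> 1000 * D"
    and t: "a + E + 2 * c + 3 * D \<le> t" "t + E + 2 * c + 3 * D \<le> a'"
  shows "\<exists>s. b \<le> s \<and> s \<le> b' \<and> d (p t) (q s) \<le> c + 6 * D"
proof -
  let ?x = "p a" and ?y = "p a'" and ?x' = "q b" and ?y' = "q b'" and ?p = "p t"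
  have X: "?x \<in> X" "?y \<in> X" "?x' \<in> X" "?y' \<in> X" "?p \<in> X" "\<And>s. s \<le> m \<Longrightarrow> q s \<in> X"
    using p q a b t by (auto simp: path_def)
  have 1: "d ?x ?p + a \<le> t" "d ?p ?y + t \<le> a'" "d ?x ?y + a \<le> a'"
    using path_dist[OF p, of a "t"] path_dist[OF p, of "t" a'] path_dist[OF p, of a "a'"]
      a by auto
  have 2: "d ?x ?y \<le> d ?x ?p + d ?p ?y" using X by (intro d_tri)
  have 3: "d ?x ?y \<le> d ?x ?y' + E" using d_tri[of ?x ?y' ?y] d_sym[of ?y ?y'] X e by auto
  \<comment> \<open>The partner of \<open>p t\<close> is the point of \<open>q\<close> at the same
    distance from \<open>p a\<close>. It remains to see that it lies almost on a geodesic from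
    \<open>p a\<close> to \<open>p a'\<close>.\<close>
  have "\<exists>s. b \<le> s \<and> s \<le> b' \<and> d ?x (q s) = d ?x ?p"
  proof (rule nat_intermediate)
    show "d ?x (q (Suc i)) \<le> d ?x (q i) + 1" if "b \<le> i" "i < b'" for i
      using d_tri[of ?x "q i" "q (Suc i)"] path_step[OF q, of i] that b X by force
    show "d ?x (q b) \<le> d ?x ?p" using 1 2 a t e by linarith
    show "d ?x ?p \<le> d ?x (q b')" using 1 2 3 a t e by linarith
  qed (use b in auto)
  then obtain s where s: "b \<le> s" "s \<le> b'" "d ?x (q s) = d ?x ?p" by blast
  let ?q = "q s"
  have qX: "?q \<in> X" using s b X by auto
  have 4: "d ?x' ?q + b \<le> s" "d ?q ?y' + s \<le> b'"
    using path_dist[OF q, of b s] path_dist[OF q, of s b'] s b by auto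
  note sym = d_sym[OF qX X(3)] d_sym[OF qX X(2)] d_sym[OF X(2) X(5)] d_sym[OF X(4) X(2)]
    d_sym[OF X(4) qX] d_sym[OF X(3) X(1)]
  have 5: "d ?x ?q \<le> E + d ?x' ?q" "d ?y ?q \<le> E + d ?q ?y'" "d ?x ?y \<le> d ?x ?q + d ?y ?q"
    "d ?x' ?y' \<le> d ?x' ?q + d ?q ?y'" "d ?x' ?q \<le> E + d ?x ?q" "d ?q ?y' \<le> E + d ?y ?q"
    "d ?x ?y' \<le> d ?x ?y + E"
    subgoal using d_tri[OF X(1) X(3) qX] e by linarith
    subgoal using d_tri[OF X(2) X(4) qX] e sym by linarith
    subgoal using d_tri[OF X(1) qX X(2)] sym by linarith
    subgoal using d_tri[OF X(3) qX X(4)] by linarith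
    subgoal using d_tri[OF X(3) X(1) qX] e sym by linarith
    subgoal using d_tri[OF qX X(2) X(4)] e sym by linarith
    subgoal using d_tri[OF X(1) X(2) X(4)] e by linarith
    done
  have 6: "d ?x ?q \<le> 100000 * D" using 1(1) s(3) a(2,5) by linarith
  have bd: "d ?x ?y' \<le> 100000 * D" "d ?x ?x' \<le> 100000 * D" "d ?x ?y \<le> 100000 * D" "d ?x ?p \<le> 100000 * D"
    subgoal using 5(7) 1(3) a(5) e(3) by linarith
    subgoal using e(1,3) by linarith
    subgoal using 1(3) a(5) by linarith
    subgoal using 1(1) a(2,5) by linarith
    done
  have 7: "d ?x ?q + d ?x' ?y' \<le> d ?x ?x' + d ?q ?y' + 2 * D \<or> d ?x ?q + d ?x' ?y' \<le> d ?x ?y' + d ?q ?x' + 2 * D"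
    by (rule four_point[OF X(1) qX X(3) X(4) 6 bd(2,1)])
  \<comment> \<open>These margins exclude the alternatives of \<open>7\<close> and \<open>10\<close>
    that contain the end gaps \<open>d ?x ?x'\<close> and \<open>d ?y ?y'\<close>, which may be as
    large as \<open>E\<close>. The surviving alternatives do not mention the gaps, and so
    \<open>E\<close> disappears from the bound.\<close>
  have far: "E + c + 3 * D \<le> d ?x ?q" "E + c + 3 * D \<le> d ?y ?q"
    subgoal using 1(2) 2 s(3) a(4) t by linarith
    subgoal using 1(1) 5(3) s(3) a(4) t by linarith
    done
  have 9: "d ?x ?q + d ?q ?y' \<le> d ?x ?y' + c + 2 * D"
  proof -
    have "d ?q ?y' + d ?x' ?q \<le> d ?x' ?y' + c" using 4 s(1,2) b(3) by linarith
    then show ?thesis using 7 sym(1) far(1) 5(1) e(1) D_pos by linarith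
  qed
  have 10: "d ?x ?y' + d ?y ?q \<le> d ?x ?y + d ?y' ?q + 2 * D \<or> d ?x ?y' + d ?y ?q \<le> d ?x ?q + d ?y' ?y + 2 * D"
    by (rule four_point[OF X(1) X(4) X(2) qX bd(1,3) 6])
  have 11: "d ?x ?q + d ?y ?q \<le> d ?x ?y + c + 4 * D" using 10 9 sym(4,5) far(2) 5(2) e(2) D_pos by linarith
  have "d ?x ?y + d ?p ?q \<le> d ?x ?p + d ?y ?q + 2 * D \<or> d ?x ?y + d ?p ?q \<le> d ?x ?q + d ?y ?p + 2 * D"
    by (rule four_point[OF X(1) X(2) X(5) qX bd(3,4) 6])
  then have "d ?p ?q \<le> c + 6 * D" using 11 1(1,2) s(3) sym(3) a(4) by linarith
  then show ?thesis using s by auto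
qed

end

section \<open>Contraction of the Frechet distance between local quasi-geodesics\<close>

context locally_hyperbolic
begin

abbreviation "window \<equiv> 20000 * D"

text \<open>The coarse staircase is followed by a fine one that never lags far behind. Whenever
  \<open>p\<close> has advanced by more than \<open>6000 * D\<close>, \<open>middle_close\<close>
  gives a new checkpoint with gap \<open>(60 + 6) * D\<close>, whatever \<open>E\<close> is, and
  \<open>synchronous_frechet\<close> extends the fine staircase to it with
  \<open>(60 + 3 * 66 + 3) * D\<close>, below \<open>270 * D\<close>. The lag of \<open>q\<close> is
  at most \<open>(66 + 6000 + 1000 + 60) * D\<close> by the triangle inequality, hence below
  \<open>9000 * D\<close>.\<close>

lemma frechet_checkpoint:
  assumes p: "path p n" "quasi_geodesic window (60 * D) p n"
    and q: "path q m" "quasi_geodesic window (60 * D) q m"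
    and eq: "p 0 = q 0" and E: "E \<le> 1000 * D"
    and "frechet d E p q i j" "i \<le> n" "j \<le> m"
  shows "\<exists>a b. a \<le> i \<and> b \<le> j \<and> i \<le> a + 6000 * D \<and> j \<le> b + 9000 * D \<and>
    d (p a) (q b) \<le> 66 * D \<and> frechet d (270 * D) p q a b"
  using assms(7-)
proof (induction rule: frechet.induct)
  case start
  have "d (p 0) (q 0) = 0" using eq path_in[OF q(1), of 0] by (simp add: d_self)
  then show ?case by (auto intro!: exI[of _ 0] frechet.start)
next
  case (left i j)
  then obtain a b where ab: "a \<le> i" "b \<le> j" "i \<le> a + 6000 * D" "j \<le> b + 9000 * D"
    "d (p a) (q b) \<le> 66 * D" "frechet d (270 * D) p q a b" by auto
  show ?case
  proof (cases "Suc i \<le> a + 6000 * D")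
    case True
    then show ?thesis using ab left.prems by (intro exI[of _ a] exI[of _ b]) auto
  next
    case False
    \<comment> \<open>The middle of the stretch is \<open>3000 * D\<close> away from both ends;
      \<open>middle_close\<close> asks for \<open>(1000 + 2 * 60 + 3) * D\<close>.\<close>
    define t where "t = a + 3000 * D"
    have i: "Suc i = a + 6000 * D + 1" using False ab by simp
    have t: "a \<le> t" "t \<le> Suc i" "t \<le> n" using i left.prems D_pos by (auto simp: t_def)
    have "\<exists>s. b \<le> s \<and> s \<le> j \<and> d (p t) (q s) \<le> 60 * D + 6 * D"
    proof (rule middle_close[OF p(1) q(1), where E = "1000 * D" and a' = "Suc i" and a = a])
      show "Suc i \<le> a + d (p a) (p (Suc i)) + 60 * D"
        by (rule quasi_geodesicD[OF p(2)]) (use i left.prems D_pos in auto)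
      show "j \<le> b + d (q b) (q j) + 60 * D"
        by (rule quasi_geodesicD[OF q(2)]) (use ab left.prems D_pos in auto)
    qed (use t i left.prems left.hyps E ab D_pos in \<open>auto simp: t_def\<close>)
    then obtain s where s: "b \<le> s" "s \<le> j" "d (p t) (q s) \<le> 66 * D" by auto
    have "frechet d (270 * D) p q t s"
    proof (rule synchronous_frechet[OF p(1) q(1), where a = a and b = b and c = "60 * D" and e = "66 * D"])
      show "t \<le> a + d (p a) (p t) + 60 * D"
        by (rule quasi_geodesicD[OF p(2)]) (use t in \<open>auto simp: t_def\<close>)
      show "s \<le> b + d (q b) (q s) + 60 * D"
        by (rule quasi_geodesicD[OF q(2)]) (use ab left.prems s D_pos in auto)
    qed (use ab s t left.prems in \<open>auto simp: t_def\<close>)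
    then show ?thesis using s t i ab left.prems D_pos
      by (intro exI[of _ t] exI[of _ s]) (auto simp: t_def)
  qed
next
  case (right i j)
  then obtain a b where ab: "a \<le> i" "b \<le> j" "i \<le> a + 6000 * D" "j \<le> b + 9000 * D"
    "d (p a) (q b) \<le> 66 * D" "frechet d (270 * D) p q a b" by auto
  have X: "p a \<in> X" "p i \<in> X" "q b \<in> X" "q (Suc j) \<in> X"
    using path_in[OF p(1)] path_in[OF q(1)] ab right.prems by auto
  have "d (p a) (p i) + a \<le> i" using path_dist[OF p(1)] ab right.prems by auto
  moreover have "d (q b) (q (Suc j)) \<le> d (q b) (p a) + (d (p a) (p i) + d (p i) (q (Suc j)))"
    using d_tri[OF X(3,1,4)] d_tri[OF X(1,2,4)] by linarith
  moreover have "Suc j \<le> b + d (q b) (q (Suc j)) + 60 * D"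
    by (rule quasi_geodesicD[OF q(2)]) (use ab right.prems D_pos in auto)
  ultimately have "Suc j \<le> b + 9000 * D"
    using ab(3,5) d_sym[OF X(1,3)] right.hyps E D_pos by linarith
  then show ?case using ab right.prems by (intro exI[of _ a] exI[of _ b]) auto
qed

text \<open>From the last checkpoint to the ends there is one stretch of bounded length whose gaps
  at both ends are at most \<open>66 * D\<close>, so one more use of
  \<open>synchronous_frechet\<close> finishes. The output does not depend on \<open>E\<close>, and
  this is what keeps repeated use from losing anything.\<close>

lemma frechet_contract:
  assumes p: "path p n" "quasi_geodesic window (60 * D) p n"
    and q: "path q m" "quasi_geodesic window (60 * D) q m"
    and eq: "p 0 = q 0" and E: "frechet d E p q n m" "E \<le> 1000 * D"
    and e: "d (p n) (q m) \<le> 66 * D"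
  shows "frechet d (270 * D) p q n m"
proof -
  obtain a b where ab: "a \<le> n" "b \<le> m" "n \<le> a + 6000 * D" "m \<le> b + 9000 * D"
    "d (p a) (q b) \<le> 66 * D" "frechet d (270 * D) p q a b"
    using frechet_checkpoint[OF p q eq E(2,1)] by auto
  show ?thesis
  proof (rule synchronous_frechet[OF p(1) q(1), where a = a and b = b and c = "60 * D" and e = "66 * D"])
    show "n \<le> a + d (p a) (p n) + 60 * D"
      by (rule quasi_geodesicD[OF p(2)]) (use ab in auto)
    show "m \<le> b + d (q b) (q m) + 60 * D"
      by (rule quasi_geodesicD[OF q(2)]) (use ab in auto)
  qed (use ab e in auto)
qed

text \<open>The window around the midpoint \<open>m\<close> shows that the path passes
  \<open>m\<close> almost straight, and this bounds the Gromov product at \<open>m\<close> of the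
  two far ends: each end shares a long initial direction with the point at \<open>10000 * D\<close>
  from \<open>m\<close> on its side. The doubled window is the room in which
  \<open>straighten\<close> exchanges points.\<close>

lemma quasi_geodesic_double:
  assumes p: "path p n" "quasi_geodesic window 2 p n"
  shows "quasi_geodesic (2 * window) (10 * D) p n"
  unfolding quasi_geodesic_def
proof (intro allI impI)
  fix i j assume ij: "i \<le> j" "j \<le> n" "j \<le> i + 2 * window"
  show "j \<le> i + d (p i) (p j) + 10 * D"
  proof (cases "j \<le> i + window")
    case True
    then show ?thesis using quasi_geodesicD[OF p(2) ij(1,2)] D_pos by linarith
  next
    case False
    define m a b where "m = (i + j) div 2" and "a = m - 10000 * D" and "b = m + 10000 * D"
    have m: "i + 10000 * D \<le> m" "m + 10000 * D \<le> j" "m \<le> i + window" "j \<le> m + window + 1"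
      using False ij(3) by (auto simp: m_def)
    have ab: "i \<le> a" "a \<le> m" "m \<le> b" "b \<le> j" "a + 10000 * D = m" "b = m + 10000 * D" "b = a + window"
      using m by (auto simp: a_def b_def)
    have X: "p i \<in> X" "p j \<in> X" "p a \<in> X" "p b \<in> X" "p m \<in> X"
      using path_in[OF p(1)] ab ij m by auto
    have 1: "d (p i) (p a) + i \<le> a" "d (p a) (p m) + a \<le> m" "d (p m) (p b) + m \<le> b" "d (p b) (p j) + b \<le> j"
       "d (p i) (p m) + i \<le> m" "d (p m) (p j) + m \<le> j"
      using path_dist[OF p(1) ab(1)] path_dist[OF p(1) ab(2)] path_dist[OF p(1) ab(3)]
        path_dist[OF p(1) ab(4)] path_dist[OF p(1), of i m] path_dist[OF p(1), of m j] ab(1-4) ij(2) by simp_all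
    have 2: "m \<le> i + d (p i) (p m) + 2" "j \<le> m + d (p m) (p j) + 2" "b \<le> a + d (p a) (p b) + 2"
    proof -
      show "m \<le> i + d (p i) (p m) + 2" by (rule quasi_geodesicD[OF p(2)]) (use ab m ij in auto)
      show "b \<le> a + d (p a) (p b) + 2" by (rule quasi_geodesicD[OF p(2)]) (use ab m ij in auto)
      \<comment> \<open>Since \<open>m\<close> is rounded down, \<open>j = m + window + 1\<close> is
        conceivable; but then \<open>j\<close> would be at least
        \<open>i + 2 * window + 1\<close>.\<close>
      have "d (p m) (p j) + 2 + m \<ge> j"
      proof (cases "j \<le> m + window")
        case True
        then have "j \<le> m + d (p m) (p j) + 2"
          by (intro quasi_geodesicD[OF p(2)]) (use m ij in auto)
        then show ?thesis by simp
      next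
        case False
        then have "i + j \<ge> 2 * m" "j = m + window + 1" using m by (auto simp: m_def)
        then have "j \<ge> i + 2 * window + 1" using ij(3) m_def by linarith
        then show ?thesis using ij(3) by simp
      qed
      then show "j \<le> m + d (p m) (p j) + 2" by simp
    qed
    note sym = d_sym[OF X(5,1)] d_sym[OF X(5,3)] d_sym[OF X(2,5)] d_sym[OF X(2,4)] d_sym[OF X(4,3)]
    have bd: "d (p m) (p i) \<le> 100000 * D" "d (p m) (p j) \<le> 100000 * D" "d (p m) (p a) \<le> 100000 * D"
      "d (p m) (p b) \<le> 100000 * D"
      subgoal using 1(5) m(3) sym(1) by linarith
      subgoal using 1(6) m(4) D_pos by linarith
      subgoal using 1(2) ab(5) sym(2) by linarith
      subgoal using 1(3) ab(6) by linarith
      done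
    have 3: "d (p i) (p m) \<le> d (p i) (p a) + d (p a) (p m)" "d (p m) (p j) \<le> d (p m) (p b) + d (p b) (p j)"
      "d (p a) (p b) \<le> d (p a) (p m) + d (p m) (p b)" "d (p i) (p b) \<le> d (p i) (p j) + d (p b) (p j)"
      "d (p i) (p b) \<le> d (p i) (p m) + d (p m) (p b)"
      using d_tri[OF X(1,3,5)] d_tri[OF X(5,4,2)] d_tri[OF X(3,5,4)] d_tri[OF X(1,2,4)] d_tri[OF X(1,5,4)] sym
      by auto
    \<comment> \<open>Gromov products at the midpoint: \<open>(a|b)\<close> is small, while \<open>(i|a)\<close> and \<open>(j|b)\<close> are large.\<close>
    have f1: "d (p m) (p i) + d (p a) (p b) \<le> d (p m) (p a) + d (p i) (p b) + 2 * D \<or>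
        d (p m) (p i) + d (p a) (p b) \<le> d (p m) (p b) + d (p i) (p a) + 2 * D"
      by (rule four_point[OF X(5,1,3,4) bd(1,3,4)])
    have f2: "d (p m) (p j) + d (p b) (p i) \<le> d (p m) (p b) + d (p j) (p i) + 2 * D \<or>
        d (p m) (p j) + d (p b) (p i) \<le> d (p m) (p i) + d (p j) (p b) + 2 * D"
      by (rule four_point[OF X(5,2,4,1) bd(2,4,1)])
    have 4: "d (p i) (p m) + d (p m) (p b) \<le> d (p i) (p b) + 2 + 2 * D"
    proof -
      have "d (p i) (p a) + 8000 * D \<le> d (p i) (p m)" using 1(1) 2(1) ab(5) D_pos by linarith
      moreover have "d (p a) (p m) + d (p m) (p b) \<le> d (p a) (p b) + 2" using 1(2,3) 2(3) by linarith
      moreover have "8000 * D \<le> d (p a) (p m)" using 2(3) 3(3) 1(3) ab(5,6) D_pos by linarith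
      ultimately show ?thesis using f1 sym(1,2) D_pos by linarith
    qed
    have 5: "d (p i) (p m) + d (p m) (p j) \<le> d (p i) (p j) + 2 + 4 * D"
    proof -
      have "8000 * D \<le> d (p m) (p b)" using 2(3) 3(3) 1(2) ab(5,6) D_pos by linarith
      moreover have "d (p j) (p b) + 8000 * D \<le> d (p m) (p j)" using 1(4) 2(2) ab(6) sym(4) D_pos by linarith
      ultimately show ?thesis using f2 4 sym d_sym[OF X(4,1)] d_sym[OF X(2,1)] D_pos by linarith
    qed
    show ?thesis using 5 2(1,2) D_pos by linarith
  qed
qed

end

section \<open>Straightening a local quasi-geodesic\<close>

context locally_hyperbolic
begin

lemma geodesic_chain:
  fixes q :: "nat \<Rightarrow> 'a" and N :: "nat \<Rightarrow> nat"
  defines "N \<equiv> \<lambda>m. \<Sum>i<m. d (q i) (q (Suc i))"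
  assumes "\<And>m. m \<le> M \<Longrightarrow> q m \<in> X"
  shows "\<exists>r. path r (N M) \<and> (\<forall>m\<le>M. r (N m) = q m)"
  using assms(2)
proof (induction M)
  case 0
  then show ?case by (auto simp: N_def path_def intro!: exI[of _ "\<lambda>_. q 0"])
next
  case (Suc M)
  then obtain r where r: "path r (N M)" "\<And>m. m \<le> M \<Longrightarrow> r (N m) = q m" by auto
  obtain g where g: "path g (d (q M) (q (Suc M)))" "g 0 = q M" "g (d (q M) (q (Suc M))) = q (Suc M)"
    using geodesic[of "q M" "q (Suc M)"] Suc.prems by auto
  define r' where "r' s = (if s \<le> N M then r s else g (s - N M))" for s
  have N: "N (Suc M) = N M + d (q M) (q (Suc M))" by (simp add: N_def)
  have Nm: "m \<le> M \<Longrightarrow> N m \<le> N M" for m unfolding N_def by (intro sum_mono2) auto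
  have "path r' (N (Suc M))"
    unfolding path_def
  proof (intro conjI allI impI)
    show "r' i \<in> X" if "i \<le> N (Suc M)" for i
      using that path_in[OF r(1), of i] path_in[OF g(1), of "i - N M"] by (auto simp: r'_def N)
    show "d (r' i) (r' (Suc i)) \<le> 1" if i: "i < N (Suc M)" for i
    proof (cases "i < N M")
      case True
      then show ?thesis using path_step[OF r(1) True] by (simp add: r'_def)
    next
      case False
      then have "r' i = g (i - N M)" using g(2) r(2)[of M] by (cases "i = N M") (auto simp: r'_def)
      moreover have "r' (Suc i) = g (Suc (i - N M))" using False by (auto simp: r'_def Suc_diff_le)
      ultimately show ?thesis using path_step[OF g(1), of "i - N M"] i N False by auto
    qed
  qed
  moreover have "r' (N m) = q m" if "m \<le> Suc M" for m
  proof (cases "m = Suc M")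
    case True
    show ?thesis
    proof (cases "d (q M) (q (Suc M)) = 0")
      case z: True
      then have "q M = q (Suc M)" using d_eq Suc.prems by auto
      then show ?thesis using True z r(2)[of M] by (simp add: r'_def N)
    next
      case False
      then show ?thesis using True g(3) by (simp add: r'_def N)
    qed
  next
    case False
    then show ?thesis using that r(2)[of m] Nm[of m] by (auto simp: r'_def)
  qed
  ultimately show ?case by blast
qed

text \<open>The new path runs through points chosen in balls around the sample points \<open>p (s m)\<close> so that the
  total length is least: if a window of it were not geodesic, replacing the chosen points in it by points of
  a geodesic would shorten it.\<close>

lemma straighten:
  assumes p: "path p n" "quasi_geodesic window 2 p n"
  shows "\<exists>r l. path r l \<and> quasi_geodesic window 0 r l \<and> r 0 = p 0 \<and> r l = p n \<and>
    frechet d (80 * D) r p l n"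
proof (cases "n < 200 * D")
  case True
  obtain g where g: "path g (d (p 0) (p n))" "g 0 = p 0" "g (d (p 0) (p n)) = p n"
    using geodesic[of "p 0" "p n"] p by (auto simp: path_def)
  let ?l = "d (p 0) (p n)"
  have X: "p 0 \<in> X" "p n \<in> X" using p by (auto simp: path_def)
  have ln: "?l \<le> n" using path_dist[OF p(1), of 0 n] by simp
  have "quasi_geodesic window 0 g ?l"
    unfolding quasi_geodesic_def
  proof (intro allI impI)
    fix i j assume ij: "i \<le> j" "j \<le> ?l" "j \<le> i + window"
    have gX: "g 0 \<in> X" "g i \<in> X" "g j \<in> X" "g ?l \<in> X" using ij path_in[OF g(1)] by auto
    show "j \<le> i + d (g i) (g j) + 0"
      using d_tri[OF gX(1,2,4)] d_tri[OF gX(2,3,4)] path_dist[OF g(1), of 0 i] path_dist[OF g(1), of j ?l] g ij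
      by auto
  qed
  moreover have "frechet d (80 * D) g p ?l n"
  proof (rule synchronous_frechet[OF g(1) p(1), where a = 0 and b = 0 and c = "10 * D" and e = 0])
    show "n \<le> 0 + d (p 0) (p n) + 10 * D"
    proof -
      have "n \<le> 0 + d (p 0) (p n) + 2" by (rule quasi_geodesicD[OF p(2)]) (use True in auto)
      then show ?thesis using D_pos by linarith
    qed
    show "frechet d (80 * D) g p 0 0" using g X by (auto intro!: frechet.start simp: d_self)
  qed (use g X True ln in \<open>auto simp: d_self\<close>)
  ultimately show ?thesis using g by auto
next
  case False
  \<comment> \<open>The spacing \<open>200 * D\<close> of the samples is large against the radius
    \<open>20 * D\<close> of the balls and the defect \<open>10 * D\<close>, so chosen points stay
    in order and at least \<open>150 * D\<close> apart. The last block absorbs the remainder of the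
    division and is shorter than \<open>2 * T\<close>.\<close>
  define T where "T = 200 * D"
  define M where "M = n div T"
  define s where "s m = (if m < M then m * T else n)" for m
  have T: "T > 0" using D_pos by (simp add: T_def)
  have M: "M \<ge> 1" "M * T \<le> n" "n < M * T + T"
    using False T div_le_mono[of T n T] dividend_less_div_times[OF T, of n]
    by (auto simp: M_def T_def[symmetric] add.commute)
  have s0: "s 0 = 0" and sM: "s M = n" using M by (auto simp: s_def)
  have s_step: "s m + T \<le> s (Suc m)" "s (Suc m) \<le> s m + 2 * T" if "m < M" for m
  proof -
    have "Suc m * T \<le> M * T" using that by (intro mult_le_mono1) simp
    then show "s m + T \<le> s (Suc m)" using that M by (auto simp: s_def)
    show "s (Suc m) \<le> s m + 2 * T"
    proof (cases "Suc m < M")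
      case True
      then show ?thesis by (simp add: s_def)
    next
      case False
      then have "M = Suc m" using that by simp
      then show ?thesis using M(3) by (simp add: s_def)
    qed
  qed
  have s_add: "s m + (j - m) * T \<le> s j" if "m \<le> j" "j \<le> M" for m j
    using that
  proof (induction j rule: dec_induct)
    case (step j)
    then show ?case using s_step(1)[of j] by (auto simp: Suc_diff_le)
  qed simp
  have s_mono: "s m \<le> s j" if "m \<le> j" "j \<le> M" for m j using s_add[OF that] by simp
  have s_le: "s m \<le> n" if "m \<le> M" for m using s_mono[OF that] sM by simp
  have s_upper: "s j \<le> s m + (j - m) * T + T" if "m \<le> j" "j \<le> M" for m j
  proof (cases "m < M")
    case True
    have "j * T = m * T + (j - m) * T" using that by (simp add: add_mult_distrib[symmetric])
    moreover have "s j \<le> j * T + T" using that M by (cases "j < M") (auto simp: s_def)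
    ultimately show ?thesis using True by (simp add: s_def)
  next
    case False
    then have "j = m" using that by simp
    then show ?thesis by simp
  qed
  have p2: "quasi_geodesic (2 * window) (10 * D) p n" by (rule quasi_geodesic_double[OF p])
  \<comment> \<open>The radius \<open>20 * D\<close> leaves room for \<open>(10 + 6) * D\<close>
    from \<open>middle_close\<close>: a geodesic between two chosen points passes again through the
    balls between them, so its points are admissible replacements.\<close>
  define ok where "ok q \<longleftrightarrow> q 0 = p 0 \<and> q M = p n \<and> (\<forall>m\<le>M. q m \<in> X \<and> d (q m) (p (s m)) \<le> 20 * D)"
    for q :: "nat \<Rightarrow> 'a"
  define len where "len q = (\<Sum>i<M. d (q i) (q (Suc i)))" for q :: "nat \<Rightarrow> 'a"
  have "ok (\<lambda>m. p (s m))" using p s0 sM s_le by (auto simp: ok_def path_def d_self)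
  then obtain q where q: "ok q" "\<And>q'. ok q' \<Longrightarrow> len q \<le> len q'"
    using ex_has_least_nat[of ok _ len] by blast
  have qX: "m \<le> M \<Longrightarrow> q m \<in> X" and qp: "m \<le> M \<Longrightarrow> d (q m) (p (s m)) \<le> 20 * D" for m
    using q(1) by (auto simp: ok_def)
  have pX: "i \<le> n \<Longrightarrow> p i \<in> X" for i using p by (auto simp: path_def)
  have geod: "(\<Sum>i=m..<m'. d (q i) (q (Suc i))) \<le> d (q m) (q m')"
    if mm: "m < m'" "m' \<le> M" "s m' \<le> s m + 2 * window" for m m'
  proof -
    let ?L = "d (q m) (q m')"
    obtain g where g: "path g ?L" "g 0 = q m" "g ?L = q m'"
      using geodesic[of "q m" "q m'"] qX mm by auto
    have "\<exists>t. t \<le> ?L \<and> d (p (s j)) (g t) \<le> 20 * D \<and> (j = m \<longrightarrow> t = 0) \<and> (j = m' \<longrightarrow> t = ?L)"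
      if j: "m \<le> j" "j \<le> m'" for j
    proof -
      consider "j = m" | "j = m'" "j \<noteq> m" | "m < j" "j < m'" using j by linarith
      then show ?thesis
      proof cases
        case 1
        then show ?thesis
          using mm qp[of m] g d_sym[OF qX pX, of m "s m"] s_le[of m] by (intro exI[of _ 0]) auto
      next
        case 2
        then show ?thesis
          using mm qp[of m'] g d_sym[OF qX pX, of m' "s m'"] s_le[of m'] by (intro exI[of _ ?L]) auto
      next
        case 3
        have ss: "s m + T \<le> s j" "s j + T \<le> s m'"
          using s_step(1)[of m] s_mono[of "Suc m" j] s_step(1)[of j] s_mono[of "Suc j" m'] 3 mm by auto
        have "\<exists>t. 0 \<le> t \<and> t \<le> ?L \<and> d (p (s j)) (g t) \<le> 10 * D + 6 * D"
        proof (rule middle_close[OF p(1) g(1), where a = "s m" and a' = "s m'" and b = 0 and E = "20 * D"])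
          show "s m' \<le> s m + d (p (s m)) (p (s m')) + 10 * D"
            by (rule quasi_geodesicD[OF p2]) (use mm s_mono s_le in auto)
        qed (use ss mm s_le[of m'] g qp[of m] qp[of m'] d_sym[OF qX pX, of m "s m"] d_sym[OF qX pX, of m' "s m'"]
            s_le[of m] in \<open>auto simp: T_def\<close>)
        then show ?thesis using 3 by auto
      qed
    qed
    then obtain t where t: "\<And>j. m \<le> j \<Longrightarrow> j \<le> m' \<Longrightarrow> t j \<le> ?L \<and> d (p (s j)) (g (t j)) \<le> 20 * D"
      and tm: "t m = 0" "t m' = ?L" using mm by (metis less_imp_le_nat order_refl)
    have gX: "i \<le> ?L \<Longrightarrow> g i \<in> X" for i using path_in[OF g(1)] by auto
    have gd: "d (g i) (g j) + i = j" if ij: "i \<le> j" "j \<le> ?L" for i j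
    proof -
      have gX: "g 0 \<in> X" "g i \<in> X" "g j \<in> X" "g ?L \<in> X" using ij path_in[OF g(1)] by auto
      show ?thesis
        using d_tri[OF gX(1,2,4)] d_tri[OF gX(2,3,4)] path_dist[OF g(1), of 0 i] path_dist[OF g(1), of j ?L]
          path_dist[OF g(1), of i j] g ij by auto
    qed
    \<comment> \<open>The replacement points occur along \<open>g\<close> in order, so that their
      successive distances add up to exactly \<open>?L\<close>. Consecutive samples differ by
      \<open>200 * D\<close>, while the errors total \<open>(10 + 4 * 20) * D\<close>.\<close>
    have t_mono: "t j \<le> t (Suc j)" if j: "m \<le> j" "j < m'" for j
    proof -
      have X: "p (s m) \<in> X" "p (s j) \<in> X" "p (s (Suc j)) \<in> X" "g 0 \<in> X" "g (t j) \<in> X" "g (t (Suc j)) \<in> X"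
        using j mm s_le[of m] s_le[of j] s_le[of "Suc j"] pX gX t[of j] t[of "Suc j"] by auto
      have 1: "s (Suc j) \<le> s m + d (p (s m)) (p (s (Suc j))) + 10 * D"
        by (rule quasi_geodesicD[OF p2])
          (use j mm s_mono[of m "Suc j"] s_le[of "Suc j"] s_mono[of "Suc j" m'] in auto)
      have 2: "d (p (s m)) (p (s j)) + s m \<le> s j" "s j + T \<le> s (Suc j)"
        using path_dist[OF p(1), of "s m" "s j"] s_mono[of m j] s_le[of j] s_step(1)[of j] j mm by auto
      have 3: "t j = d (g 0) (g (t j))" "t (Suc j) = d (g 0) (g (t (Suc j)))"
        using gd[of 0 "t j"] gd[of 0 "t (Suc j)"] t[of j] t[of "Suc j"] j by auto
      have 4: "d (g 0) (g (t j)) \<le> d (g 0) (p (s m)) + d (p (s m)) (p (s j)) + d (p (s j)) (g (t j))"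
        using d_tri[OF X(4,1,5)] d_tri[OF X(1,2,5)] by linarith
      have 5: "d (p (s m)) (p (s (Suc j))) \<le> d (p (s m)) (g 0) + d (g 0) (g (t (Suc j))) + d (g (t (Suc j))) (p (s (Suc j)))"
        using d_tri[OF X(1,4,3)] d_tri[OF X(4,6,3)] by linarith
      have 6: "d (g 0) (p (s m)) \<le> 20 * D" "d (p (s m)) (g 0) \<le> 20 * D" "d (p (s j)) (g (t j)) \<le> 20 * D"
        "d (g (t (Suc j))) (p (s (Suc j))) \<le> 20 * D"
        using qp[of m] mm g(2) d_sym[OF X(1,4)] t[of j] t[of "Suc j"] j d_sym[OF X(3,6)] by auto
      show ?thesis using 1 2 3 4 5 6 unfolding T_def by linarith
    qed
    define q' where "q' j = (if m \<le> j \<and> j \<le> m' then g (t j) else q j)" for j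
    have q'm: "q' m = q m" "q' m' = q m'" using tm g mm by (auto simp: q'_def)
    have "q' 0 = q 0" using q'm mm by (cases "m = 0") (auto simp: q'_def)
    moreover have "q' M = q M" using q'm mm by (cases "m' = M") (auto simp: q'_def)
    moreover have "q' j \<in> X \<and> d (q' j) (p (s j)) \<le> 20 * D" if "j \<le> M" for j
      using that t[of j] gX[of "t j"] qX[of j] qp[of j] d_sym[OF pX gX, of "s j" "t j"] s_le[of j]
      by (auto simp: q'_def)
    ultimately have ok': "ok q'" using q(1) by (auto simp: ok_def)
    have split: "len f = (\<Sum>i=0..<m. d (f i) (f (Suc i))) + (\<Sum>i=m..<m'. d (f i) (f (Suc i)))
        + (\<Sum>i=m'..<M. d (f i) (f (Suc i)))" for f
      unfolding len_def lessThan_atLeast0 using mm by (simp add: sum.atLeastLessThan_concat)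
    have "(\<Sum>i=0..<m. d (q' i) (q' (Suc i))) = (\<Sum>i=0..<m. d (q i) (q (Suc i)))"
    proof (rule sum.cong)
      fix i assume i: "i \<in> {0..<m}"
      then have "q' i = q i" by (simp add: q'_def)
      moreover have "q' (Suc i) = q (Suc i)" using i q'm by (cases "Suc i = m") (auto simp: q'_def)
      ultimately show "d (q' i) (q' (Suc i)) = d (q i) (q (Suc i))" by simp
    qed simp
    moreover have "(\<Sum>i=m'..<M. d (q' i) (q' (Suc i))) = (\<Sum>i=m'..<M. d (q i) (q (Suc i)))"
    proof (rule sum.cong)
      fix i assume i: "i \<in> {m'..<M}"
      then have "q' (Suc i) = q (Suc i)" by (simp add: q'_def)
      moreover have "q' i = q i" using i q'm by (cases "i = m'") (auto simp: q'_def)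
      ultimately show "d (q' i) (q' (Suc i)) = d (q i) (q (Suc i))" by simp
    qed simp
    moreover have "(\<Sum>i=m..<j. d (q' i) (q' (Suc i))) = t j" if "m \<le> j" "j \<le> m'" for j
      using that
    proof (induction j rule: dec_induct)
      case base
      then show ?case using tm by simp
    next
      case (step j)
      then show ?case using gd[OF t_mono[of j]] t[of "Suc j"] by (auto simp: q'_def)
    qed
    then have "(\<Sum>i=m..<m'. d (q' i) (q' (Suc i))) = ?L" using tm mm by auto
    ultimately show ?thesis using q(2)[OF ok'] split[of q] split[of q'] by linarith
  qed
  define N where "N m = (\<Sum>i<m. d (q i) (q (Suc i)))" for m
  obtain r where r: "path r (N M)" "\<And>m. m \<le> M \<Longrightarrow> r (N m) = q m"
    using geodesic_chain[of M q] qX unfolding N_def by blast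
  have block: "150 * D \<le> d (q m) (q (Suc m))" if m: "m < M" for m
  proof -
    have X: "q m \<in> X" "q (Suc m) \<in> X" "p (s m) \<in> X" "p (s (Suc m)) \<in> X"
      using qX pX s_le m by auto
    have "s (Suc m) \<le> s m + d (p (s m)) (p (s (Suc m))) + 10 * D"
      by (rule quasi_geodesicD[OF p2])
        (use m s_mono[of m "Suc m"] s_le[of "Suc m"] s_step(2)[OF m] in \<open>auto simp: T_def\<close>)
    moreover have "d (p (s m)) (p (s (Suc m))) \<le> d (p (s m)) (q m) + d (q m) (q (Suc m)) + d (q (Suc m)) (p (s (Suc m)))"
      using d_tri[OF X(3,1,4)] d_tri[OF X(1,2,4)] by linarith
    ultimately show ?thesis
      using s_step(1)[OF m] qp[of m] qp[of "Suc m"] m d_sym[OF X(1,3)] by (simp add: T_def)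
  qed
  have N_add: "N m + i * (150 * D) \<le> N (m + i)" if "m + i \<le> M" for m i
    using that
  proof (induction i)
    case (Suc i)
    then show ?case using block[of "m + i"] by (simp add: N_def)
  qed simp
  have N_mono: "N m + 150 * D \<le> N m'" if "m < m'" "m' \<le> M" for m m'
  proof -
    have "1 * (150 * D) \<le> (m' - m) * (150 * D)" using that by (intro mult_le_mono1) simp
    moreover have "N m + (m' - m) * (150 * D) \<le> N m'" using N_add[of m "m' - m"] that by simp
    ultimately show ?thesis by linarith
  qed
  have N_diff: "N m' = N m + (\<Sum>i=m..<m'. d (q i) (q (Suc i)))" if "m \<le> m'" for m m'
    unfolding N_def lessThan_atLeast0 using that by (simp add: sum.atLeastLessThan_concat)
  have "quasi_geodesic window 0 r (N M)"
    unfolding quasi_geodesic_def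
  proof (intro allI impI)
    fix i j assume ij: "i \<le> j" "j \<le> N M" "j \<le> i + window"
    show "j \<le> i + d (r i) (r j) + 0"
    proof (cases "i = j")
      case False
      define m where "m = (GREATEST m. m \<le> M \<and> N m \<le> i)"
      define m' where "m' = (LEAST m. j \<le> N m)"
      have ex: "0 \<le> M \<and> N 0 \<le> i" by (simp add: N_def)
      have m: "m \<le> M" "N m \<le> i"
        using GreatestI_nat[of "\<lambda>m. m \<le> M \<and> N m \<le> i", OF ex, of M] by (auto simp: m_def)
      have m_max: "i < N l" if "m < l" "l \<le> M" for l
        using Greatest_le_nat[of "\<lambda>m. m \<le> M \<and> N m \<le> i" l M] that by (force simp: m_def not_le)
      have m': "j \<le> N m'" "m' \<le> M"
        using LeastI[of "\<lambda>m. j \<le> N m", OF ij(2)] Least_le[of "\<lambda>m. j \<le> N m", OF ij(2)] by (auto simp: m'_def)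
      have m'_min: "N l < j" if "l < m'" for l
        using not_less_Least[of l "\<lambda>m. j \<le> N m"] that by (auto simp: m'_def)
      have mm: "m < m'"
      proof (rule ccontr)
        assume "\<not> m < m'"
        then have "N m' \<le> N m" using N_mono[of m' m] m by (cases "m = m'") auto
        then show False using m m' False ij by linarith
      qed
      \<comment> \<open>Blocks of the new path have length at least \<open>150 * D\<close>, and
        \<open>134 * 150\<close> exceeds \<open>20000\<close>. On \<open>p\<close> the blocks met by
        a window therefore cover at most \<open>137 * 200 * D\<close>, which is within the doubled
        window on which \<open>geod\<close> applies.\<close>
      have "m' - m \<le> 136"
      proof (rule ccontr)
        assume "\<not> m' - m \<le> 136"
        then have l: "Suc m + 134 < m'" "Suc m + 134 \<le> M" "Suc m \<le> M" using m' by auto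
        have "i < N (Suc m)" using m_max[of "Suc m"] l by auto
        moreover have "N (Suc m + 134) < j" using m'_min l by auto
        ultimately show False using N_add[of "Suc m" 134] l ij D_pos by auto
      qed
      then have "(m' - m) * T \<le> 136 * T" by (rule mult_le_mono1)
      moreover have "s m' \<le> s m + (m' - m) * T + T" using s_upper[of m m'] mm m' by simp
      ultimately have "s m' \<le> s m + 2 * window" unfolding T_def by linarith
      then have 1: "N m' \<le> N m + d (q m) (q m')" using geod[of m m'] N_diff[of m m'] mm m' by auto
      have X: "r (N m) \<in> X" "r i \<in> X" "r j \<in> X" "r (N m') \<in> X" and le: "N m' \<le> N M"
        using path_in[OF r(1)] ij m m' N_mono[of m' M] by (cases "m' = M"; auto)+
      show ?thesis
        using 1 d_tri[OF X(1,2,4)] d_tri[OF X(2,3,4)] path_dist[OF r(1) m(2)] path_dist[OF r(1) m'(1) le]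
          ij m m' r(2)[of m] r(2)[of m'] by auto
    qed simp
  qed
  \<comment> \<open>Block by block, \<open>synchronous_frechet\<close> asks for
    \<open>(10 + 3 * 20 + 3) * D\<close>, which is below \<open>80 * D\<close>.\<close>
  moreover have "frechet d (80 * D) r p (N m) (s m)" if "m \<le> M" for m
    using that
  proof (induction m)
    case 0
    then show ?case using r(2)[of 0] q(1) pX[of 0] s0 by (auto intro!: frechet.start simp: N_def ok_def d_self)
  next
    case (Suc m)
    have N: "N (Suc m) = N m + d (q m) (q (Suc m))" by (simp add: N_def)
    have NM: "N (Suc m) \<le> N M" using N_mono[of "Suc m" M] Suc.prems by (cases "Suc m = M") auto
    have 1: "s (Suc m) \<le> s m + d (p (s m)) (p (s (Suc m))) + 10 * D"
      by (rule quasi_geodesicD[OF p2])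
        (use Suc.prems s_mono[of m "Suc m"] s_le[of "Suc m"] s_step(2)[of m] in \<open>auto simp: T_def\<close>)
    have X: "q m \<in> X" "q (Suc m) \<in> X" "p (s m) \<in> X" "p (s (Suc m)) \<in> X"
      using qX pX s_le Suc.prems by auto
    have 2: "d (q m) (q (Suc m)) \<le> d (q m) (p (s m)) + d (p (s m)) (p (s (Suc m))) + d (p (s (Suc m))) (q (Suc m))"
      using d_tri[OF X(1,3,2)] d_tri[OF X(3,4,2)] by linarith
    have 3: "d (q m) (q (Suc m)) \<le> 1000 * D"
      using 2 path_dist[OF p(1), of "s m" "s (Suc m)"] s_step[of m] s_le[of "Suc m"] Suc.prems qp[of m] qp[of "Suc m"]
        d_sym[OF X(2,4)] by (auto simp: T_def)
    show ?case
    proof (rule synchronous_frechet[OF r(1) p(1), where a = "N m" and b = "s m" and c = "10 * D" and e = "20 * D"])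
      show "s (Suc m) \<le> s m + d (p (s m)) (p (s (Suc m))) + 10 * D" by (rule 1)
    qed (use N NM r(2)[of m] r(2)[of "Suc m"] 3 qp[of m] qp[of "Suc m"] Suc s_step[of m] s_le[of "Suc m"]
        in \<open>auto simp: T_def\<close>)
  qed
  then have "frechet d (80 * D) r p (N M) n" using sM by auto
  moreover have "r 0 = p 0" "r (N M) = p n" using r(2)[of 0] r(2)[of M] q(1) by (auto simp: N_def ok_def)
  ultimately show ?thesis using r(1) by blast
qed

end

section \<open>Word metrics\<close>

abbreviation letters :: "('a, 'm) monoid_scheme \<Rightarrow> 'a set \<Rightarrow> 'a set" where
  "letters G S \<equiv> S \<union> (\<lambda>s. inv\<^bsub>G\<^esub> s) ` S"

abbreviation eval_word :: "('a, 'm) monoid_scheme \<Rightarrow> 'a list \<Rightarrow> 'a" where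
  "eval_word G w \<equiv> foldr (\<otimes>\<^bsub>G\<^esub>) w \<one>\<^bsub>G\<^esub>"

text \<open>The equivalence closure is the presentation by all relations between words of length at
  most \<open>N\<close>. Letters are elements of \<open>G\<close> and not formal symbols, so
  cancelling a letter against its inverse is itself a move as soon as
  \<open>2 \<le> N\<close>.\<close>

definition word_moves :: "('a, 'm) monoid_scheme \<Rightarrow> 'a set \<Rightarrow> nat \<Rightarrow> 'a list rel" where
  "word_moves G S N = {(x @ u @ y, x @ v @ y) | x u v y.
     set x \<subseteq> letters G S \<and> set u \<subseteq> letters G S \<and> set v \<subseteq> letters G S \<and> set y \<subseteq> letters G S \<and>
     length u \<le> N \<and> length v \<le> N \<and> eval_word G u = eval_word G v}"

locale word_group = group G for G (structure) +
  fixes S :: "'a set"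
  assumes generating: "finite_generating_set G S"
begin

abbreviation "A \<equiv> letters G S"
abbreviation "ev \<equiv> eval_word G"
abbreviation "len \<equiv> word_length G S"
abbreviation "dst \<equiv> word_dist G S"

lemma S_carrier: "S \<subseteq> carrier G"
  using generating by (auto simp: finite_generating_set_def)

lemma letters_carrier: "A \<subseteq> carrier G"
  using S_carrier by auto

lemma letters_inv: "a \<in> A \<Longrightarrow> inv a \<in> A"
  using S_carrier by (auto intro: imageI)

lemma ev_closed: "set w \<subseteq> A \<Longrightarrow> ev w \<in> carrier G"
  using letters_carrier by (induction w) auto

lemma ev_append: "set u \<subseteq> A \<Longrightarrow> set v \<subseteq> A \<Longrightarrow> ev (u @ v) = ev u \<otimes> ev v"
proof (induction u)
  case (Cons a u)
  then have "a \<in> carrier G" "ev u \<in> carrier G" "ev v \<in> carrier G"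
    using letters_carrier ev_closed[of u] ev_closed[of v] by auto
  then show ?case using Cons by (simp add: m_assoc)
qed (simp add: ev_closed)

lemma ex_word: "g \<in> carrier G \<Longrightarrow> \<exists>w. set w \<subseteq> A \<and> ev w = g"
proof -
  assume "g \<in> carrier G"
  then have "g \<in> generate G S" using generating by (simp add: finite_generating_set_def)
  then show ?thesis
  proof (induction rule: generate.induct)
    case one
    then show ?case by (intro exI[of _ "[]"]) auto
  next
    case (incl h)
    then show ?case using S_carrier by (intro exI[of _ "[h]"]) auto
  next
    case (inv h)
    then show ?case using S_carrier by (intro exI[of _ "[inv h]"]) auto
  next
    case (eng h1 h2)
    then obtain u v where "set u \<subseteq> A" "ev u = h1" "set v \<subseteq> A" "ev v = h2" by blast
    then show ?case using ev_append[of u v] by (intro exI[of _ "u @ v"]) auto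
  qed
qed

lemma len_le: "set w \<subseteq> A \<Longrightarrow> len (ev w) \<le> length w"
  unfolding word_length_def by (rule Least_le) auto

lemma ex_geodesic_word: "g \<in> carrier G \<Longrightarrow> \<exists>w. set w \<subseteq> A \<and> ev w = g \<and> length w = len g"
proof -
  assume "g \<in> carrier G"
  then have "\<exists>n ws. length ws = n \<and> set ws \<subseteq> A \<and> ev ws = g" using ex_word by blast
  then show ?thesis unfolding word_length_def by (rule LeastI2_ex) blast
qed

lemma len_one: "len \<one> = 0"
  using len_le[of "[]"] by simp

lemma len_zero: "g \<in> carrier G \<Longrightarrow> len g = 0 \<Longrightarrow> g = \<one>"
  using ex_geodesic_word[of g] by auto

lemma len_mult: "g \<in> carrier G \<Longrightarrow> h \<in> carrier G \<Longrightarrow> len (g \<otimes> h) \<le> len g + len h"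
proof -
  assume "g \<in> carrier G" "h \<in> carrier G"
  then obtain u v where u: "set u \<subseteq> A" "ev u = g" "length u = len g"
    and v: "set v \<subseteq> A" "ev v = h" "length v = len h"
    using ex_geodesic_word by metis
  then show ?thesis using len_le[of "u @ v"] ev_append[of u v] by auto
qed

lemma ex_inverse_word: "set w \<subseteq> A \<Longrightarrow> \<exists>v. set v \<subseteq> A \<and> ev v = inv (ev w) \<and> length v = length w"
proof (induction w)
  case Nil
  then show ?case by auto
next
  case (Cons a w)
  then obtain v where v: "set v \<subseteq> A" "ev v = inv (ev w)" "length v = length w" by auto
  have a: "a \<in> A" "a \<in> carrier G" "ev w \<in> carrier G" using Cons.prems letters_carrier ev_closed[of w] by auto
  have ia: "inv a \<in> A" using letters_inv[OF a(1)] .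
  then have "set (v @ [inv a]) \<subseteq> A" using v by auto
  moreover have "ev (v @ [inv a]) = inv (ev (a # w))"
    using ev_append[of v "[inv a]"] v ia a by (simp add: inv_mult_group del: foldr_append)
  ultimately show ?case using v by (intro exI[of _ "v @ [inv a]"]) auto
qed

lemma len_inv_le: "g \<in> carrier G \<Longrightarrow> len (inv g) \<le> len g"
  using ex_geodesic_word[of g] ex_inverse_word len_le by metis

lemma len_inv: "g \<in> carrier G \<Longrightarrow> len (inv g) = len g"
  using len_inv_le[of g] len_inv_le[of "inv g"] by auto

lemma len_letter: "a \<in> A \<Longrightarrow> len a \<le> 1"
  using len_le[of "[a]"] letters_carrier by auto

lemma dst_one: "g \<in> carrier G \<Longrightarrow> dst \<one> g = len g"
  by (simp add: word_dist_def)

lemma dst_translate: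
  "x \<in> carrier G \<Longrightarrow> g \<in> carrier G \<Longrightarrow> h \<in> carrier G \<Longrightarrow> dst (x \<otimes> g) (x \<otimes> h) = dst g h"
proof -
  assume c: "x \<in> carrier G" "g \<in> carrier G" "h \<in> carrier G"
  then have "inv x \<otimes> (x \<otimes> h) = h" by (simp add: m_assoc[symmetric])
  then show ?thesis using c by (simp add: word_dist_def inv_mult_group m_assoc)
qed

lemma dst_mult_right: "x \<in> carrier G \<Longrightarrow> g \<in> carrier G \<Longrightarrow> dst x (x \<otimes> g) = len g"
  by (simp add: word_dist_def m_assoc[symmetric])

sublocale nat_metric "carrier G" "word_dist G S"
proof
  fix x y z assume x: "x \<in> carrier G" and y: "y \<in> carrier G"
  show "dst x x = 0" using x by (simp add: word_dist_def len_one)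
  show "x = y" if "dst x y = 0"
  proof -
    have "inv x \<otimes> y = \<one>" using len_zero[of "inv x \<otimes> y"] that x y by (simp add: word_dist_def)
    then show ?thesis using x y by (metis inv_closed inv_equality inv_inv)
  qed
  show "dst x y = dst y x"
    using len_inv[of "inv x \<otimes> y"] x y by (simp add: word_dist_def inv_mult_group)
  assume z: "z \<in> carrier G"
  have "inv x \<otimes> z = (inv x \<otimes> y) \<otimes> (inv y \<otimes> z)"
    using x y z by (simp add: m_assoc[symmetric]) (simp add: m_assoc)
  then show "dst x z \<le> dst x y + dst y z"
    using len_mult[of "inv x \<otimes> y" "inv y \<otimes> z"] x y z by (simp add: word_dist_def)
qed

definition trace :: "'a \<Rightarrow> 'a list \<Rightarrow> nat \<Rightarrow> 'a" where
  "trace x w i = x \<otimes> ev (take i w)"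

lemma set_take: "set w \<subseteq> A \<Longrightarrow> set (take i w) \<subseteq> A"
  using set_take_subset by fastforce

lemma trace_0: "x \<in> carrier G \<Longrightarrow> trace x w 0 = x"
  by (simp add: trace_def)

lemma trace_Suc:
  assumes "x \<in> carrier G" "set w \<subseteq> A" "i < length w"
  shows "trace x w (Suc i) = trace x w i \<otimes> w ! i"
proof -
  have wi: "w ! i \<in> A" "w ! i \<in> carrier G" using assms letters_carrier nth_mem by blast+
  have "ev (take (Suc i) w) = ev (take i w) \<otimes> w ! i"
    using ev_append[of "take i w" "[w ! i]"] wi set_take[OF assms(2), of i] assms
    by (simp add: take_Suc_conv_app_nth del: foldr_append)
  then show ?thesis
    using assms wi ev_closed[OF set_take[OF assms(2), of i]] by (simp add: trace_def m_assoc)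
qed

lemma trace_closed: "x \<in> carrier G \<Longrightarrow> set w \<subseteq> A \<Longrightarrow> trace x w i \<in> carrier G"
  using ev_closed[OF set_take] by (simp add: trace_def)

lemma trace_path: "x \<in> carrier G \<Longrightarrow> set w \<subseteq> A \<Longrightarrow> path (trace x w) (length w)"
  unfolding path_def
proof (intro conjI allI impI)
  fix i assume i: "x \<in> carrier G" "set w \<subseteq> A" "i < length w"
  then have wi: "w ! i \<in> A" using nth_mem by blast
  then have "w ! i \<in> carrier G" using letters_carrier by blast
  with i show "dst (trace x w i) (trace x w (Suc i)) \<le> 1"
    using dst_mult_right[of "trace x w i" "w ! i"] trace_closed[of x w i] len_letter[OF wi]
      by (simp add: trace_Suc)
qed (simp add: trace_closed)

text \<open>A step of length exactly one is a geodesic word with one letter. A \<open>path\<close>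
  may also stand still, which the one-letter encoding does not provide for; hence the assumption
  \<open>unit\<close>.\<close>

lemma ex_trace:
  assumes p: "path p n" and unit: "\<And>i. i < n \<Longrightarrow> dst (p i) (p (Suc i)) = 1"
  shows "\<exists>w. set w \<subseteq> A \<and> length w = n \<and> (\<forall>i\<le>n. trace (p 0) w i = p i)"
proof (intro exI conjI)
  let ?w = "map (\<lambda>i. inv (p i) \<otimes> p (Suc i)) [0..<n]"
  have X: "i \<le> n \<Longrightarrow> p i \<in> carrier G" for i using p by (simp add: path_def)
  have letter: "inv (p i) \<otimes> p (Suc i) \<in> A" if "i < n" for i
  proof -
    have "len (inv (p i) \<otimes> p (Suc i)) = 1" using unit[OF that] by (simp add: word_dist_def)
    moreover have "inv (p i) \<otimes> p (Suc i) \<in> carrier G" using X that by simp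
    ultimately obtain v where v: "set v \<subseteq> A" "ev v = inv (p i) \<otimes> p (Suc i)" "length v = 1"
      using ex_geodesic_word by metis
    then obtain a where a: "v = [a]" by (cases v) auto
    then have "a \<in> A" "a \<in> carrier G" using v(1) letters_carrier by auto
    then show ?thesis using v(2) a by simp
  qed
  show w: "set ?w \<subseteq> A" using letter by (simp add: image_subset_iff del: Un_iff)
  show "length ?w = n" by simp
  show "\<forall>i\<le>n. trace (p 0) ?w i = p i"
  proof (intro allI impI)
    fix i assume "i \<le> n"
    then show "trace (p 0) ?w i = p i"
    proof (induction i)
      case 0
      then show ?case using X[of 0] by (simp add: trace_0)
    next
      case (Suc i)
      have "p i \<otimes> (inv (p i) \<otimes> p (Suc i)) = p (Suc i)"
        using X[of i] X[of "Suc i"] Suc.prems by (simp add: m_assoc[symmetric])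
      then show ?case using trace_Suc[OF _ w, of "p 0" i] Suc X[of 0] by simp
    qed
  qed
qed

lemma word_geodesic:
  assumes "x \<in> carrier G" "y \<in> carrier G"
  shows "\<exists>p. path p (dst x y) \<and> p 0 = x \<and> p (dst x y) = y"
proof -
  obtain w where w: "set w \<subseteq> A" "ev w = inv x \<otimes> y" "length w = dst x y"
    using ex_geodesic_word[of "inv x \<otimes> y"] assms by (auto simp: word_dist_def)
  have "trace x w (dst x y) = y"
    using w assms by (simp add: trace_def m_assoc[symmetric])
  then show ?thesis using trace_path[OF assms(1) w(1)] w assms trace_0 by (intro exI[of _ "trace x w"]) auto
qed

lemma word_movesD:
  "(w, w') \<in> word_moves G S N \<Longrightarrow> set w \<subseteq> A \<and> set w' \<subseteq> A \<and> ev w = ev w'"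
  by (auto simp: word_moves_def ev_append simp del: foldr_append)

end

section \<open>A Cartan--Hadamard theorem for word metrics\<close>

text \<open>The last assumption is simple connectedness at scale \<open>20 * D\<close>. This scale
  stays below the end gap \<open>66 * D\<close> that \<open>contract\<close> tolerates, so half a
  relation can be developed letter by letter without losing the original path.\<close>

locale cartan_hadamard = word_group +
  fixes D :: nat
  assumes D_positive: "1 \<le> D"
    and local_four_point: "\<lbrakk>x \<in> carrier G; y \<in> carrier G; z \<in> carrier G; w \<in> carrier G;
        dst x y \<le> 100000 * D; dst x z \<le> 100000 * D; dst x w \<le> 100000 * D\<rbrakk> \<Longrightarrow>
      dst x y + dst z w \<le> dst x z + dst y w + 2 * D \<or> dst x y + dst z w \<le> dst x w + dst y z + 2 * D"
    and coarsely_simply_connected: "\<lbrakk>set u \<subseteq> A; set v \<subseteq> A; ev u = ev v\<rbrakk> \<Longrightarrow>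
      (u, v) \<in> (word_moves G S (20 * D))\<^sup>*"
begin

sublocale locally_hyperbolic "carrier G" "word_dist G S" D
  by unfold_locales (use word_geodesic D_positive local_four_point in auto)

section \<open>Developing words into straight paths\<close>

definition straight :: "'a \<Rightarrow> (nat \<Rightarrow> 'a) \<times> nat \<Rightarrow> bool" where
  "straight x = (\<lambda>(p, n). path p n \<and> quasi_geodesic window 0 p n \<and> p 0 = x)"

definition close :: "(nat \<Rightarrow> 'a) \<times> nat \<Rightarrow> (nat \<Rightarrow> 'a) \<times> nat \<Rightarrow> bool" where
  "close = (\<lambda>(p, n) (q, m). frechet dst (270 * D) p q n m \<and> p n = q m)"

definition extend :: "(nat \<Rightarrow> 'a) \<Rightarrow> nat \<Rightarrow> 'a \<Rightarrow> nat \<Rightarrow> 'a" where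
  "extend p n a = p(Suc n := p n \<otimes> a)"

text \<open>A straightened path is not unique. \<open>SOME\<close> fixes one choice, and comparisons
  of developments are made only up to \<open>close\<close>, which no choice can affect.\<close>

definition develop_step :: "(nat \<Rightarrow> 'a) \<times> nat \<Rightarrow> 'a \<Rightarrow> (nat \<Rightarrow> 'a) \<times> nat" where
  "develop_step = (\<lambda>(p, n) a. SOME (r, l). path r l \<and> quasi_geodesic window 0 r l \<and> r 0 = p 0 \<and>
     r l = p n \<otimes> a \<and> frechet dst (80 * D) r (extend p n a) l (Suc n))"

definition develop :: "(nat \<Rightarrow> 'a) \<times> nat \<Rightarrow> 'a list \<Rightarrow> (nat \<Rightarrow> 'a) \<times> nat" where
  "develop = foldl develop_step"

text \<open>A new letter adds one to the length of the path and may take one off the distance of its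
  end: this is the defect 2 from which \<open>straighten\<close> starts.\<close>

lemma extend_path:
  assumes "straight x (p, n)" "a \<in> A"
  shows "path (extend p n a) (Suc n)" "quasi_geodesic window 2 (extend p n a) (Suc n)"
proof -
  have p: "path p n" "quasi_geodesic window 0 p n" using assms by (auto simp: straight_def)
  have X: "i \<le> n \<Longrightarrow> p i \<in> carrier G" for i using p by (simp add: path_def)
  have a: "a \<in> carrier G" using assms letters_carrier by blast
  have last: "dst (p n) (p n \<otimes> a) \<le> 1" using dst_mult_right[OF X a] len_letter[OF assms(2)] by simp
  show path: "path (extend p n a) (Suc n)"
    using p X a last by (auto simp: path_def extend_def less_Suc_eq le_Suc_eq)
  show "quasi_geodesic window 2 (extend p n a) (Suc n)"
    unfolding quasi_geodesic_def
  proof (intro allI impI)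
    fix i j assume ij: "i \<le> j" "j \<le> Suc n" "j \<le> i + window"
    consider "j \<le> n" | "j = Suc n" "i = Suc n" | "j = Suc n" "i \<le> n" using ij by linarith
    then show "j \<le> i + dst (extend p n a i) (extend p n a j) + 2"
    proof cases
      case 1
      then show ?thesis using quasi_geodesicD[OF p(2), of i j] ij by (simp add: extend_def)
    next
      case 3
      have "n \<le> i + dst (p i) (p n) + 0" by (rule quasi_geodesicD[OF p(2)]) (use 3 ij in auto)
      moreover have "dst (p i) (p n) \<le> dst (p i) (p n \<otimes> a) + dst (p n) (p n \<otimes> a)"
        using d_tri[of "p i" "p n \<otimes> a" "p n"] d_sym[of "p n" "p n \<otimes> a"] X 3 a by auto
      ultimately show ?thesis using 3 last by (auto simp: extend_def)
    qed simp
  qed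
qed

lemma develop_step:
  assumes "straight x (p, n)" "a \<in> A" "develop_step (p, n) a = (r, l)"
  shows "straight x (r, l)" "r l = p n \<otimes> a" "frechet dst (80 * D) r (extend p n a) l (Suc n)"
proof -
  have "\<exists>r l. path r l \<and> quasi_geodesic window 0 r l \<and> r 0 = p 0 \<and>
     r l = p n \<otimes> a \<and> frechet dst (80 * D) r (extend p n a) l (Suc n)"
    using straighten[OF extend_path[OF assms(1,2)]] by (simp add: extend_def)
  then have "case develop_step (p, n) a of (r, l) \<Rightarrow> path r l \<and> quasi_geodesic window 0 r l \<and> r 0 = p 0 \<and>
     r l = p n \<otimes> a \<and> frechet dst (80 * D) r (extend p n a) l (Suc n)"
    unfolding develop_step_def prod.case by (intro someI_ex[of "\<lambda>(r, l). _ r l"]) auto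
  then show "straight x (r, l)" "r l = p n \<otimes> a" "frechet dst (80 * D) r (extend p n a) l (Suc n)"
    using assms by (auto simp: straight_def)
qed

lemma straight_quasi: "straight x (p, n) \<Longrightarrow> path p n \<and> quasi_geodesic window (60 * D) p n \<and> p 0 = x"
  by (auto simp: straight_def intro: quasi_geodesic_mono)

lemma develop:
  assumes "straight x s" "set w \<subseteq> A"
  shows "straight x (develop s w)"
  using assms(2)
proof (induction w rule: rev_induct)
  case Nil
  then show ?case using assms by (simp add: develop_def)
next
  case (snoc a w)
  then show ?case
    using develop_step(1)[of x "fst (develop s w)" "snd (develop s w)" a
        "fst (develop_step (develop s w) a)" "snd (develop_step (develop s w) a)"]
    by (simp add: develop_def)
qed

lemma develop_end:
  assumes "straight x (p, n)" "set w \<subseteq> A" "develop (p, n) w = (r, l)"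
  shows "r l = p n \<otimes> ev w"
  using assms(2,3)
proof (induction w arbitrary: r l rule: rev_induct)
  case Nil
  then show ?case using assms(1) by (auto simp: develop_def straight_def path_def)
next
  case (snoc a w)
  obtain r' l' where r': "develop (p, n) w = (r', l')" by force
  have st: "straight x (r', l')" using develop[OF assms(1), of w] r' snoc.prems by auto
  have a: "a \<in> A" "set w \<subseteq> A" using snoc.prems by auto
  have c: "a \<in> carrier G" "ev w \<in> carrier G" "p n \<in> carrier G"
    using a letters_carrier ev_closed[OF a(2)] assms(1) by (auto simp: straight_def path_def)
  have "develop_step (r', l') a = (r, l)" using snoc.prems r' by (simp add: develop_def)
  from develop_step(2)[OF st a(1) this] have "r l = r' l' \<otimes> a" .
  also have "\<dots> = p n \<otimes> (ev w \<otimes> a)" using snoc.IH[OF a(2) r'] c by (simp add: m_assoc)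
  also have "ev w \<otimes> a = ev (w @ [a])" using ev_append[of w "[a]"] a c by (simp del: foldr_append)
  finally show ?case .
qed

lemma contract:
  assumes "path p n" "quasi_geodesic window (60 * D) p n" "path q m" "quasi_geodesic window (60 * D) q m"
    "p 0 = q 0" "frechet dst E p q n m" "E \<le> 1000 * D" "dst (p n) (q m) \<le> 66 * D"
  shows "frechet dst (270 * D) p q n m"
  by (rule frechet_contract[OF assms])

lemma frechet_path_trans:
  "frechet dst E p q n m \<Longrightarrow> frechet dst F q r m l \<Longrightarrow> path p n \<Longrightarrow> path q m \<Longrightarrow> path r l \<Longrightarrow>
    frechet dst (E + F) p r n l"
  by (erule (1) frechet_trans) (auto simp: path_def)

lemma frechet_path_sym: "frechet dst E p q n m \<Longrightarrow> path p n \<Longrightarrow> path q m \<Longrightarrow> frechet dst E q p m n"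
  by (erule frechet_sym) (auto simp: path_def)

lemma close_refl:
  assumes "straight x s" shows "close s s"
proof -
  obtain p n where s: "s = (p, n)" by force
  have p: "path p n" using assms s by (simp add: straight_def)
  have "frechet dst (270 * D) p p i i" if "i \<le> n" for i
    using that
  proof (induction i)
    case 0
    then show ?case using path_in[OF p, of 0] by (auto intro!: frechet.start simp: d_self)
  next
    case (Suc i)
    have X: "p i \<in> carrier G" "p (Suc i) \<in> carrier G" using path_in[OF p] Suc.prems by auto
    have "dst (p (Suc i)) (p i) \<le> 270 * D"
      using path_step[OF p, of i] Suc.prems d_sym[OF X] D_positive by auto
    then have "frechet dst (270 * D) p p (Suc i) i" using Suc by (intro frechet.left) auto
    then show ?case using X by (intro frechet.right) (auto simp: d_self)
  qed
  then show ?thesis by (simp add: close_def s)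
qed

text \<open>Composition gives \<open>540 * D\<close>, and \<open>contract\<close> brings it back to
  \<open>270 * D\<close>. So \<open>close\<close> is transitive without loss, and chains of any
  length are harmless.\<close>

lemma close_trans:
  assumes "straight x s" "straight x t" "straight x u" "close s t" "close t u"
  shows "close s u"
proof -
  obtain p n q m r l where eq: "s = (p, n)" "t = (q, m)" "u = (r, l)" by (metis surj_pair)
  note st = assms[unfolded eq]
  have P: "path p n" "path q m" "path r l" using straight_quasi[OF st(1)] straight_quasi[OF st(2)]
    straight_quasi[OF st(3)] by auto
  have "frechet dst (270 * D + 270 * D) p r n l"
    by (rule frechet_path_trans[OF _ _ P]) (use st in \<open>auto simp: close_def\<close>)
  moreover have "p n = r l" using st by (auto simp: close_def)
  ultimately show ?thesis
    unfolding close_def eq prod.case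
    using contract[of p n r l "270 * D + 270 * D"] straight_quasi[OF st(1)] straight_quasi[OF st(3)]
      path_in[OF P(3)] by (auto simp: d_self)
qed

text \<open>Straightening costs \<open>80 * D\<close> on either side, which makes
  \<open>430 * D\<close> together with the old bound; the new ends coincide, so
  \<open>contract\<close> restores \<open>270 * D\<close>.\<close>

lemma close_step:
  assumes "straight x s" "straight x t" "close s t" "a \<in> A"
  shows "close (develop_step s a) (develop_step t a)"
proof -
  obtain p n q m where eq: "s = (p, n)" "t = (q, m)" by (metis surj_pair)
  obtain p' n' q' m' where eq': "develop_step s a = (p', n')" "develop_step t a = (q', m')" by (metis surj_pair)
  note st = assms[unfolded eq] and eq2 = eq'[unfolded eq]
  note P = develop_step[OF st(1,4) eq2(1)] and Q = develop_step[OF st(2,4) eq2(2)]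
  have e: "p n = q m" "frechet dst (270 * D) p q n m" using st(3) by (auto simp: close_def)
  have X: "p n \<in> carrier G" "q m \<in> carrier G" "a \<in> carrier G" "p n \<otimes> a \<in> carrier G"
    using st letters_carrier by (auto simp: straight_def path_def)
  have pq: "path p n" "path q m" using st by (auto simp: straight_def)
  let ?p = "extend p n a" and ?q = "extend q m a"
  have "frechet dst (270 * D) ?p ?q n m"
    by (rule frechet_cong[OF e(2)]) (auto simp: extend_def)
  moreover have "dst (?p (Suc n)) (?q m) \<le> 270 * D"
    using dst_mult_right[OF X(1,3)] len_letter[OF assms(4)] d_sym[OF X(4,2)] e D_positive
    by (simp add: extend_def)
  ultimately have "frechet dst (270 * D) ?p ?q (Suc n) m" by (rule frechet.left)
  then have "frechet dst (270 * D) ?p ?q (Suc n) (Suc m)"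
    using X e by (intro frechet.right) (auto simp: extend_def d_self)
  from frechet_path_trans[OF P(3) this] have "frechet dst (80 * D + 270 * D) p' ?q n' (Suc m)"
    using straight_quasi[OF P(1)] extend_path[OF st(1,4)] extend_path[OF st(2,4)] by auto
  from frechet_path_trans[OF this frechet_path_sym[OF Q(3)]]
  have "frechet dst (80 * D + 270 * D + 80 * D) p' q' n' m'"
    using straight_quasi[OF P(1)] straight_quasi[OF Q(1)] extend_path[OF st(2,4)] by auto
  then have "frechet dst (270 * D) p' q' n' m'"
    using straight_quasi[OF P(1)] straight_quasi[OF Q(1)] P(2) Q(2) e X
    by (intro contract[where E = "80 * D + 270 * D + 80 * D"]) (auto simp: d_self)
  then show ?thesis using P(2) Q(2) e by (simp add: close_def eq')
qed

lemma close_develop: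
  assumes "straight x s" "straight x t" "close s t" "set w \<subseteq> A"
  shows "close (develop s w) (develop t w)"
  using assms(4)
proof (induction w rule: rev_induct)
  case Nil
  then show ?case using assms by (simp add: develop_def)
next
  case (snoc a w)
  then have "close (develop_step (develop s w) a) (develop_step (develop t w) a)"
    using develop[OF assms(1)] develop[OF assms(2)] by (intro close_step) auto
  then show ?case by (simp add: develop_def)
qed

text \<open>After each letter the end of the developed path is still within \<open>20 * D\<close> of
  the old end, so \<open>contract\<close> applies again. The number of letters enters only through
  this distance.\<close>

lemma develop_short:
  assumes "straight x (p, n)" "set w \<subseteq> A" "length w \<le> 20 * D" "develop (p, n) w = (r, l)"
  shows "frechet dst (270 * D) r p l n"
  using assms(2-)
proof (induction w arbitrary: r l rule: rev_induct)
  case Nil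
  then show ?case using close_refl[OF assms(1)] by (auto simp: develop_def close_def)
next
  case (snoc a w)
  obtain r' l' where r': "develop (p, n) w = (r', l')" by force
  have st: "straight x (r', l')" using develop[OF assms(1), of w] r' snoc.prems by auto
  have a: "a \<in> A" "set w \<subseteq> A" using snoc.prems by auto
  have st': "straight x (r, l)" using develop[OF assms(1), of "w @ [a]"] snoc.prems by auto
  have IH: "frechet dst (270 * D) r' p l' n" using snoc r' by auto
  have X: "p n \<in> carrier G" using assms by (auto simp: straight_def path_def)
  have fin: "r l = p n \<otimes> ev (w @ [a])" using develop_end[OF assms(1) _ snoc.prems(3)] snoc.prems by auto
  have evc: "ev (w @ [a]) \<in> carrier G" by (rule ev_closed) (use snoc.prems in auto)
  have "dst (p n) (r l) \<le> 20 * D"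
    using fin dst_mult_right[OF X evc] len_le[of "w @ [a]"] snoc.prems by auto
  then have e: "dst (r l) (p n) \<le> 20 * D" using d_sym[OF X, of "r l"] fin X evc by auto
  have step: "develop_step (r', l') a = (r, l)" using snoc.prems r' by (simp add: develop_def)
  note R = develop_step[OF st a(1) step]
  have "frechet dst (270 * D) (extend r' l' a) p l' n"
    by (rule frechet_cong[OF IH]) (auto simp: extend_def)
  moreover have "dst (extend r' l' a (Suc l')) (p n) \<le> 270 * D" using e R(2) by (simp add: extend_def)
  ultimately have "frechet dst (270 * D) (extend r' l' a) p (Suc l') n" by (rule frechet.left)
  from frechet_path_trans[OF R(3) this] have "frechet dst (80 * D + 270 * D) r p l n"
    using straight_quasi[OF st'] extend_path[OF st a(1)] straight_quasi[OF assms(1)] by auto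
  then show ?case
    using straight_quasi[OF st'] straight_quasi[OF assms(1)] e
    by (intro contract[where E = "80 * D + 270 * D"]) auto
qed

text \<open>Developing either side of a short relation stays close to the path before it, so the two
  results are close to each other. They end at the same element, and the remaining letters preserve
  closeness.\<close>

lemma develop_move:
  assumes "straight x s" "(w, w') \<in> word_moves G S (20 * D)"
  shows "close (develop s w) (develop s w')"
proof -
  obtain a u v b where w: "w = a @ u @ b" "w' = a @ v @ b" "set a \<subseteq> A" "set u \<subseteq> A" "set v \<subseteq> A" "set b \<subseteq> A"
    "length u \<le> 20 * D" "length v \<le> 20 * D" "ev u = ev v"
    using assms(2) by (auto simp: word_moves_def)
  obtain p n where s: "develop s a = (p, n)" by force
  have st: "straight x (p, n)" using develop[OF assms(1) w(3)] s by simp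
  obtain r l r' l' where r: "develop (p, n) u = (r, l)" "develop (p, n) v = (r', l')" by force
  have R: "straight x (r, l)" "straight x (r', l')" using develop[OF st w(4)] develop[OF st w(5)] r by auto
  have "frechet dst (270 * D + 270 * D) r r' l l'"
    by (rule frechet_path_trans[OF develop_short[OF st w(4,7) r(1)]
          frechet_path_sym[OF develop_short[OF st w(5,8) r(2)]]])
      (use straight_quasi[OF R(1)] straight_quasi[OF R(2)] straight_quasi[OF st] in auto)
  moreover have "r l = r' l'" using develop_end[OF st w(4) r(1)] develop_end[OF st w(5) r(2)] w by simp
  moreover have "r' l' \<in> carrier G" using R by (auto simp: straight_def path_def)
  ultimately have "close (r, l) (r', l')"
    unfolding close_def prod.case using straight_quasi[OF R(1)] straight_quasi[OF R(2)]
    by (auto intro!: contract[where E = "270 * D + 270 * D"] simp: d_self)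
  then have "close (develop (r, l) b) (develop (r', l') b)" by (rule close_develop[OF R _ w(6)])
  moreover have "develop s w = develop (r, l) b" "develop s w' = develop (r', l') b"
    using s r by (auto simp: develop_def w)
  ultimately show ?thesis by simp
qed

lemma develop_moves:
  assumes "straight x s" "(w, w') \<in> (word_moves G S (20 * D))\<^sup>*" "set w \<subseteq> A"
  shows "set w' \<subseteq> A \<and> close (develop s w) (develop s w')"
  using assms(2)
proof (induction rule: rtrancl_induct)
  case base
  then show ?case using close_refl[OF develop] assms by blast
next
  case (step y z)
  then have y: "set y \<subseteq> A" "set z \<subseteq> A" using word_movesD by auto
  show ?case
    using close_trans[OF develop[OF assms(1,3)] develop[OF assms(1) y(1)] develop[OF assms(1) y(2)]]
      develop_move[OF assms(1) step(2)] step.IH y by blast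
qed

lemma quasi_geodesic_prefix: "quasi_geodesic k c p n \<Longrightarrow> m \<le> n \<Longrightarrow> quasi_geodesic k c p m"
  by (simp add: quasi_geodesic_def)

lemma quasi_geodesic_cong:
  "quasi_geodesic k c p n \<Longrightarrow> (\<And>i. i \<le> n \<Longrightarrow> q i = p i) \<Longrightarrow> quasi_geodesic k c q n"
  unfolding quasi_geodesic_def by simp

lemma path_prefix: "path p n \<Longrightarrow> m \<le> n \<Longrightarrow> path p m"
  by (simp add: path_def)

text \<open>Induction over the prefixes: developed path and trace have the same origin and the same
  end after each letter, so the cost of the straightening is contracted away every time.\<close>

lemma develop_quasi_geodesic:
  assumes x: "x \<in> carrier G" and w: "set w \<subseteq> A"
    and q: "quasi_geodesic window (60 * D) (trace x w) (length w)"
    and i: "i \<le> length w" and r: "develop ((\<lambda>_. x), 0) (take i w) = (r, l)"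
  shows "frechet dst (270 * D) r (trace x w) l i"
  using i r
proof (induction i arbitrary: r l)
  case 0
  then show ?case using x by (auto intro!: frechet.start simp: develop_def trace_0 d_self)
next
  case (Suc i)
  have st0: "straight x ((\<lambda>_. x), 0)" using x by (simp add: straight_def path_def quasi_geodesic_def)
  obtain r' l' where r': "develop ((\<lambda>_. x), 0) (take i w) = (r', l')" by force
  have st: "straight x (r', l')" using develop[OF st0 set_take[OF w], of i] r' by simp
  have st': "straight x (r, l)" using develop[OF st0 set_take[OF w], of "Suc i"] Suc.prems by simp
  have a: "w ! i \<in> A" using Suc.prems(1) w nth_mem by (meson Suc_le_eq subsetD)
  have "develop ((\<lambda>_. x), 0) (take (Suc i) w) = develop_step (develop ((\<lambda>_. x), 0) (take i w)) (w ! i)"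
    using Suc.prems(1) by (simp add: develop_def take_Suc_conv_app_nth)
  then have step: "develop_step (r', l') (w ! i) = (r, l)" using r' Suc.prems by simp
  note R = develop_step[OF st a step]
  have IH: "frechet dst (270 * D) r' (trace x w) l' i" using Suc r' by auto
  have fin: "r l = trace x w (Suc i)" using develop_end[OF st0 set_take[OF w] Suc.prems(2)] by (simp add: trace_def)
  have X: "trace x w i \<in> carrier G" "trace x w (Suc i) \<in> carrier G" using trace_closed[OF x w] by auto
  have P: "path (trace x w) (length w)" by (rule trace_path[OF x w])
  have "frechet dst (270 * D) (extend r' l' (w ! i)) (trace x w) l' i"
    by (rule frechet_cong[OF IH]) (auto simp: extend_def)
  moreover have "dst (extend r' l' (w ! i) (Suc l')) (trace x w i) \<le> 270 * D"
    using path_step[OF P, of i] Suc.prems(1) R(2) fin d_sym[OF X] D_positive by (simp add: extend_def)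
  ultimately have "frechet dst (270 * D) (extend r' l' (w ! i)) (trace x w) (Suc l') i" by (rule frechet.left)
  then have "frechet dst (270 * D) (extend r' l' (w ! i)) (trace x w) (Suc l') (Suc i)"
    using R(2) fin X by (intro frechet.right) (auto simp: extend_def d_self)
  from frechet_path_trans[OF R(3) this] have "frechet dst (80 * D + 270 * D) r (trace x w) l (Suc i)"
    using straight_quasi[OF st'] extend_path[OF st a] path_prefix[OF P Suc.prems(1)] by auto
  then show ?case
    using straight_quasi[OF st'] path_prefix[OF P Suc.prems(1)] quasi_geodesic_prefix[OF q Suc.prems(1)] fin X x
    by (intro contract[where E = "80 * D + 270 * D"]) (auto simp: trace_0 d_self)
qed

text \<open>Both paths are close to the path developed along any word for their common endpoint.\<close>

theorem quasi_geodesics_close: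
  assumes p: "path p n" "quasi_geodesic window (60 * D) p n" "\<And>i. i < n \<Longrightarrow> dst (p i) (p (Suc i)) = 1"
    and q: "path q m" "quasi_geodesic window (60 * D) q m" "\<And>i. i < m \<Longrightarrow> dst (q i) (q (Suc i)) = 1"
    and ends: "p 0 = q 0" "p n = q m"
  shows "frechet dst (270 * D) p q n m"
proof -
  define x where "x = p 0"
  have x: "x \<in> carrier G" using p by (auto simp: x_def path_def)
  obtain u where u: "set u \<subseteq> A" "length u = n" "\<And>i. i \<le> n \<Longrightarrow> trace x u i = p i"
    using ex_trace[OF p(1,3)] by (auto simp: x_def)
  obtain v where v: "set v \<subseteq> A" "length v = m" "\<And>i. i \<le> m \<Longrightarrow> trace x v i = q i"
    using ex_trace[OF q(1,3)] ends by (auto simp: x_def)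
  have "x \<otimes> ev u = x \<otimes> ev v" using u(2) u(3)[of n] v(2) v(3)[of m] ends by (simp add: trace_def)
  then have "ev u = ev v" using x ev_closed[OF u(1)] ev_closed[OF v(1)] by simp
  then have moves: "(u, v) \<in> (word_moves G S (20 * D))\<^sup>*" by (rule coarsely_simply_connected[OF u(1) v(1)])
  let ?s = "((\<lambda>_. x), 0 :: nat)"
  have st0: "straight x ?s" using x by (simp add: straight_def path_def quasi_geodesic_def)
  obtain r l r' l' where r: "develop ?s u = (r, l)" "develop ?s v = (r', l')" by force
  have R: "straight x (r, l)" "straight x (r', l')" using develop[OF st0 u(1)] develop[OF st0 v(1)] r by auto
  have qu: "quasi_geodesic window (60 * D) (trace x u) n"
    by (rule quasi_geodesic_cong[OF p(2)]) (simp add: u(3))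
  have qv: "quasi_geodesic window (60 * D) (trace x v) m"
    by (rule quasi_geodesic_cong[OF q(2)]) (simp add: v(3))
  have "frechet dst (270 * D) r (trace x u) l n"
    using develop_quasi_geodesic[OF x u(1) qu[folded u(2)] order_refl, of r l] r(1)
    unfolding u(2) take_all[OF eq_refl[OF u(2)]] by blast
  then have 1: "frechet dst (270 * D) r p l n" by (rule frechet_cong) (use u in auto)
  have "frechet dst (270 * D) r' (trace x v) l' m"
    using develop_quasi_geodesic[OF x v(1) qv[folded v(2)] order_refl, of r' l'] r(2)
    unfolding v(2) take_all[OF eq_refl[OF v(2)]] by blast
  then have 2: "frechet dst (270 * D) r' q l' m" by (rule frechet_cong) (use v in auto)
  have "close (r, l) (r', l')" using develop_moves[OF st0 moves u(1)] r by auto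
  then have 3: "frechet dst (270 * D) r r' l l'" by (simp add: close_def)
  have P: "path r l" "path r' l'" using straight_quasi[OF R(1)] straight_quasi[OF R(2)] by auto
  \<comment> \<open>The sum \<open>810 * D\<close> is still within the reach \<open>1000 * D\<close>
    of \<open>contract\<close>.\<close>
  have "frechet dst (270 * D + (270 * D + 270 * D)) p q n m"
    by (rule frechet_path_trans[OF frechet_path_sym[OF 1 P(1) p(1)]
          frechet_path_trans[OF 3 2 P q(1)] p(1) P(1) q(1)])
  then show ?thesis
    by (rule contract[OF p(1,2) q(1,2) ends(1)]) (use ends q path_in[OF q(1), of m] in \<open>auto simp: d_self\<close>)
qed

end

section \<open>Geodesics and how they diverge\<close>

context nat_metric
begin

definition geod :: "(nat \<Rightarrow> 'a) \<Rightarrow> nat \<Rightarrow> bool" where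
  "geod p n \<longleftrightarrow> path p n \<and> (\<forall>i j. i \<le> j \<longrightarrow> j \<le> n \<longrightarrow> d (p i) (p j) + i = j)"

lemma geodD: "geod p n \<Longrightarrow> i \<le> j \<Longrightarrow> j \<le> n \<Longrightarrow> d (p i) (p j) + i = j"
  by (simp add: geod_def)

lemma geodD': "geod p n \<Longrightarrow> i \<le> j \<Longrightarrow> j \<le> n \<Longrightarrow> d (p j) (p i) + i = j"
  using geodD[of p n i j] d_sym[of "p i" "p j"] by (auto simp: geod_def path_def)

lemma geodI:
  assumes p: "path p n" and n: "d (p 0) (p n) = n"
  shows "geod p n"
  unfolding geod_def
proof (intro conjI allI impI p)
  fix i j assume ij: "i \<le> j" "j \<le> n"
  have X: "p 0 \<in> X" "p i \<in> X" "p j \<in> X" "p n \<in> X" using path_in[OF p] ij by auto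
  show "d (p i) (p j) + i = j"
    using d_tri[OF X(1,2,4)] d_tri[OF X(2,3,4)] path_dist[OF p, of 0 i] path_dist[OF p, of j n]
      path_dist[OF p ij] n ij by auto
qed

lemma geod_in: "geod p n \<Longrightarrow> i \<le> n \<Longrightarrow> p i \<in> X"
  by (simp add: geod_def path_def)

lemma geod_prefix: "geod p n \<Longrightarrow> m \<le> n \<Longrightarrow> geod p m"
  by (simp add: geod_def path_def)

lemma geod_quasi: "geod p n \<Longrightarrow> quasi_geodesic k c p n"
  unfolding quasi_geodesic_def by (metis add.commute geodD le_add1)

end

context locally_hyperbolic
begin

lemma ex_geod: "x \<in> X \<Longrightarrow> y \<in> X \<Longrightarrow> \<exists>p. geod p (d x y) \<and> p 0 = x \<and> p (d x y) = y"
  using geodesic[of x y] geodI by metis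

text \<open>After their last near pair the geodesics branch. If the Gromov product of
  \<open>a i'\<close> and \<open>b j'\<close> at that pair were large, a point \<open>B\<close> of
  \<open>b\<close> shortly after \<open>j\<close> would be within \<open>6 * D\<close> of the point
  \<open>A\<close> of \<open>a\<close> at the same distance from \<open>a i\<close>, against
  \<open>far\<close>. As \<open>44 = 2 * 19 + 6\<close>, the negated claim puts \<open>i'\<close>
  and \<open>j'\<close> more than \<open>19 * D\<close> beyond the pair, so that both
  \<open>A\<close> and \<open>B\<close> exist.\<close>

lemma diverging_geodesics:
  assumes a: "geod a n" and b: "geod b m"
    and i: "i \<le> i'" "i' \<le> n" "i' \<le> i + 20000 * D" and j: "j \<le> j'" "j' \<le> m" "j' \<le> j + 20000 * D"
    and near: "d (a i) (b j) \<le> 6 * D"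
    and far: "\<And>i1 j1. i < i1 \<Longrightarrow> i1 \<le> n \<Longrightarrow> j < j1 \<Longrightarrow> j1 \<le> m \<Longrightarrow> 6 * D < d (a i1) (b j1)"
  shows "i' + j' \<le> d (a i') (b j') + 44 * D + i + j"
proof (rule ccontr)
  assume neg: "\<not> ?thesis"
  let ?P = "a i" and ?X = "a i'" and ?Y = "b j'" and ?Q = "b j"
  have X: "?P \<in> X" "?X \<in> X" "?Y \<in> X" "?Q \<in> X"
    using geod_in[OF a] geod_in[OF b] i j by auto
  have PX: "d ?P ?X + i = i'" "d ?X ?P + i = i'" using geodD[OF a i(1,2)] geodD'[OF a i(1,2)] .
  have QY: "d ?Q ?Y + j = j'" using geodD[OF b j(1,2)] .
  have PY: "d ?Q ?Y \<le> d ?P ?Y + 6 * D" "d ?P ?Y \<le> d ?Q ?Y + 6 * D"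
    using d_tri[OF X(4,1,3)] d_tri[OF X(1,4,3)] d_sym[OF X(1,4)] near by auto
  have i19: "i + 19 * D < i'"
    using d_tri[OF X(1,2,3)] PX QY PY neg by linarith
  have j19: "j + 19 * D < j'"
    using d_tri[OF X(2,3,1)] d_sym[OF X(3,1)] PX QY PY neg by linarith
  \<comment> \<open>\<open>12 * D\<close> exceeds the gap \<open>6 * D\<close>, so
    \<open>\<tau>\<close> is positive and \<open>A\<close> comes strictly after \<open>a i\<close>;
    and \<open>\<tau>\<close> is at most \<open>18 * D\<close>, which is less than
    \<open>19 * D\<close>.\<close>
  define B where "B = b (j + 12 * D)"
  have BX: "B \<in> X" using geod_in[OF b] j j19 by (simp add: B_def)
  have B: "d ?Q B = 12 * D" "d B ?Q = 12 * D" "d B ?Y + 12 * D + j = j'"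
    using geodD[OF b, of j "j + 12 * D"] geodD'[OF b, of j "j + 12 * D"] geodD[OF b, of "j + 12 * D" j'] j j19
    by (auto simp: B_def)
  define \<tau> where "\<tau> = d ?P B"
  have \<tau>: "6 * D \<le> \<tau>" "\<tau> \<le> 18 * D"
    using d_tri[OF X(1,4) BX] d_tri[OF X(4,1) BX] d_sym[OF X(1,4)] near B by (auto simp: \<tau>_def)
  define A where "A = a (i + \<tau>)"
  have AX: "A \<in> X" using geod_in[OF a] i i19 \<tau> by (simp add: A_def)
  have A: "d ?P A = \<tau>" "d A ?X + \<tau> + i = i'" "d A ?P = \<tau>"
    using geodD[OF a, of i "i + \<tau>"] geodD'[OF a, of i "i + \<tau>"] geodD[OF a, of "i + \<tau>" i'] i i19 \<tau>
    by (auto simp: A_def)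
  have sBP: "d B ?P = \<tau>" using d_sym[OF BX X(1)] by (simp add: \<tau>_def)
  have sm: "d ?X ?Y \<le> 100000 * D" "d B ?Y \<le> 100000 * D" "d ?P ?Y \<le> 100000 * D" "d ?X B \<le> 100000 * D"
    subgoal using neg i j by linarith
    subgoal using B(3) j by linarith
    subgoal using PY(2) QY j by linarith
    subgoal using d_tri[OF X(2,1) BX] PX(2) \<tau>(2) i(3) \<tau>_def by linarith
    done
  have 1: "d ?P B + d B ?Y \<le> d ?P ?Y + 2 * D"
  proof -
    have "d B ?P + d ?Q ?Y \<le> d B ?Q + d ?P ?Y + 2 * D \<or> d B ?P + d ?Q ?Y \<le> d B ?Y + d ?P ?Q + 2 * D"
      by (rule four_point[OF BX X(1,4,3)]) (use sBP \<tau> B sm in linarith)+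
    then show ?thesis using B QY sBP near \<tau> D_pos \<tau>_def by linarith
  qed
  have 2: "d ?X B + \<tau> \<le> d ?P ?X + 4 * D"
  proof -
    have "d ?X B + d ?P ?Y \<le> d ?X ?P + d B ?Y + 2 * D \<or> d ?X B + d ?P ?Y \<le> d ?X ?Y + d B ?P + 2 * D"
      by (rule four_point[OF X(2) BX X(1,3)]) (use sm PX i in linarith)+
    then show ?thesis
    proof
      assume "d ?X B + d ?P ?Y \<le> d ?X ?P + d B ?Y + 2 * D"
      then show ?thesis using 1 PX \<tau>_def by linarith
    next
      assume "d ?X B + d ?P ?Y \<le> d ?X ?Y + d B ?P + 2 * D"
      then show ?thesis using neg sBP PY QY PX \<tau>(2) i j by linarith
    qed
  qed
  have "d A B + d ?P ?X \<le> d A ?P + d B ?X + 2 * D \<or> d A B + d ?P ?X \<le> d A ?X + d B ?P + 2 * D"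
  proof (rule four_point[OF AX BX X(1,2)])
    show "d A B \<le> 100000 * D" using d_tri[OF AX X(1) BX] A \<tau> \<tau>_def by linarith
    show "d A ?P \<le> 100000 * D" using A \<tau> by linarith
    show "d A ?X \<le> 100000 * D" using A i by linarith
  qed
  then have "d A B \<le> 6 * D" using 2 A sBP PX d_sym[OF BX X(2)] by linarith
  moreover have "6 * D < d A B"
    unfolding A_def B_def by (rule far) (use \<tau> i i19 j j19 D_pos in auto)
  ultimately show False by simp
qed

end

section \<open>The global four-point condition\<close>

context cartan_hadamard
begin

lemma geod_unit: "geod p n \<Longrightarrow> i < n \<Longrightarrow> dst (p i) (p (Suc i)) = 1"
  using geodD[of p n i "Suc i"] by simp

text \<open>The near pair with \<open>i + j\<close> largest is the branch point of a coarse tripod: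
  half of \<open>i + j\<close> is the Gromov product of the far ends, up to a constant. By
  maximality the arms diverge after it, so the path back along \<open>a\<close>, across and out
  along \<open>b\<close> is a local quasi-geodesic. Hence a geodesic between the far ends passes
  within \<open>270 * D\<close> of \<open>a i\<close>, and \<open>546 = 2 * 270 + 6\<close>.\<close>

lemma geodesics_meet:
  assumes a: "geod a n" "a 0 = w" and b: "geod b m" "b 0 = w"
  shows "\<exists>i j. i \<le> n \<and> j \<le> m \<and> dst (a i) (b j) \<le> 6 * D \<and> n + m \<le> dst (a n) (b m) + i + j + 546 * D"
proof -
  define P where "P = (\<lambda>(i, j). i \<le> n \<and> j \<le> m \<and> dst (a i) (b j) \<le> 6 * D)"
  have "P (0, 0)" using geod_in[OF a(1), of 0] a b by (auto simp: P_def d_self)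
  moreover have "\<forall>y. P y \<longrightarrow> (case y of (i, j) \<Rightarrow> i + j) < Suc (n + m)" by (auto simp: P_def)
  ultimately obtain i j where ij: "P (i, j)" and mx: "\<And>i' j'. P (i', j') \<Longrightarrow> i' + j' \<le> i + j"
    using ex_has_greatest_nat[of P "(0, 0)" "\<lambda>(i, j). i + j" "Suc (n + m)"] by auto
  have i: "i \<le> n" and j: "j \<le> m" and near: "dst (a i) (b j) \<le> 6 * D" using ij by (auto simp: P_def)
  have far: "6 * D < dst (a i1) (b j1)" if "i < i1" "i1 \<le> n" "j < j1" "j1 \<le> m" for i1 j1
  proof (rule ccontr)
    assume "\<not> 6 * D < dst (a i1) (b j1)"
    then have "P (i1, j1)" using that by (simp add: P_def)
    then show False using mx[of i1 j1] that by simp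
  qed
  define l u where "l = dst (a i) (b j)" and "u = n - i"
  have aX: "t \<le> n \<Longrightarrow> a t \<in> carrier G" for t using geod_in[OF a(1)] .
  have bX: "t \<le> m \<Longrightarrow> b t \<in> carrier G" for t using geod_in[OF b(1)] .
  obtain \<sigma> where \<sigma>: "geod \<sigma> l" "\<sigma> 0 = a i" "\<sigma> l = b j" using ex_geod[OF aX[OF i] bX[OF j]] by (auto simp: l_def)
  have \<sigma>X: "t \<le> l \<Longrightarrow> \<sigma> t \<in> carrier G" for t using geod_in[OF \<sigma>(1)] .
  have l6: "l \<le> 6 * D" using near by (simp add: l_def)
  define c where "c s = (if s \<le> u then a (n - s) else if s \<le> u + l then \<sigma> (s - u) else b (j + (s - u - l)))" for s
  define L where "L = u + l + (m - j)"
  have c1: "c s = a (n - s)" if "s \<le> u" for s using that by (simp add: c_def)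
  have c2: "c s = \<sigma> (s - u)" if "u \<le> s" "s \<le> u + l" for s
    using that \<sigma>(2) i by (cases "s = u") (auto simp: c_def u_def)
  have c3: "c s = b (j + (s - u - l))" if "u + l \<le> s" for s
    using that \<sigma>(3) c2[of s] by (cases "s = u + l") (auto simp: c_def)
  have unit: "dst (c s) (c (Suc s)) = 1" if s: "s < L" for s
  proof -
    consider "Suc s \<le> u" | "u \<le> s" "Suc s \<le> u + l" | "u + l \<le> s" by linarith
    then show ?thesis
    proof cases
      case 1
      then have "Suc (n - Suc s) = n - s" by (simp add: u_def)
      then show ?thesis using 1 geodD'[OF a(1), of "n - Suc s" "n - s"] by (auto simp: c1)
    next
      case 2
      then show ?thesis using geod_unit[OF \<sigma>(1), of "s - u"] by (simp add: c2 Suc_diff_le)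
    next
      case 3
      then have "j + (Suc s - u - l) = Suc (j + (s - u - l))" by simp
      then show ?thesis using 3 geod_unit[OF b(1), of "j + (s - u - l)"] s by (simp add: c3 L_def)
    qed
  qed
  have cX: "c s \<in> carrier G" if "s \<le> L" for s
    using that aX[of "n - s"] \<sigma>X[of "s - u"] bX[of "j + (s - u - l)"] j by (auto simp: c_def L_def)
  have pc: "path c L" using unit cX by (auto simp: path_def)
  \<comment> \<open>A stretch containing all of \<open>\<sigma>\<close> loses at most
    \<open>(44 + 6) * D\<close> by \<open>diverging_geodesics\<close>. A stretch ending inside
    \<open>\<sigma>\<close> loses at most twice the length of \<open>\<sigma>\<close>, that is
    \<open>12 * D\<close>, and a stretch within one piece loses nothing.\<close>
  have qc: "quasi_geodesic window (60 * D) c L"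
    unfolding quasi_geodesic_def
  proof (intro allI impI)
    fix s t assume st: "s \<le> t" "t \<le> L" "t \<le> s + window"
    have X: "c s \<in> carrier G" "c t \<in> carrier G" using cX st by auto
    consider "t \<le> u" | "s \<le> u" "u \<le> t" "t \<le> u + l" | "s \<le> u" "u + l \<le> t" | "u \<le> s" "t \<le> u + l"
      | "u \<le> s" "s \<le> u + l" "u + l \<le> t" | "u + l \<le> s" by linarith
    then show "t \<le> s + dst (c s) (c t) + 60 * D"
    proof cases
      case 1
      have "dst (a (n - s)) (a (n - t)) + (n - t) = n - s" by (rule geodD'[OF a(1)]) (use st in auto)
      then have "dst (c s) (c t) + (n - t) = n - s" using 1 st by (simp add: c1)
      then show ?thesis using 1 st u_def by linarith
    next
      case 2
      have "dst (a (n - s)) (a i) + i = n - s" by (rule geodD'[OF a(1)]) (use 2 i in \<open>auto simp: u_def\<close>)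
      then have "dst (c s) (a i) + s = u" using 2 i by (auto simp: c1 u_def)
      moreover have "dst (\<sigma> 0) (\<sigma> (t - u)) + 0 = t - u" by (rule geodD[OF \<sigma>(1)]) (use 2 in auto)
      then have "dst (a i) (c t) \<le> l" using 2 \<sigma>(2) by (simp add: c2)
      moreover have "dst (c s) (a i) \<le> dst (c s) (c t) + dst (a i) (c t)"
        using d_tri[OF X(1,2) aX[OF i]] d_sym[OF X(2) aX[OF i]] by simp
      ultimately show ?thesis using 2 l6 by linarith
    next
      case 3
      have "(n - s) + (j + (t - u - l)) \<le> dst (a (n - s)) (b (j + (t - u - l))) + 44 * D + i + j"
        by (rule diverging_geodesics[OF a(1) b(1) _ _ _ _ _ _ near far])
          (use 3 st i j in \<open>auto simp: u_def L_def\<close>)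
      then show ?thesis using 3 l6 i by (simp add: c1 c3 u_def)
    next
      case 4
      have "dst (\<sigma> (s - u)) (\<sigma> (t - u)) + (s - u) = t - u" by (rule geodD[OF \<sigma>(1)]) (use 4 st in auto)
      then have "dst (c s) (c t) + (s - u) = t - u" using 4 st by (simp add: c2)
      then show ?thesis using 4 st by linarith
    next
      case 5
      have "dst (b j) (b (j + (t - u - l))) + j = j + (t - u - l)"
        by (rule geodD[OF b(1)]) (use 5 st j in \<open>auto simp: L_def\<close>)
      then have "dst (b j) (c t) + u + l = t" using 5 by (simp add: c3)
      moreover have "dst (\<sigma> l) (\<sigma> (s - u)) + (s - u) = l" by (rule geodD'[OF \<sigma>(1)]) (use 5 in auto)
      then have "dst (b j) (c s) \<le> l" using 5 \<sigma>(3) by (simp add: c2)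
      moreover have "dst (b j) (c t) \<le> dst (b j) (c s) + dst (c s) (c t)"
        using d_tri[OF bX[OF j] X] .
      ultimately show ?thesis using 5 l6 by linarith
    next
      case 6
      have "dst (b (j + (s - u - l))) (b (j + (t - u - l))) + (j + (s - u - l)) = j + (t - u - l)"
        by (rule geodD[OF b(1)]) (use 6 st j in \<open>auto simp: L_def\<close>)
      then have "dst (c s) (c t) + (j + (s - u - l)) = j + (t - u - l)" using 6 st by (simp add: c3)
      then show ?thesis using 6 st by linarith
    qed
  qed
  have c0: "c 0 = a n" by (simp add: c1)
  have cL: "c L = b m" using c3[of L] j by (simp add: L_def)
  obtain g where g: "geod g (dst (a n) (b m))" "g 0 = a n" "g (dst (a n) (b m)) = b m"
    using ex_geod[OF aX bX] by auto
  let ?k = "dst (a n) (b m)"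
  have "frechet dst (270 * D) c g L ?k"
    by (rule quasi_geodesics_close[OF pc qc unit _ geod_quasi[OF g(1)] geod_unit[OF g(1)]])
      (use g c0 cL in \<open>auto simp: geod_def\<close>)
  from frechet_meets_left[OF this, of u] obtain t where t: "t \<le> ?k" "dst (c u) (g t) \<le> 270 * D"
    by (auto simp: L_def)
  have ai: "c u = a i" using i by (simp add: c1 u_def)
  have gX: "g t \<in> carrier G" using geod_in[OF g(1) t(1)] .
  have 1: "dst (a n) (g t) = t" "dst (g t) (b m) + t = ?k"
    using geodD[OF g(1), of 0 t] geodD[OF g(1), of t ?k] t g by auto
  have 2: "dst (a n) (a i) + i = n" "dst (b j) (b m) + j = m"
    using geodD'[OF a(1) i] geodD[OF b(1) j] by auto
  have 3: "dst (a n) (a i) \<le> t + 270 * D"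
    using d_tri[OF aX[of n] gX aX[OF i]] d_sym[OF gX aX[OF i]] t ai 1 by auto
  have 4: "dst (b j) (b m) \<le> 6 * D + 270 * D + dst (g t) (b m)"
    using d_tri[OF bX[OF j] aX[OF i] bX[of m]] d_tri[OF aX[OF i] gX bX[of m]] d_sym[OF aX[OF i] bX[OF j]] near t ai
    by auto
  have "n + m \<le> ?k + i + j + 546 * D" using 1 2 3 4 by linarith
  then show ?thesis using i j near by blast
qed

text \<open>Following \<open>a\<close> up to \<open>a i\<close> and crossing to \<open>b j\<close>
  is a local quasi-geodesic, hence close to \<open>b\<close>. The point of \<open>b\<close> near
  \<open>a t\<close> may have another parameter, but parameters are distances from the common
  origin, so this costs a second \<open>270 * D\<close>.\<close>

lemma geodesics_close_before_meeting:
  assumes a: "geod a n" "a 0 = w" and b: "geod b m" "b 0 = w"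
    and i: "i \<le> n" and j: "j \<le> m" and near: "dst (a i) (b j) \<le> 6 * D" and t: "t \<le> i" "t \<le> j"
  shows "dst (a t) (b t) \<le> 540 * D"
proof -
  define l where "l = dst (a i) (b j)"
  have aX: "t \<le> n \<Longrightarrow> a t \<in> carrier G" for t using geod_in[OF a(1)] .
  have bX: "t \<le> m \<Longrightarrow> b t \<in> carrier G" for t using geod_in[OF b(1)] .
  obtain \<sigma> where \<sigma>: "geod \<sigma> l" "\<sigma> 0 = a i" "\<sigma> l = b j" using ex_geod[OF aX[OF i] bX[OF j]] by (auto simp: l_def)
  have \<sigma>X: "t \<le> l \<Longrightarrow> \<sigma> t \<in> carrier G" for t using geod_in[OF \<sigma>(1)] .
  have l6: "l \<le> 6 * D" using near by (simp add: l_def)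
  define c where "c s = (if s \<le> i then a s else \<sigma> (s - i))" for s
  have c1: "c s = a s" if "s \<le> i" for s using that by (simp add: c_def)
  have c2: "c s = \<sigma> (s - i)" if "i \<le> s" for s
    using that \<sigma>(2) by (cases "s = i") (auto simp: c_def)
  have unit: "dst (c s) (c (Suc s)) = 1" if s: "s < i + l" for s
  proof (cases "Suc s \<le> i")
    case True
    then show ?thesis using geod_unit[OF a(1), of s] i by (simp add: c1)
  next
    case False
    then show ?thesis using geod_unit[OF \<sigma>(1), of "s - i"] s by (simp add: c2 Suc_diff_le)
  qed
  have cX: "c s \<in> carrier G" if "s \<le> i + l" for s
    using that aX[of s] \<sigma>X[of "s - i"] i by (auto simp: c_def)
  have pc: "path c (i + l)" using unit cX by (auto simp: path_def)
  have qc: "quasi_geodesic window (60 * D) c (i + l)"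
    unfolding quasi_geodesic_def
  proof (intro allI impI)
    fix s t assume st: "s \<le> t" "t \<le> i + l" "t \<le> s + window"
    have X: "c s \<in> carrier G" "c t \<in> carrier G" using cX st by auto
    consider "t \<le> i" | "s \<le> i" "i \<le> t" | "i \<le> s" by linarith
    then show "t \<le> s + dst (c s) (c t) + 60 * D"
    proof cases
      case 1
      then show ?thesis using geodD[OF a(1), of s t] st i by (auto simp: c1)
    next
      case 2
      have "dst (c s) (a i) + s = i" using geodD[OF a(1), of s i] 2 i by (auto simp: c1)
      moreover have "dst (a i) (c t) \<le> l" using geodD[OF \<sigma>(1), of 0 "t - i"] 2 st \<sigma> by (auto simp: c2)
      moreover have "dst (c s) (a i) \<le> dst (c s) (c t) + dst (a i) (c t)"
        using d_tri[OF X(1,2) aX[OF i]] d_sym[OF X(2) aX[OF i]] by simp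
      ultimately show ?thesis using 2 l6 st by linarith
    next
      case 3
      have "dst (\<sigma> (s - i)) (\<sigma> (t - i)) + (s - i) = t - i"
        by (rule geodD[OF \<sigma>(1)]) (use st in auto)
      then have "dst (c s) (c t) + (s - i) = t - i" using 3 st by (simp add: c2)
      then show ?thesis using 3 st by linarith
    qed
  qed
  have b': "geod b j" by (rule geod_prefix[OF b(1) j])
  have "frechet dst (270 * D) c b (i + l) j"
    by (rule quasi_geodesics_close[OF pc qc unit _ geod_quasi[OF b'] geod_unit[OF b']])
      (use b' a b c1[of 0] c2[of "i + l"] \<sigma> in \<open>auto simp: geod_def\<close>)
  from frechet_meets_left[OF this, of t] obtain s where s: "s \<le> j" "dst (a t) (b s) \<le> 270 * D"
    using t by (auto simp: c1)
  have X: "a t \<in> carrier G" "b s \<in> carrier G" "b t \<in> carrier G" "a 0 \<in> carrier G"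
    using aX[of t] bX[of s] bX[of t] aX[of 0] t i j s by auto
  have lev: "dst (a 0) (a t) = t" "dst (a 0) (b s) = s"
    using geodD[OF a(1), of 0 t] geodD[OF b(1), of 0 s] a b t i j s by auto
  have "t \<le> s + 270 * D" "s \<le> t + 270 * D"
    using d_tri[OF X(4,2,1)] d_tri[OF X(4,1,2)] d_sym[OF X(1,2)] lev s by auto
  moreover have "dst (b s) (b t) + min s t = max s t"
    using geodD[OF b(1), of s t] geodD'[OF b(1), of t s] s t j by (cases "s \<le> t") auto
  ultimately show ?thesis using d_tri[OF X(1,2,3)] s by (simp add: min_def max_def split: if_splits)
qed

text \<open>In terms of Gromov products at \<open>x\<close>: the products of \<open>y\<close> with
  \<open>z\<close> and with \<open>w\<close> are half of \<open>i + j\<close> and of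
  \<open>k + l\<close>. Up to the time \<open>t\<close>, the least of these indices, all three
  geodesics stay together, so the product of \<open>z\<close> and \<open>w\<close> is at least
  \<open>t\<close> up to a constant. The errors add up to \<open>(1080 + 546 + 6) * D\<close>, which
  is below \<open>2000 * D\<close>.\<close>

theorem global_four_point:
  assumes X: "x \<in> carrier G" "y \<in> carrier G" "z \<in> carrier G" "w \<in> carrier G"
  shows "dst x y + dst z w \<le> dst x z + dst y w + 2 * (1000 * D) \<or>
    dst x y + dst z w \<le> dst x w + dst y z + 2 * (1000 * D)"
proof -
  obtain a b c where a: "geod a (dst x z)" "a 0 = x" "a (dst x z) = z"
    and b: "geod b (dst x y)" "b 0 = x" "b (dst x y) = y"
    and c: "geod c (dst x w)" "c 0 = x" "c (dst x w) = w"
    using ex_geod[OF X(1,3)] ex_geod[OF X(1,2)] ex_geod[OF X(1,4)] by blast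
  obtain i j where ij: "i \<le> dst x z" "j \<le> dst x y" "dst (a i) (b j) \<le> 6 * D"
    "dst x z + dst x y \<le> dst z y + i + j + 546 * D"
    using geodesics_meet[OF a(1,2) b(1,2)] a b by auto
  obtain k l where kl: "k \<le> dst x w" "l \<le> dst x y" "dst (c k) (b l) \<le> 6 * D"
    "dst x w + dst x y \<le> dst w y + k + l + 546 * D"
    using geodesics_meet[OF c(1,2) b(1,2)] c b by auto
  define t where "t = min (min i j) (min k l)"
  have t: "t \<le> i" "t \<le> j" "t \<le> k" "t \<le> l" by (auto simp: t_def)
  have T: "a t \<in> carrier G" "b t \<in> carrier G" "c t \<in> carrier G"
    using geod_in[OF a(1), of t] geod_in[OF b(1), of t] geod_in[OF c(1), of t] ij kl t by auto
  have 1: "dst (a t) (b t) \<le> 540 * D" "dst (c t) (b t) \<le> 540 * D"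
    using geodesics_close_before_meeting[OF a(1,2) b(1,2) ij(1-3) t(1,2)]
      geodesics_close_before_meeting[OF c(1,2) b(1,2) kl(1-3) t(3,4)] by auto
  have 2: "dst z (a t) + t = dst x z" "dst (c t) w + t = dst x w"
    using geodD'[OF a(1), of t "dst x z"] geodD[OF c(1), of t "dst x w"] a c t ij kl by auto
  have 3: "dst z w + t + t \<le> dst x z + dst x w + 1080 * D"
    using d_tri[OF X(3) T(1) X(4)] d_tri[OF T(1,2) X(4)] d_tri[OF T(2,3) X(4)] d_sym[OF T(2,3)] 1 2 by linarith
  have lev: "i \<le> j + 6 * D" "j \<le> i + 6 * D" "k \<le> l + 6 * D" "l \<le> k + 6 * D"
  proof -
    have I: "a i \<in> carrier G" "b j \<in> carrier G" "b l \<in> carrier G" "c k \<in> carrier G"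
      using geod_in[OF a(1)] geod_in[OF b(1)] geod_in[OF c(1)] ij kl by auto
    have "dst x (a i) = i" "dst x (b j) = j" "dst x (b l) = l" "dst x (c k) = k"
      using geodD[OF a(1), of 0 i] geodD[OF b(1), of 0 j] geodD[OF b(1), of 0 l] geodD[OF c(1), of 0 k] a b c ij kl
      by auto
    then show "i \<le> j + 6 * D" "j \<le> i + 6 * D" "k \<le> l + 6 * D" "l \<le> k + 6 * D"
      using d_tri[OF X(1) I(1,2)] d_tri[OF X(1) I(2,1)] d_tri[OF X(1) I(4,3)] d_tri[OF X(1) I(3,4)]
        d_sym[OF I(1,2)] d_sym[OF I(4,3)] ij(3) kl(3) by auto
  qed
  have sym: "dst z y = dst y z" "dst w y = dst y w" using d_sym X by auto
  have "t = i \<or> t = j \<or> t = k \<or> t = l" unfolding t_def by linarith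
  then consider "t = i \<or> t = j" | "t = k \<or> t = l" by blast
  then show ?thesis
  proof cases
    case 1
    then have "i + j \<le> t + t + 6 * D" using lev by auto
    then have "dst x y + dst z w \<le> dst x w + dst y z + 2 * (1000 * D)" using ij(4) 3 sym by linarith
    then show ?thesis ..
  next
    case 2
    then have "k + l \<le> t + t + 6 * D" using lev by auto
    then have "dst x y + dst z w \<le> dst x z + dst y w + 2 * (1000 * D)" using kl(4) 3 sym by linarith
    then show ?thesis ..
  qed
qed

end

section \<open>Groups presented by the short relations\<close>

text \<open>The maximum of the usual condition is written as a disjunction, which stays within the
  naturals and splits into linear cases. Balls about \<open>1\<close> are enough because left
  translations are isometries.\<close>

definition hyperbolic_in_ball :: "('a, 'm) monoid_scheme \<Rightarrow> 'a set \<Rightarrow> nat \<Rightarrow> nat \<Rightarrow> bool" where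
  "hyperbolic_in_ball G S D R \<longleftrightarrow> (\<forall>x\<in>carrier G. \<forall>y\<in>carrier G. \<forall>z\<in>carrier G. \<forall>w\<in>carrier G.
     word_length G S x \<le> R \<and> word_length G S y \<le> R \<and> word_length G S z \<le> R \<and> word_length G S w \<le> R \<longrightarrow>
     word_dist G S x y + word_dist G S z w \<le> word_dist G S x z + word_dist G S y w + 2 * D \<or>
     word_dist G S x y + word_dist G S z w \<le> word_dist G S x w + word_dist G S y z + 2 * D)"

lemma hyperbolic_in_ballD:
  "hyperbolic_in_ball G S D R \<Longrightarrow> x \<in> carrier G \<Longrightarrow> y \<in> carrier G \<Longrightarrow> z \<in> carrier G \<Longrightarrow> w \<in> carrier G \<Longrightarrow>
   word_length G S x \<le> R \<Longrightarrow> word_length G S y \<le> R \<Longrightarrow> word_length G S z \<le> R \<Longrightarrow> word_length G S w \<le> R \<Longrightarrow>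
   word_dist G S x y + word_dist G S z w \<le> word_dist G S x z + word_dist G S y w + 2 * D \<or>
   word_dist G S x y + word_dist G S z w \<le> word_dist G S x w + word_dist G S y z + 2 * D"
  unfolding hyperbolic_in_ball_def by blast

section \<open>Rewriting words by short relations\<close>

context word_group
begin

abbreviation "moves N \<equiv> (word_moves G S N)\<^sup>*"

lemma moves_sym: "(u, v) \<in> moves N \<Longrightarrow> (v, u) \<in> moves N"
proof -
  have "sym (word_moves G S N)"
    unfolding sym_def word_moves_def by clarsimp metis
  then show "(u, v) \<in> moves N \<Longrightarrow> (v, u) \<in> moves N" by (meson symD sym_rtrancl)
qed

lemma moves_eval: "(u, v) \<in> moves N \<Longrightarrow> set u \<subseteq> A \<Longrightarrow> set v \<subseteq> A \<and> ev u = ev v"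
proof (induction rule: rtrancl_induct)
  case (step y z)
  then show ?case using word_movesD[of y z N] by auto
qed simp

lemma moves_context:
  assumes "(u, v) \<in> moves N" "set x \<subseteq> A" "set y \<subseteq> A"
  shows "(x @ u @ y, x @ v @ y) \<in> moves N"
  using assms(1)
proof (induction rule: rtrancl_induct)
  case (step b c)
  obtain p q r s where b: "b = p @ q @ s" "c = p @ r @ s" "set p \<subseteq> A" "set q \<subseteq> A" "set r \<subseteq> A" "set s \<subseteq> A"
    "length q \<le> N" "length r \<le> N" "ev q = ev r"
    using step(2) by (auto simp: word_moves_def)
  have "(x @ b @ y, x @ c @ y) \<in> word_moves G S N"
    unfolding word_moves_def using b assms
    by (intro CollectI exI[of _ "x @ p"] exI[of _ q] exI[of _ r] exI[of _ "s @ y"]) auto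
  then show ?case using step by auto
qed simp

lemma move_short:
  assumes "set x \<subseteq> A" "set y \<subseteq> A" "set u \<subseteq> A" "set v \<subseteq> A" "length u \<le> N" "length v \<le> N" "ev u = ev v"
  shows "(x @ u @ y, x @ v @ y) \<in> moves N"
  using assms unfolding word_moves_def by blast

lemma moves_append:
  assumes "(u, v) \<in> moves N" "(u', v') \<in> moves N" "set u \<subseteq> A" "set u' \<subseteq> A"
  shows "(u @ u', v @ v') \<in> moves N"
proof -
  have "set v \<subseteq> A" using moves_eval[OF assms(1,3)] by simp
  then show ?thesis
    using moves_context[OF assms(1), of "[]" u'] moves_context[OF assms(2), of v "[]"] assms(3,4)
    by (auto intro: rtrancl_trans)
qed

lemma moves_mono: "N \<le> N' \<Longrightarrow> (u, v) \<in> moves N \<Longrightarrow> (u, v) \<in> moves N'"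
proof -
  assume N: "N \<le> N'"
  have "word_moves G S N \<subseteq> word_moves G S N'"
    unfolding word_moves_def using N by (blast intro: le_trans)
  then show "(u, v) \<in> moves N \<Longrightarrow> (u, v) \<in> moves N'" by (meson rtrancl_mono subsetD)
qed

text \<open>The rungs of the ladder are geodesics between \<open>trace \<one> u t\<close> and \<open>trace \<one> v t\<close>.\<close>

lemma moves_ladder:
  assumes u: "set u \<subseteq> A" and v: "set v \<subseteq> A" and eq: "ev u = ev v"
    and near: "\<And>t. dst (ev (take t u)) (ev (take t v)) < N"
  shows "(u, v) \<in> moves N"
proof -
  define r where "r t = (SOME w. set w \<subseteq> A \<and> ev w = inv (ev (take t u)) \<otimes> ev (take t v) \<and>
     length w = dst (ev (take t u)) (ev (take t v)))" for t
  have c: "ev (take t u) \<in> carrier G" "ev (take t v) \<in> carrier G" for t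
    using ev_closed[OF set_take[OF u]] ev_closed[OF set_take[OF v]] by auto
  have r: "set (r t) \<subseteq> A" "ev (r t) = inv (ev (take t u)) \<otimes> ev (take t v)"
    "length (r t) = dst (ev (take t u)) (ev (take t v))" for t
  proof -
    have "\<exists>w. set w \<subseteq> A \<and> ev w = inv (ev (take t u)) \<otimes> ev (take t v) \<and>
      length w = dst (ev (take t u)) (ev (take t v))"
      using ex_geodesic_word[of "inv (ev (take t u)) \<otimes> ev (take t v)"] c by (simp add: word_dist_def)
    from someI_ex[OF this] show "set (r t) \<subseteq> A" "ev (r t) = inv (ev (take t u)) \<otimes> ev (take t v)"
      "length (r t) = dst (ev (take t u)) (ev (take t v))" by (auto simp: r_def)
  qed
  have "(take t u @ r t, take t v) \<in> moves N" for t
  proof (induction t)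
    case 0
    then show ?case using r(3)[of 0] by (simp add: d_self)
  next
    case (Suc t)
    define a b where "a = (if t < length u then [u ! t] else [])" and "b = (if t < length v then [v ! t] else [])"
    have a: "take (Suc t) u = take t u @ a" "set a \<subseteq> A" "length a \<le> 1"
    proof -
      have "u ! t \<in> A" if "t < length u" using u nth_mem[OF that] by blast
      then show "take (Suc t) u = take t u @ a" "set a \<subseteq> A" "length a \<le> 1"
        by (cases "t < length u"; simp add: a_def take_Suc_conv_app_nth del: Un_iff)+
    qed
    have b: "take (Suc t) v = take t v @ b" "set b \<subseteq> A" "length b \<le> 1"
    proof -
      have "v ! t \<in> A" if "t < length v" using v nth_mem[OF that] by blast
      then show "take (Suc t) v = take t v @ b" "set b \<subseteq> A" "length b \<le> 1"
        by (cases "t < length v"; simp add: b_def take_Suc_conv_app_nth del: Un_iff)+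
    qed
    have ab: "ev a \<in> carrier G" "ev b \<in> carrier G" using ev_closed a b by auto
    have ea: "ev (take (Suc t) u) = ev (take t u) \<otimes> ev a"
      unfolding a(1) by (rule ev_append[OF set_take[OF u] a(2)])
    have eb: "ev (take (Suc t) v) = ev (take t v) \<otimes> ev b"
      unfolding b(1) by (rule ev_append[OF set_take[OF v] b(2)])
    let ?U = "ev (take t u)" and ?V = "ev (take t v)"
    have cU: "?U \<in> carrier G" "?V \<in> carrier G" using c by auto
    have "ev (a @ r (Suc t)) = ev a \<otimes> (inv (?U \<otimes> ev a) \<otimes> (?V \<otimes> ev b))"
      unfolding ev_append[OF a(2) r(1)] r(2) ea eb ..
    also have "\<dots> = inv ?U \<otimes> ?V \<otimes> ev b"
      using cU ab by (simp add: inv_mult_group m_assoc[symmetric])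
    also have "\<dots> = ev (r t @ b)" unfolding ev_append[OF r(1) b(2)] r(2) ..
    finally have e: "ev (a @ r (Suc t)) = ev (r t @ b)" .
    have len: "length (a @ r (Suc t)) \<le> N" "length (r t @ b) \<le> N"
      using near[of t] near[of "Suc t"] r(3) a b by auto
    have "(take t u @ (a @ r (Suc t)) @ [], take t u @ (r t @ b) @ []) \<in> moves N"
      by (rule move_short[OF set_take[OF u] _ _ _ len e]) (use a b r in auto)
    moreover have "([] @ (take t u @ r t) @ b, [] @ take t v @ b) \<in> moves N"
      by (rule moves_context[OF Suc]) (use b in auto)
    ultimately show ?case unfolding a(1) b(1) by (auto intro: rtrancl_trans)
  qed
  from this[of "max (length u) (length v)"]
  have "(u @ r (max (length u) (length v)), v) \<in> moves N" by simp
  moreover have "r (max (length u) (length v)) = []"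
    using r(3)[of "max (length u) (length v)"] eq ev_closed[OF v] by (simp add: d_self)
  ultimately show ?thesis by simp
qed

text \<open>Induction on the prefixes: once the prefix is replaced by a geodesic word
  \<open>u\<close>, it remains to fill the thin triangle with sides \<open>u\<close>, the letter
  \<open>a\<close> and the geodesic \<open>v\<close>. This is done by a ladder, whose rungs are
  short because the triangle lies in the ball of radius \<open>R\<close>.\<close>

lemma short_words_equal:
  assumes hyp: "hyperbolic_in_ball G S D R" and D: "1 \<le> D" and w: "set w \<subseteq> A" "length w \<le> R"
    and v: "set v \<subseteq> A" "ev v = ev w" "length v = len (ev w)"
  shows "(w, v) \<in> moves (20 * D)"
  using w v
proof (induction w arbitrary: v rule: rev_induct)
  case Nil
  then show ?case by (auto simp: len_one)
next
  case (snoc a w)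
  have w: "set w \<subseteq> A" "length w \<le> R" "a \<in> A" using snoc.prems by auto
  have ac: "a \<in> carrier G" using w letters_carrier by blast
  obtain u where u: "set u \<subseteq> A" "ev u = ev w" "length u = len (ev w)"
    using ex_geodesic_word[OF ev_closed[OF w(1)]] by blast
  have 1: "(w @ [a], u @ [a]) \<in> moves (20 * D)"
    using moves_context[OF snoc.IH[OF w(1,2) u], of "[]" "[a]"] w by simp
  let ?g = "ev w" and ?h = "ev (w @ [a])"
  have gh: "?g \<in> carrier G" "?h \<in> carrier G" "?h = ?g \<otimes> a" "ev (u @ [a]) = ?h"
    using ev_closed[OF w(1)] ev_closed[OF snoc.prems(1)] ev_append[of w "[a]"] ev_append[of u "[a]"] w u ac
    by (auto simp del: foldr_append)
  have lens: "len ?g \<le> length w" "len ?h \<le> length w + 1" "len ?g \<le> R" "len ?h \<le> R"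
    using len_le[OF w(1)] len_le[OF snoc.prems(1)] snoc.prems w by auto
  have dgh: "dst ?g ?h \<le> 1" using dst_mult_right[OF gh(1) ac] gh len_letter[OF w(3)] by simp
  have dd: "len ?h \<le> len ?g + 1" "len ?g \<le> len ?h + 1"
    using d_tri[OF one_closed gh(1,2)] d_tri[OF one_closed gh(2,1)] d_sym[OF gh(1,2)] dgh dst_one gh by auto
  have near: "dst (ev (take t (u @ [a]))) (ev (take t v)) < 20 * D" for t
  proof -
    let ?p = "ev (take t (u @ [a]))" and ?q = "ev (take t v)"
    have ua: "set (u @ [a]) \<subseteq> A" using u w by auto
    have tp: "trace \<one> (u @ [a]) i = ev (take i (u @ [a]))" "trace \<one> v i = ev (take i v)" for i
      using ev_closed[OF set_take[OF ua]] ev_closed[OF set_take[OF snoc.prems(3)]] by (auto simp: trace_def)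
    have P: "path (trace \<one> (u @ [a])) (len ?g + 1)" "path (trace \<one> v) (len ?h)"
      using trace_path[OF one_closed ua] trace_path[OF one_closed snoc.prems(3)] u snoc.prems by auto
    have pq: "?p \<in> carrier G" "?q \<in> carrier G"
      using ev_closed[OF set_take[OF ua]] ev_closed[OF set_take[OF snoc.prems(3)]] by auto
    show ?thesis
    proof (cases "t \<le> len ?g \<and> t \<le> len ?h")
      case True
      have pd: "dst \<one> ?p \<le> t" "dst ?p ?g + t \<le> len ?g"
        using path_dist[OF P(1), of 0 t] path_dist[OF P(1), of t "len ?g"] True u gh
        by (auto simp: tp)
      have qd: "dst \<one> ?q \<le> t" "dst ?q ?h + t \<le> len ?h"
        using path_dist[OF P(2), of 0 t] path_dist[OF P(2), of t "len ?h"] True snoc.prems(3-5) gh by (auto simp: tp)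
      have qg: "dst ?q ?g \<le> dst ?q ?h + 1" using d_tri[OF pq(2) gh(2,1)] d_sym[OF gh(1,2)] dgh by simp
      \<comment> \<open>Both points are at time \<open>t\<close> on geodesics from \<open>1\<close>,
        whose ends are adjacent, so both cross sums are at most \<open>len ?g + 2\<close>. This
        leaves \<open>2 * D + 2\<close> for the rung.\<close>
      have "dst ?p ?q + dst \<one> ?g \<le> dst ?p \<one> + dst ?q ?g + 2 * D \<or> dst ?p ?q + dst \<one> ?g \<le> dst ?p ?g + dst ?q \<one> + 2 * D"
        by (rule hyperbolic_in_ballD[OF hyp pq one_closed gh(1)])
          (use pd qd True lens pq gh in \<open>auto simp: dst_one len_one\<close>)
      then show ?thesis
        using pd qd qg dd True dst_one[OF gh(1)] d_sym[OF pq(1) one_closed] d_sym[OF pq(2) one_closed] D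
        by linarith
    next
      case False
      then have t: "len ?h \<le> t + 1" "len ?g \<le> t + 1" using dd by auto
      have "dst ?p ?h \<le> 2"
      proof (cases "t \<le> len ?g + 1")
        case True
        then have "dst ?p ?h + t \<le> len ?g + 1"
          using path_dist[OF P(1), of t "len ?g + 1"] u gh by (auto simp: tp)
        then show ?thesis using t by linarith
      next
        case False
        then have "?p = ?h" using u gh by simp
        then show ?thesis using gh by (simp add: d_self)
      qed
      moreover have "dst ?q ?h \<le> 2"
      proof (cases "t \<le> len ?h")
        case True
        then have "dst ?q ?h + t \<le> len ?h"
          using path_dist[OF P(2), of t "len ?h"] snoc.prems(3-5) gh by (auto simp: tp)
        then show ?thesis using t by linarith
      next
        case False
        then have "?q = ?h" using snoc.prems(3-5) gh by simp
        then show ?thesis using gh by (simp add: d_self)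
      qed
      ultimately show ?thesis
        using d_tri[OF pq(1) gh(2) pq(2)] d_sym[OF gh(2) pq(2)] D by linarith
    qed
  qed
  have "(u @ [a], v) \<in> moves (20 * D)"
    by (rule moves_ladder[OF _ snoc.prems(3) _ near]) (use u w gh snoc.prems in auto)
  then show ?case using 1 by (rule rtrancl_trans[rotated])
qed

lemma short_words_moves:
  assumes "hyperbolic_in_ball G S D R" "1 \<le> D" "set u \<subseteq> A" "length u \<le> R" "set v \<subseteq> A" "length v \<le> R"
    "ev u = ev v"
  shows "(u, v) \<in> moves (20 * D)"
proof -
  obtain w where w: "set w \<subseteq> A" "ev w = ev u" "length w = len (ev u)"
    using ex_geodesic_word[OF ev_closed[OF assms(3)]] by blast
  have "(u, w) \<in> moves (20 * D)" by (rule short_words_equal[OF assms(1-4) w])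
  moreover have "(v, w) \<in> moves (20 * D)"
    by (rule short_words_equal[OF assms(1,2,5,6) w[unfolded assms(7)]])
  ultimately show ?thesis using moves_sym by (meson rtrancl_trans)
qed

end

text \<open>The quotient is realised inside an arbitrary type through \<open>enc\<close> because the groups of a direct
  system have to share one type of elements.\<close>

locale word_quotient = word_group +
  fixes enc :: "'a list set \<Rightarrow> 'c" and N :: nat
  assumes N2: "2 \<le> N"
    and enc_inj: "inj_on enc ((\<lambda>w. moves N `` {w}) ` lists A)"
begin

definition cl :: "'a list \<Rightarrow> 'c" where
  "cl w = enc (moves N `` {w})"

definition rep :: "'c \<Rightarrow> 'a list" where
  "rep x = (SOME w. set w \<subseteq> A \<and> cl w = x)"

definition Q :: "'c monoid" where
  "Q = \<lparr>carrier = cl ` lists A, mult = (\<lambda>x y. cl (rep x @ rep y)), one = cl []\<rparr>"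

definition gens :: "'c set" where
  "gens = (\<lambda>s. cl [s]) ` S"

lemma cl_eq: "set u \<subseteq> A \<Longrightarrow> set v \<subseteq> A \<Longrightarrow> cl u = cl v \<longleftrightarrow> (u, v) \<in> moves N"
proof -
  assume "set u \<subseteq> A" "set v \<subseteq> A"
  then have "cl u = cl v \<longleftrightarrow> moves N `` {u} = moves N `` {v}"
    unfolding cl_def by (intro inj_on_eq_iff[OF enc_inj]) (auto simp: lists_eq_set)
  also have "\<dots> \<longleftrightarrow> (u, v) \<in> moves N"
    using moves_sym[of u v N] by (auto intro: rtrancl_trans)
  finally show ?thesis .
qed

lemma rep: "x \<in> carrier Q \<Longrightarrow> set (rep x) \<subseteq> A \<and> cl (rep x) = x"
  unfolding rep_def by (rule someI_ex) (auto simp: Q_def lists_eq_set)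

lemma carrier_Q: "carrier Q = cl ` {w. set w \<subseteq> A}"
  by (auto simp: Q_def lists_eq_set)

lemma cl_carrier: "set w \<subseteq> A \<Longrightarrow> cl w \<in> carrier Q"
  by (simp add: carrier_Q)

lemma one_Q: "\<one>\<^bsub>Q\<^esub> = cl []"
  by (simp add: Q_def)

lemma mult_Q: "set u \<subseteq> A \<Longrightarrow> set v \<subseteq> A \<Longrightarrow> cl u \<otimes>\<^bsub>Q\<^esub> cl v = cl (u @ v)"
proof -
  assume uv: "set u \<subseteq> A" "set v \<subseteq> A"
  note r = rep[OF cl_carrier[OF uv(1)]] rep[OF cl_carrier[OF uv(2)]]
  have "(rep (cl u) @ rep (cl v), u @ v) \<in> moves N"
    by (rule moves_append) (use r uv cl_eq in auto)
  then have "cl (rep (cl u) @ rep (cl v)) = cl (u @ v)" using r uv by (subst cl_eq) auto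
  then show ?thesis by (simp add: Q_def)
qed

lemma cancel_letter: "a \<in> A \<Longrightarrow> cl [inv a, a] = cl []"
proof -
  assume a: "a \<in> A"
  then have "a \<in> carrier G" using letters_carrier by blast
  then have "ev [inv a, a] = ev []" by simp
  then have "([] @ [inv a, a] @ [], [] @ [] @ []) \<in> moves N"
    using a letters_inv[OF a] N2 by (intro move_short) auto
  then show ?thesis using a letters_inv[OF a] by (subst cl_eq) auto
qed

lemma ex_cl_inverse: "set w \<subseteq> A \<Longrightarrow> \<exists>v. set v \<subseteq> A \<and> cl (v @ w) = cl []"
proof (induction w)
  case Nil
  then show ?case by (intro exI[of _ "[]"]) auto
next
  case (Cons a w)
  then obtain v where v: "set v \<subseteq> A" "cl (v @ w) = cl []" by auto
  have a: "a \<in> A" "inv a \<in> A" using Cons.prems letters_inv by auto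
  have m: "([inv a, a], []) \<in> moves N" using cancel_letter[OF a(1)] a by (subst cl_eq[symmetric]) auto
  have "(v @ [inv a, a] @ w, v @ [] @ w) \<in> moves N"
    by (rule moves_context[OF m]) (use v Cons.prems in auto)
  then have "cl ((v @ [inv a]) @ (a # w)) = cl (v @ w)" using v Cons.prems a by (subst cl_eq) auto
  then show ?case using v a by (intro exI[of _ "v @ [inv a]"]) auto
qed

lemma group_Q: "group Q"
proof (rule groupI)
  show "x \<otimes>\<^bsub>Q\<^esub> y \<in> carrier Q" if "x \<in> carrier Q" "y \<in> carrier Q" for x y
    using that by (auto simp: carrier_Q mult_Q)
  show "\<one>\<^bsub>Q\<^esub> \<in> carrier Q" by (auto simp: carrier_Q one_Q)
  show "x \<otimes>\<^bsub>Q\<^esub> y \<otimes>\<^bsub>Q\<^esub> z = x \<otimes>\<^bsub>Q\<^esub> (y \<otimes>\<^bsub>Q\<^esub> z)"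
    if "x \<in> carrier Q" "y \<in> carrier Q" "z \<in> carrier Q" for x y z
    using that by (auto simp: carrier_Q mult_Q)
  show "\<one>\<^bsub>Q\<^esub> \<otimes>\<^bsub>Q\<^esub> x = x" if "x \<in> carrier Q" for x
    using that by (auto simp: carrier_Q one_Q mult_Q)
  show "\<exists>y\<in>carrier Q. y \<otimes>\<^bsub>Q\<^esub> x = \<one>\<^bsub>Q\<^esub>" if "x \<in> carrier Q" for x
  proof -
    obtain w where w: "set w \<subseteq> A" "x = cl w" using \<open>x \<in> carrier Q\<close> by (auto simp: carrier_Q)
    obtain v where v: "set v \<subseteq> A" "cl (v @ w) = cl []" using ex_cl_inverse[OF w(1)] by blast
    show ?thesis using w v by (intro bexI[of _ "cl v"]) (auto simp: mult_Q one_Q cl_carrier)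
  qed
qed

lemma inv_letter: "a \<in> A \<Longrightarrow> inv\<^bsub>Q\<^esub> (cl [a]) = cl [inv a]"
proof -
  assume a: "a \<in> A"
  have "cl [inv a] \<otimes>\<^bsub>Q\<^esub> cl [a] = \<one>\<^bsub>Q\<^esub>"
    using a letters_inv[OF a] cancel_letter[OF a] by (simp add: mult_Q one_Q)
  then show ?thesis
    using group.inv_equality[OF group_Q, of "cl [inv a]" "cl [a]"] a letters_inv[OF a] by (simp add: cl_carrier)
qed

lemma letters_Q: "letters Q gens = (\<lambda>a. cl [a]) ` A"
proof -
  have "(\<lambda>s. inv\<^bsub>Q\<^esub> s) ` gens = (\<lambda>a. cl [a]) ` (\<lambda>s. inv s) ` S"
    unfolding gens_def image_image by (rule image_cong) (auto simp: inv_letter)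
  then show ?thesis by (simp add: gens_def image_Un)
qed

lemma cl_in_generate: "set w \<subseteq> A \<Longrightarrow> cl w \<in> generate Q gens"
proof (induction w)
  case Nil
  then show ?case using generate.one[of Q gens] by (simp add: one_Q)
next
  case (Cons a w)
  have "cl [a] \<in> generate Q gens"
  proof (cases "a \<in> S")
    case True
    then show ?thesis by (auto simp: gens_def intro: generate.incl)
  next
    case False
    then obtain s where s: "s \<in> S" "a = inv s" using Cons.prems by auto
    then have "inv\<^bsub>Q\<^esub> (cl [s]) \<in> generate Q gens" by (auto simp: gens_def intro: generate.inv)
    then show ?thesis using s inv_letter[of s] by simp
  qed
  then have "cl [a] \<otimes>\<^bsub>Q\<^esub> cl w \<in> generate Q gens" using Cons by (auto intro: generate.eng)
  then show ?case using Cons.prems by (simp add: mult_Q)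
qed

lemma generating_Q: "finite_generating_set Q gens"
  unfolding finite_generating_set_def
proof (intro conjI)
  show "finite gens" using generating by (simp add: gens_def finite_generating_set_def)
  show sub: "gens \<subseteq> carrier Q" by (auto simp: gens_def cl_carrier)
  show "generate Q gens = carrier Q"
    using group.generate_in_carrier[OF group_Q sub] cl_in_generate by (auto simp: carrier_Q)
qed

sublocale Q: word_group Q gens
  by (intro word_group.intro group_Q word_group_axioms.intro generating_Q)

lemma ev_Q: "set w \<subseteq> A \<Longrightarrow> eval_word Q (map (\<lambda>a. cl [a]) w) = cl w"
  by (induction w) (auto simp: one_Q mult_Q)

lemma lift_word: "set ws \<subseteq> letters Q gens \<Longrightarrow> \<exists>w. set w \<subseteq> A \<and> ws = map (\<lambda>a. cl [a]) w"
proof (induction ws)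
  case (Cons x ws)
  then obtain w a where "set w \<subseteq> A" "ws = map (\<lambda>a. cl [a]) w" "a \<in> A" "x = cl [a]"
    unfolding letters_Q by auto
  then show ?case by (intro exI[of _ "a # w"]) auto
qed simp

lemma ex_geodesic_cl: "x \<in> carrier Q \<Longrightarrow> \<exists>w. set w \<subseteq> A \<and> cl w = x \<and> length w = word_length Q gens x"
proof -
  assume "x \<in> carrier Q"
  then obtain ws where ws: "set ws \<subseteq> letters Q gens" "eval_word Q ws = x" "length ws = word_length Q gens x"
    using Q.ex_geodesic_word by blast
  then obtain w where "set w \<subseteq> A" "ws = map (\<lambda>a. cl [a]) w" using lift_word by blast
  then show ?thesis using ws ev_Q[of w] by (intro exI[of _ w]) auto
qed

lemma word_length_cl_le: "set w \<subseteq> A \<Longrightarrow> word_length Q gens (cl w) \<le> length w"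
proof -
  assume w: "set w \<subseteq> A"
  then have "set (map (\<lambda>a. cl [a]) w) \<subseteq> letters Q gens" unfolding letters_Q by auto
  from Q.len_le[OF this] show ?thesis using ev_Q[OF w] by simp
qed

definition proj :: "'c \<Rightarrow> 'a" where
  "proj x = ev (rep x)"

lemma proj_cl: "set w \<subseteq> A \<Longrightarrow> proj (cl w) = ev w"
proof -
  assume w: "set w \<subseteq> A"
  note r = rep[OF cl_carrier[OF w]]
  then have "(rep (cl w), w) \<in> moves N" using cl_eq w by blast
  then show ?thesis using moves_eval r by (simp add: proj_def)
qed

lemma proj_hom: "proj \<in> hom Q G"
proof (rule homI)
  show "proj x \<in> carrier G" if "x \<in> carrier Q" for x
    using that ev_closed by (auto simp: carrier_Q proj_cl)
  show "proj (x \<otimes>\<^bsub>Q\<^esub> y) = proj x \<otimes> proj y" if "x \<in> carrier Q" "y \<in> carrier Q" for x y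
    using that by (auto simp: carrier_Q mult_Q proj_cl ev_append simp del: foldr_append)
qed

end

text \<open>\<open>R\<close> plays two roles: it is the radius of the ball of \<open>G\<close> on
  which the four-point condition holds and the radius up to which \<open>proj\<close> is shown to
  preserve lengths. Points within \<open>100000 * D\<close> of a base point are up to
  \<open>200000 * D\<close> apart, and \<open>R\<close> exceeds this.\<close>

locale hyperbolic_word_quotient = word_group +
  fixes enc :: "'a list set \<Rightarrow> 'c" and D R :: nat
  assumes D1: "1 \<le> D" and R: "400000 * D \<le> R"
    and hyp: "hyperbolic_in_ball G S D R"
    and enc_inj: "inj_on enc ((\<lambda>w. moves (20 * D) `` {w}) ` lists A)"
begin

sublocale word_quotient G S enc "20 * D"
  by unfold_locales (use D1 enc_inj in auto)

text \<open>Geodesic words for the two elements have length at most \<open>R\<close> and the same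
  value in \<open>G\<close>; for words that short, equality in \<open>G\<close> already follows from
  the moves that define the quotient.\<close>

lemma proj_inj:
  assumes "x \<in> carrier Q" "y \<in> carrier Q" "word_length Q gens x \<le> R" "word_length Q gens y \<le> R" "proj x = proj y"
  shows "x = y"
proof -
  obtain u v where u: "set u \<subseteq> A" "cl u = x" "length u = word_length Q gens x"
    and v: "set v \<subseteq> A" "cl v = y" "length v = word_length Q gens y" using ex_geodesic_cl assms by metis
  then have "ev u = ev v" using proj_cl assms by metis
  then have "(u, v) \<in> moves (20 * D)"
    using short_words_moves[OF hyp D1 u(1) _ v(1)] u v assms by simp
  then show ?thesis using cl_eq u v by blast
qed

text \<open>A geodesic word in \<open>G\<close> for \<open>proj x\<close>, read in the quotient,
  names an element of length at most \<open>R\<close> with the same image. By injectivity this is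
  \<open>x\<close>, so \<open>x\<close> has no larger length.\<close>

lemma proj_length:
  assumes x: "x \<in> carrier Q" "word_length Q gens x \<le> R"
  shows "len (proj x) = word_length Q gens x"
proof (rule antisym)
  obtain u where u: "set u \<subseteq> A" "cl u = x" "length u = word_length Q gens x" using ex_geodesic_cl x by metis
  then show le: "len (proj x) \<le> word_length Q gens x" using len_le[OF u(1)] proj_cl[OF u(1)] by simp
  obtain v where v: "set v \<subseteq> A" "ev v = proj x" "length v = len (proj x)"
    using ex_geodesic_word proj_hom x by (metis hom_in_carrier)
  have "cl v = x"
    by (rule proj_inj) (use v x le word_length_cl_le[OF v(1)] proj_cl[OF v(1)] cl_carrier in auto)
  then show "word_length Q gens x \<le> len (proj x)" using word_length_cl_le[OF v(1)] v by simp
qed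

lemma proj_dist:
  assumes "x \<in> carrier Q" "y \<in> carrier Q" "word_dist Q gens x y \<le> R"
  shows "dst (proj x) (proj y) = word_dist Q gens x y"
proof -
  have h: "group_hom Q G proj"
    by (intro group_hom.intro group_Q is_group group_hom_axioms.intro proj_hom)
  have "inv (proj x) \<otimes> proj y = proj (inv\<^bsub>Q\<^esub> x \<otimes>\<^bsub>Q\<^esub> y)"
    using assms group_hom.hom_inv[OF h] hom_mult[OF proj_hom] by auto
  then show ?thesis
    using proj_length[of "inv\<^bsub>Q\<^esub> x \<otimes>\<^bsub>Q\<^esub> y"] assms by (simp add: word_dist_def)
qed

text \<open>The two short words exchanged by a move have the same class, so the move is also one in
  \<open>Q\<close>. Every relation of \<open>Q\<close> is by construction a chain of such moves;
  this is the coarse simple connectedness of \<open>Q\<close>.\<close>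

lemma map_moves:
  assumes "(u, v) \<in> moves (20 * D)"
  shows "(map (\<lambda>a. cl [a]) u, map (\<lambda>a. cl [a]) v) \<in> (word_moves Q gens (20 * D))\<^sup>*"
  using assms
proof (induction rule: rtrancl_induct)
  case (step v w)
  then obtain x p q y where m: "v = x @ p @ y" "w = x @ q @ y" "set x \<subseteq> A" "set p \<subseteq> A" "set q \<subseteq> A" "set y \<subseteq> A"
    "length p \<le> 20 * D" "length q \<le> 20 * D" "ev p = ev q"
    by (auto simp: word_moves_def)
  let ?c = "map (\<lambda>a. cl [a])"
  have "cl p = cl q" using move_short[of "[]" "[]" p q "20 * D"] m by (subst cl_eq) auto
  then have e: "eval_word Q (?c p) = eval_word Q (?c q)" using m by (simp add: ev_Q)
  have s: "set u \<subseteq> A \<Longrightarrow> set (?c u) \<subseteq> letters Q gens" for u unfolding letters_Q by auto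
  have "(?c v, ?c w) \<in> word_moves Q gens (20 * D)"
    unfolding word_moves_def m(1,2) map_append
    by (intro CollectI exI[of _ "?c x"] exI[of _ "?c p"] exI[of _ "?c q"] exI[of _ "?c y"])
      (use s[OF m(3)] s[OF m(4)] s[OF m(5)] s[OF m(6)] m e in auto)
  then show ?case using step by auto
qed simp

sublocale Q: cartan_hadamard Q gens D
proof
  fix x y z w assume X: "x \<in> carrier Q" "y \<in> carrier Q" "z \<in> carrier Q" "w \<in> carrier Q"
    and le: "word_dist Q gens x y \<le> 100000 * D" "word_dist Q gens x z \<le> 100000 * D" "word_dist Q gens x w \<le> 100000 * D"
  \<comment> \<open>The translation \<open>?t\<close> takes \<open>x\<close> to the identity, and
    there \<open>proj\<close> preserves all the distances involved, so the condition can be read off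
    in the ball of \<open>G\<close>.\<close>
  let ?d = "word_dist Q gens" and ?t = "\<lambda>y. inv\<^bsub>Q\<^esub> x \<otimes>\<^bsub>Q\<^esub> y"
  have tX: "?t u \<in> carrier Q" if "u \<in> carrier Q" for u using X that by simp
  have td: "?d (?t u) (?t v) = ?d u v" if "u \<in> carrier Q" "v \<in> carrier Q" for u v
    using Q.dst_translate X that by simp
  have tl: "word_length Q gens (?t u) = ?d x u" for u by (simp add: word_dist_def)
  have small: "?d u v \<le> 200000 * D" if "u \<in> carrier Q" "v \<in> carrier Q" "?d x u \<le> 100000 * D" "?d x v \<le> 100000 * D" for u v
    using Q.d_tri[of u x v] Q.d_sym[of u x] that X by simp
  have xx: "?d x x \<le> 100000 * D" using X Q.d_self by simp
  have pd: "dst (proj (?t u)) (proj (?t v)) = ?d u v"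
    if "u \<in> carrier Q" "v \<in> carrier Q" "?d x u \<le> 100000 * D" "?d x v \<le> 100000 * D" for u v
    using proj_dist[OF tX[OF that(1)] tX[OF that(2)]] td[OF that(1,2)] small[OF that] R by simp
  have pl: "len (proj (?t u)) \<le> R" if "u \<in> carrier Q" "?d x u \<le> 100000 * D" for u
    using proj_length[OF tX[OF that(1)]] tl[of u] that R by simp
  have pc: "proj (?t u) \<in> carrier G" if "u \<in> carrier Q" for u
    using tX[OF that] proj_hom by (auto simp: hom_def)
  show "?d x y + ?d z w \<le> ?d x z + ?d y w + 2 * D \<or> ?d x y + ?d z w \<le> ?d x w + ?d y z + 2 * D"
    using hyperbolic_in_ballD[OF hyp pc[OF X(1)] pc[OF X(2)] pc[OF X(3)] pc[OF X(4)]
        pl[OF X(1) xx] pl[OF X(2) le(1)] pl[OF X(3) le(2)] pl[OF X(4) le(3)]]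
    by (simp only: pd X le xx)
next
  fix u v assume uv: "set u \<subseteq> letters Q gens" "set v \<subseteq> letters Q gens" "eval_word Q u = eval_word Q v"
  obtain u' v' where u': "set u' \<subseteq> A" "u = map (\<lambda>a. cl [a]) u'" "set v' \<subseteq> A" "v = map (\<lambda>a. cl [a]) v'"
    using lift_word uv by metis
  then have "cl u' = cl v'" using uv ev_Q by metis
  then have "(u', v') \<in> moves (20 * D)" using cl_eq u' by blast
  then show "(u, v) \<in> (word_moves Q gens (20 * D))\<^sup>*" using map_moves u' by simp
qed (rule D1)

end

section \<open>Four-point hyperbolicity, slim triangles and real trees\<close>

definition four_point :: "'p set \<Rightarrow> ('p \<Rightarrow> 'p \<Rightarrow> real) \<Rightarrow> real \<Rightarrow> bool" where
  "four_point M d \<delta> \<longleftrightarrow> (\<forall>x\<in>M. \<forall>y\<in>M. \<forall>z\<in>M. \<forall>w\<in>M.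
     d x y + d z w \<le> max (d x z + d y w) (d x w + d y z) + 2 * \<delta>)"

lemma four_pointD:
  "four_point M d \<delta> \<Longrightarrow> x \<in> M \<Longrightarrow> y \<in> M \<Longrightarrow> z \<in> M \<Longrightarrow> w \<in> M \<Longrightarrow>
    d x y + d z w \<le> max (d x z + d y w) (d x w + d y z) + 2 * \<delta>"
  by (simp add: four_point_def)

text \<open>Only the upper bound is asked for. Such paths can be concatenated and reversed freely,
  and one whose length equals the distance of its ends is automatically isometric.\<close>

definition lipschitz_path :: "'p set \<Rightarrow> ('p \<Rightarrow> 'p \<Rightarrow> real) \<Rightarrow> 'p \<Rightarrow> 'p \<Rightarrow> real \<Rightarrow> (real \<Rightarrow> 'p) \<Rightarrow> bool" where
  "lipschitz_path M d x y l \<gamma> \<longleftrightarrow> 0 \<le> l \<and> \<gamma> ` {0..l} \<subseteq> M \<and> \<gamma> 0 = x \<and> \<gamma> l = y \<and>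
     (\<forall>s\<in>{0..l}. \<forall>t\<in>{0..l}. s \<le> t \<longrightarrow> d (\<gamma> s) (\<gamma> t) \<le> t - s)"

lemma real_tree_ex_segment:
  assumes "real_tree M d" "x \<in> M" "y \<in> M"
  shows "\<exists>A. geodesic_segment M d x y A"
proof -
  have "\<forall>x\<in>M. \<forall>y\<in>M. \<exists>!A. geodesic_segment M d x y A"
    using assms(1) unfolding real_tree_def by (elim conjE)
  from ex1_implies_ex[OF bspec[OF bspec[OF this assms(2)] assms(3)]] show ?thesis .
qed

lemma lipschitz_pathD:
  "lipschitz_path M d x y l \<gamma> \<Longrightarrow> 0 \<le> s \<Longrightarrow> s \<le> t \<Longrightarrow> t \<le> l \<Longrightarrow> d (\<gamma> s) (\<gamma> t) \<le> t - s"
  by (simp add: lipschitz_path_def)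

section \<open>Slim triangles, the four-point condition and real trees\<close>

context Metric_space
begin

lemma geodesic_segment_endpoints:
  assumes "geodesic_segment M d x y A"
  shows "x \<in> A" "y \<in> A" "A \<subseteq> M"
proof -
  obtain \<gamma> where "\<gamma> ` {0..d x y} \<subseteq> M" "\<gamma> 0 = x" "\<gamma> (d x y) = y" "A = \<gamma> ` {0..d x y}"
    using assms by (auto simp: geodesic_segment_def)
  then show "x \<in> A" "y \<in> A" "A \<subseteq> M"
    using nonneg[of x y] imageI[of 0 "{0..d x y}" \<gamma>] imageI[of "d x y" "{0..d x y}" \<gamma>] by auto
qed

lemma geodesic_segment_dist:
  assumes "geodesic_segment M d x y A" "p \<in> A"
  shows "d x p + d p y = d x y"
proof -
  obtain \<gamma> where g: "\<gamma> 0 = x" "\<gamma> (d x y) = y" "A = \<gamma> ` {0..d x y}"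
    "\<And>s t. s \<in> {0..d x y} \<Longrightarrow> t \<in> {0..d x y} \<Longrightarrow> d (\<gamma> s) (\<gamma> t) = \<bar>s - t\<bar>"
    using assms by (auto simp: geodesic_segment_def)
  then obtain t where t: "t \<in> {0..d x y}" "p = \<gamma> t" using assms(2) by auto
  have "d (\<gamma> 0) (\<gamma> t) = \<bar>0 - t\<bar>" "d (\<gamma> t) (\<gamma> (d x y)) = \<bar>t - d x y\<bar>" using g(4) t by auto
  then show ?thesis using g t by auto
qed

lemma geodesic_segment_point:
  assumes "geodesic_segment M d x y A" "0 \<le> t" "t \<le> d x y"
  shows "\<exists>p\<in>A. d x p = t \<and> d p y = d x y - t"
proof -
  obtain \<gamma> where g: "\<gamma> 0 = x" "\<gamma> (d x y) = y" "A = \<gamma> ` {0..d x y}"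
    "\<And>s t. s \<in> {0..d x y} \<Longrightarrow> t \<in> {0..d x y} \<Longrightarrow> d (\<gamma> s) (\<gamma> t) = \<bar>s - t\<bar>"
    using assms by (auto simp: geodesic_segment_def)
  have "d (\<gamma> 0) (\<gamma> t) = \<bar>0 - t\<bar>" "d (\<gamma> t) (\<gamma> (d x y)) = \<bar>t - d x y\<bar>" using g(4) assms by auto
  then show ?thesis using g assms by (intro bexI[of _ "\<gamma> t"]) auto
qed

lemma geodesic_segment_sym:
  assumes "geodesic_segment M d x y A" shows "geodesic_segment M d y x A"
proof -
  obtain \<gamma> where g: "\<gamma> ` {0..d x y} \<subseteq> M" "\<gamma> 0 = x" "\<gamma> (d x y) = y" "A = \<gamma> ` {0..d x y}"
    "\<And>s t. s \<in> {0..d x y} \<Longrightarrow> t \<in> {0..d x y} \<Longrightarrow> d (\<gamma> s) (\<gamma> t) = \<bar>s - t\<bar>"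
    using assms by (auto simp: geodesic_segment_def)
  have im: "(\<lambda>t. \<gamma> (d x y - t)) ` {0..d x y} = \<gamma> ` {0..d x y}"
  proof (intro equalityI subsetI)
    fix p assume "p \<in> \<gamma> ` {0..d x y}"
    then obtain t where "t \<in> {0..d x y}" "p = \<gamma> t" by auto
    then show "p \<in> (\<lambda>t. \<gamma> (d x y - t)) ` {0..d x y}" by (intro image_eqI[of _ _ "d x y - t"]) auto
  qed auto
  show ?thesis
    unfolding geodesic_segment_def commute[of y x]
    by (rule exI[of _ "\<lambda>t. \<gamma> (d x y - t)"]) (use g im in auto)
qed

lemma geodesic_segment_trivial: "x \<in> M \<Longrightarrow> geodesic_segment M d x x {x}"
  unfolding geodesic_segment_def by (rule exI[of _ "\<lambda>_. x"]) auto

lemma lipschitz_path_segment: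
  assumes "lipschitz_path M d x y l \<gamma>" "d x y = l"
  shows "geodesic_segment M d x y (\<gamma> ` {0..l})"
  unfolding geodesic_segment_def assms(2)
proof (intro exI[of _ \<gamma>] conjI ballI)
  note g = assms(1)[unfolded lipschitz_path_def]
  have key: "d (\<gamma> s) (\<gamma> t) = t - s" if "s \<in> {0..l}" "t \<in> {0..l}" "s \<le> t" for s t
  proof -
    have X: "\<gamma> 0 \<in> M" "\<gamma> s \<in> M" "\<gamma> t \<in> M" "\<gamma> l \<in> M" using g that by auto
    have "d (\<gamma> s) (\<gamma> t) \<le> t - s" "d (\<gamma> 0) (\<gamma> s) \<le> s - 0" "d (\<gamma> t) (\<gamma> l) \<le> l - t"
      by (rule lipschitz_pathD[OF assms(1)]; use that in simp)+
    then show ?thesis using triangle[OF X(1,2,4)] triangle[OF X(2,3,4)] g assms(2) by auto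
  qed
  fix s t assume "s \<in> {0..l}" "t \<in> {0..l}"
  then show "d (\<gamma> s) (\<gamma> t) = \<bar>s - t\<bar>"
    using key[of s t] key[of t s] commute[of "\<gamma> s" "\<gamma> t"] by (cases "s \<le> t") auto
qed (use assms in \<open>auto simp: lipschitz_path_def\<close>)

lemma segment_lipschitz_path:
  assumes "geodesic_segment M d x y A"
  obtains \<gamma> where "lipschitz_path M d x y (d x y) \<gamma>" "A = \<gamma> ` {0..d x y}"
    "\<And>s t. s \<in> {0..d x y} \<Longrightarrow> t \<in> {0..d x y} \<Longrightarrow> d (\<gamma> s) (\<gamma> t) = \<bar>s - t\<bar>"
  using assms unfolding geodesic_segment_def lipschitz_path_def by auto

lemma lipschitz_path_join:
  assumes 1: "lipschitz_path M d x y a \<gamma>" and 2: "lipschitz_path M d y z b \<eta>"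
  shows "lipschitz_path M d x z (a + b) (\<lambda>s. if s \<le> a then \<gamma> s else \<eta> (s - a))"
    and "(\<lambda>s. if s \<le> a then \<gamma> s else \<eta> (s - a)) ` {0..a + b} = \<gamma> ` {0..a} \<union> \<eta> ` {0..b}"
proof -
  let ?k = "\<lambda>s. if s \<le> a then \<gamma> s else \<eta> (s - a)"
  note g = 1[unfolded lipschitz_path_def] and h = 2[unfolded lipschitz_path_def]
  show im: "?k ` {0..a + b} = \<gamma> ` {0..a} \<union> \<eta> ` {0..b}"
  proof (intro equalityI subsetI)
    fix p assume "p \<in> \<gamma> ` {0..a} \<union> \<eta> ` {0..b}"
    then consider t where "t \<in> {0..a}" "p = \<gamma> t" | t where "t \<in> {0..b}" "p = \<eta> t" by auto
    then show "p \<in> ?k ` {0..a + b}"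
    proof cases
      case 1
      then show ?thesis using h by (intro image_eqI[of _ _ t]) auto
    next
      case 2
      then show ?thesis using g h by (intro image_eqI[of _ _ "t + a"]) auto
    qed
  qed auto
  show "lipschitz_path M d x z (a + b) ?k"
    unfolding lipschitz_path_def
  proof (intro conjI ballI impI)
    fix s t assume st: "s \<in> {0..a + b}" "t \<in> {0..a + b}" "s \<le> t"
    show "d (?k s) (?k t) \<le> t - s"
    proof (cases "t \<le> a \<or> a < s")
      case True
      then show ?thesis
        using lipschitz_pathD[OF 1, of s t] lipschitz_pathD[OF 2, of "s - a" "t - a"] st by auto
    next
      case False
      then have f: "s \<le> a" "a < t" by auto
      have X: "\<gamma> s \<in> M" "y \<in> M" "\<eta> (t - a) \<in> M" using g h st f by auto
      have "d (\<gamma> s) (\<gamma> a) \<le> a - s" by (rule lipschitz_pathD[OF 1]) (use st f in auto)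
      moreover have "d (\<eta> 0) (\<eta> (t - a)) \<le> (t - a) - 0" by (rule lipschitz_pathD[OF 2]) (use st f in auto)
      ultimately have "d (\<gamma> s) (\<gamma> a) \<le> a - s" "d (\<eta> 0) (\<eta> (t - a)) \<le> (t - a) - 0" by auto
      then show ?thesis using triangle[OF X] g h f by auto
    qed
  qed (use g h im in auto)
qed

text \<open>Walking along \<open>A\<close> from \<open>x\<close> to \<open>y\<close>, one changes
  from being near the side towards \<open>x\<close> to being near the side towards \<open>y\<close>.
  A point near both sides is almost on a geodesic from \<open>w\<close> to \<open>x\<close> and on
  one from \<open>w\<close> to \<open>y\<close>, so its distance from \<open>w\<close> is almost the
  Gromov product of \<open>x\<close> and \<open>y\<close>.\<close>

lemma slim_meeting_point:
  assumes hyp: "hyperbolic_space M d \<delta>" and X: "x \<in> M" "y \<in> M" "w \<in> M"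
    and A: "geodesic_segment M d x y A" and e: "e > 0"
  shows "\<exists>p\<in>A. 2 * d w p \<le> d w x + d w y - d x y + 4 * \<delta> + e"
proof -
  have geo: "\<exists>A. geodesic_segment M d u v A" if "u \<in> M" "v \<in> M" for u v
    using hyp that by (auto simp: hyperbolic_space_def geodesic_space_def)
  obtain B C where B: "geodesic_segment M d y w B" and C: "geodesic_segment M d w x C"
    using geo X by blast
  have slim: "A \<subseteq> closed_nbhd M d \<delta> (B \<union> C)"
    using hyp X A B C unfolding hyperbolic_space_def by blast
  obtain \<gamma> where g: "lipschitz_path M d x y (d x y) \<gamma>" "A = \<gamma> ` {0..d x y}"
    "\<And>s t. s \<in> {0..d x y} \<Longrightarrow> t \<in> {0..d x y} \<Longrightarrow> d (\<gamma> s) (\<gamma> t) = \<bar>s - t\<bar>"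
    using segment_lipschitz_path[OF A] by metis
  let ?l = "d x y"
  \<comment> \<open>The change happens at \<open>Sup T\<close>. A parameter of \<open>T\<close> just
    below it is near \<open>C\<close>; just above it, or at the end \<open>y\<close>, there is a
    point near \<open>B\<close>. The slack \<open>e\<close> covers the gap between the two.\<close>
  define T where "T = {t \<in> {0..?l}. \<exists>q\<in>C. d (\<gamma> t) q \<le> \<delta>}"
  have d0: "0 \<le> \<delta>"
  proof -
    have "x \<in> closed_nbhd M d \<delta> (B \<union> C)" using slim geodesic_segment_endpoints(1)[OF A] by blast
    then obtain q where "d x q \<le> \<delta>" by (auto simp: closed_nbhd_def)
    then show ?thesis using nonneg[of x q] by linarith
  qed
  have "0 \<in> T"
    using g(1) d0 geodesic_segment_endpoints(2)[OF C] X by (auto simp: T_def lipschitz_path_def intro!: bexI[of _ x])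
  then have Tne: "T \<noteq> {}" by auto
  have Tbd: "bdd_above T" by (auto simp: T_def intro!: bdd_aboveI[of _ ?l])
  define s where "s = Sup T"
  have s_le: "t \<le> s" if "t \<in> T" for t unfolding s_def by (rule cSup_upper[OF that Tbd])
  have s0: "0 \<le> s" using s_le[OF \<open>0 \<in> T\<close>] .
  define e' where "e' = e / 8"
  have e': "e' > 0" using e by (simp add: e'_def)
  obtain t where t: "t \<in> T" "s - e' < t" using less_cSupD[OF Tne, of "s - e'"] e' by (auto simp: s_def)
  obtain q where q: "q \<in> C" "d (\<gamma> t) q \<le> \<delta>" and tl: "t \<in> {0..?l}" using t by (auto simp: T_def)
  have "\<exists>r\<in>B. d (\<gamma> t) r \<le> \<delta> + 2 * e'"
  proof (cases "s + e' \<le> ?l")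
    case True
    have u: "s + e' \<in> {0..?l}" using True s0 e' by auto
    have "s + e' \<notin> T" using s_le[of "s + e'"] e' by auto
    moreover have "\<gamma> (s + e') \<in> closed_nbhd M d \<delta> (B \<union> C)" using slim g(2) u by blast
    ultimately obtain r where r: "r \<in> B" "d (\<gamma> (s + e')) r \<le> \<delta>"
      using u by (auto simp: T_def closed_nbhd_def)
    have Y: "\<gamma> t \<in> M" "\<gamma> (s + e') \<in> M" "r \<in> M"
      using g(1) tl u r geodesic_segment_endpoints(3)[OF B] by (auto simp: lipschitz_path_def)
    have "d (\<gamma> t) (\<gamma> (s + e')) \<le> 2 * e'" using g(3)[OF tl u] t s_le[of t] e' by auto
    then show ?thesis using triangle[OF Y] r by (intro bexI[of _ r]) auto
  next
    case False
    have l: "?l \<in> {0..?l}" by simp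
    have "d (\<gamma> t) (\<gamma> ?l) \<le> 2 * e'" using g(3)[OF tl l] t tl False by auto
    then show ?thesis using g(1) geodesic_segment_endpoints(1)[OF B] d0
      by (intro bexI[of _ y]) (auto simp: lipschitz_path_def)
  qed
  then obtain r where r: "r \<in> B" "d (\<gamma> t) r \<le> \<delta> + 2 * e'" by blast
  let ?p = "\<gamma> t"
  have p: "?p \<in> A" "?p \<in> M" using g(2) tl geodesic_segment_endpoints(3)[OF A] by auto
  have qr: "q \<in> M" "r \<in> M" using q r geodesic_segment_endpoints(3)[OF B] geodesic_segment_endpoints(3)[OF C] by auto
  have "d w q + d q x = d w x" "d y r + d r w = d y w" "d x ?p + d ?p y = d x y"
    using geodesic_segment_dist[OF C q(1)] geodesic_segment_dist[OF B r(1)] geodesic_segment_dist[OF A p(1)] .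
  moreover have "d w ?p \<le> d w q + d ?p q" "d x ?p \<le> d q x + d ?p q" "d w ?p \<le> d r w + d ?p r" "d ?p y \<le> d y r + d ?p r"
    using triangle[OF X(3) qr(1) p(2)] triangle[OF X(1) qr(1) p(2)] triangle[OF X(3) qr(2) p(2)]
      triangle[OF X(2) qr(2) p(2)] by (simp_all add: commute)
  ultimately have "2 * d w ?p \<le> d w x + d w y - d x y + 4 * \<delta> + 4 * e'"
    using q r by (simp add: commute)
  moreover have "4 * e' \<le> e" using e by (simp add: e'_def)
  ultimately have "2 * d w ?p \<le> d w x + d w y - d x y + 4 * \<delta> + e" by linarith
  then show ?thesis using p by blast
qed

text \<open>The point \<open>p\<close> realises the Gromov product of \<open>x\<close> and
  \<open>y\<close> at \<open>w\<close> up to \<open>2 * \<delta>\<close>. It is within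
  \<open>\<delta>\<close> of a point \<open>q\<close> on another side, and the distance of
  \<open>w\<close> from a segment is at least the Gromov product of its ends.\<close>

lemma slim_imp_four_point:
  assumes hyp: "hyperbolic_space M d \<delta>"
  shows "four_point M d (3 * \<delta>)"
  unfolding four_point_def
proof (intro ballI)
  fix x y z w assume X: "x \<in> M" "y \<in> M" "z \<in> M" "w \<in> M"
  show "d x y + d z w \<le> max (d x z + d y w) (d x w + d y z) + 2 * (3 * \<delta>)"
  proof (rule field_le_epsilon)
    fix e :: real assume e: "0 < e"
    have geo: "\<exists>A. geodesic_segment M d u v A" if "u \<in> M" "v \<in> M" for u v
      using hyp that by (auto simp: hyperbolic_space_def geodesic_space_def)
    obtain A B C where A: "geodesic_segment M d x y A" and B: "geodesic_segment M d y z B"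
      and C: "geodesic_segment M d z x C"
      using geo X by metis
    obtain p where p: "p \<in> A" "2 * d w p \<le> d w x + d w y - d x y + 4 * \<delta> + e"
      using slim_meeting_point[OF hyp X(1,2,4) A e] by blast
    have "A \<subseteq> closed_nbhd M d \<delta> (B \<union> C)" using hyp X A B C unfolding hyperbolic_space_def by blast
    then obtain q where q: "q \<in> B \<union> C" "d p q \<le> \<delta>" using p by (auto simp: closed_nbhd_def)
    have M: "p \<in> M" "q \<in> M"
      using p q geodesic_segment_endpoints(3)[OF A] geodesic_segment_endpoints(3)[OF B]
        geodesic_segment_endpoints(3)[OF C] by auto
    have wq: "d w q \<le> d w p + \<delta>" using triangle[OF X(4) M] q by simp
    have tri: "d w u \<le> d w q + d q u" if "u \<in> M" for u using triangle[OF X(4) M(2) that] .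
    show "d x y + d z w \<le> max (d x z + d y w) (d x w + d y z) + 2 * (3 * \<delta>) + e"
    proof (cases "q \<in> B")
      case True
      have "d y q + d q z = d y z" by (rule geodesic_segment_dist[OF B True])
      then have "d w y + d w z - d y z \<le> 2 * d w q" using tri[OF X(2)] tri[OF X(3)] by (simp add: commute)
      then have "d x y + d z w \<le> (d x w + d y z) + 2 * (3 * \<delta>) + e" using p(2) wq by (simp add: commute)
      then show ?thesis by linarith
    next
      case False
      then have "q \<in> C" using q by blast
      then have "d z q + d q x = d z x" by (rule geodesic_segment_dist[OF C])
      then have "d w x + d w z - d x z \<le> 2 * d w q" using tri[OF X(1)] tri[OF X(3)] by (simp add: commute)
      then have "d x y + d z w \<le> (d x z + d y w) + 2 * (3 * \<delta>) + e" using p(2) wq by (simp add: commute)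
      then show ?thesis by linarith
    qed
  qed
qed

text \<open>Applied to \<open>p\<close>, \<open>z\<close> and the ends of \<open>A\<close>, the
  condition says that \<open>p\<close> is within \<open>2 * \<delta>\<close> of lying between
  \<open>z\<close> and one of the ends \<open>u\<close>. Applied again to the point of that side at
  the same distance from \<open>u\<close>, it costs another \<open>2 * \<delta>\<close>.\<close>

lemma four_point_slim_side:
  assumes fp: "four_point M d \<delta>" and X: "x \<in> M" "y \<in> M" "z \<in> M"
    and A: "geodesic_segment M d x y A" and B: "geodesic_segment M d y z B" and C: "geodesic_segment M d z x C"
  shows "A \<subseteq> closed_nbhd M d (4 * \<delta>) (B \<union> C)"
proof
  fix p assume p: "p \<in> A"
  then have pM: "p \<in> M" using geodesic_segment_endpoints(3)[OF A] by auto
  have pd: "d x p + d p y = d x y" by (rule geodesic_segment_dist[OF A p])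
  have d0: "0 \<le> \<delta>" using four_pointD[OF fp X(1,1,1,1)] X by simp
  have near: "\<exists>q\<in>E. d p q \<le> 4 * \<delta>"
    if u: "u \<in> M" and E: "geodesic_segment M d u z E" and le: "d p z + d p u \<le> d u z + 2 * \<delta>" for u E
  proof -
    \<comment> \<open>The distance \<open>d u p\<close> may exceed the length of the side; then the
      point taken is \<open>z\<close> itself.\<close>
    define t where "t = min (d u p) (d u z)"
    have "0 \<le> t" "t \<le> d u z" by (auto simp: t_def)
    from geodesic_segment_point[OF E this]
    obtain q where q: "q \<in> E" "d u q = t" "d q z = d u z - t" by blast
    have qM: "q \<in> M" using q geodesic_segment_endpoints(3)[OF E] by auto
    have "d p q + d u z \<le> max (d p u + d q z) (d p z + d q u) + 2 * \<delta>" by (rule four_pointD[OF fp pM qM u X(3)])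
    moreover have "d p q \<le> 4 * \<delta>" if "t = d u z"
    proof -
      have "q = z" using q that qM X by simp
      moreover have "d u z \<le> d u p" using that by (simp add: t_def min_def split: if_splits)
      ultimately show ?thesis using le d0 by (simp add: commute)
    qed
    ultimately have "d p q \<le> 4 * \<delta>" using q le d0 by (auto simp: t_def min_def max_def commute split: if_splits)
    then show ?thesis using q by blast
  qed
  have "d p z + d x y \<le> max (d p x + d z y) (d p y + d z x) + 2 * \<delta>" by (rule four_pointD[OF fp pM X(3,1,2)])
  then consider "d p z + d p y \<le> d y z + 2 * \<delta>" | "d p z + d p x \<le> d x z + 2 * \<delta>"
    using pd by (auto simp: commute max_def split: if_splits)
  then show "p \<in> closed_nbhd M d (4 * \<delta>) (B \<union> C)"
  proof cases
    case 1
    then show ?thesis using near[OF X(2) B 1] pM by (auto simp: closed_nbhd_def)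
  next
    case 2
    then show ?thesis using near[OF X(1) geodesic_segment_sym[OF C] 2] pM by (auto simp: closed_nbhd_def)
  qed
qed

lemma four_point_imp_slim:
  assumes "geodesic_space M d" "four_point M d \<delta>"
  shows "hyperbolic_space M d (4 * \<delta>)"
  unfolding hyperbolic_space_def
  using assms four_point_slim_side[OF assms(2)] by blast

text \<open>The sides from \<open>z\<close> to \<open>x\<close> and to \<open>y\<close> agree at a
  last point and meet nowhere after it. Their remaining parts therefore concatenate to a segment,
  which by uniqueness is the third side, so every triangle is a tripod.\<close>

lemma real_tree_imp_slim:
  assumes tree: "real_tree M d"
  shows "hyperbolic_space M d 0"
proof -
  have uniq: "A = B" if "x \<in> M" "y \<in> M" "geodesic_segment M d x y A" "geodesic_segment M d x y B" for x y A B
    using tree that unfolding real_tree_def by blast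
  have concat: "geodesic_segment M d y z (A \<union> B)"
    if "x \<in> M" "y \<in> M" "z \<in> M" "geodesic_segment M d y x A" "geodesic_segment M d x z B" "A \<inter> B = {x}" for x y z A B
    using tree that unfolding real_tree_def by blast
  have side: "A \<subseteq> B \<union> C"
    if X: "x \<in> M" "y \<in> M" "z \<in> M" and A: "geodesic_segment M d x y A"
      and B: "geodesic_segment M d y z B" and C: "geodesic_segment M d z x C" for x y z A B C
  proof -
    obtain \<gamma> where g: "lipschitz_path M d z x (d z x) \<gamma>" "C = \<gamma> ` {0..d z x}"
      "\<And>s t. s \<in> {0..d z x} \<Longrightarrow> t \<in> {0..d z x} \<Longrightarrow> d (\<gamma> s) (\<gamma> t) = \<bar>s - t\<bar>"
      using segment_lipschitz_path[OF C] by metis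
    obtain \<eta> where h: "lipschitz_path M d z y (d z y) \<eta>" "B = \<eta> ` {0..d z y}"
      "\<And>s t. s \<in> {0..d z y} \<Longrightarrow> t \<in> {0..d z y} \<Longrightarrow> d (\<eta> s) (\<eta> t) = \<bar>s - t\<bar>"
      using segment_lipschitz_path[OF geodesic_segment_sym[OF B]] by metis
    have g0: "\<gamma> 0 = z" "\<gamma> (d z x) = x" "\<eta> 0 = z" "\<eta> (d z y) = y"
      using g(1) h(1) by (auto simp: lipschitz_path_def)
    have gM: "t \<in> {0..d z x} \<Longrightarrow> \<gamma> t \<in> M" and hM: "t \<in> {0..d z y} \<Longrightarrow> \<eta> t \<in> M" for t
      using g(1) h(1) by (auto simp: lipschitz_path_def)
    have eq: "t = t'" if "t \<in> {0..d z x}" "t' \<in> {0..d z y}" "\<gamma> t = \<eta> t'" for t t'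
      using g(3)[of 0 t] h(3)[of 0 t'] that g0 by auto
    define T where "T = {t \<in> {0..d z x}. t \<le> d z y \<and> \<gamma> t = \<eta> t}"
    have T0: "0 \<in> T" using g0 by (auto simp: T_def)
    then have Tne: "T \<noteq> {}" by auto
    have Tbd: "bdd_above T" by (auto simp: T_def intro!: bdd_aboveI[of _ "d z x"])
    define s where "s = Sup T"
    have s_le: "t \<le> s" if "t \<in> T" for t unfolding s_def by (rule cSup_upper[OF that Tbd])
    have s: "0 \<le> s" "s \<le> d z x" "s \<le> d z y"
      using s_le[OF T0] cSup_least[OF Tne, of "d z x"] cSup_least[OF Tne, of "d z y"] by (auto simp: s_def T_def)
    \<comment> \<open>The supremum is attained: parameters of \<open>T\<close> just below
      \<open>s\<close> give \<open>\<gamma> s\<close> and \<open>\<eta> s\<close> a distance smaller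
      than any \<open>e\<close>.\<close>
    have "d (\<gamma> s) (\<eta> s) \<le> 0"
    proof (rule field_le_epsilon)
      fix e :: real assume e: "0 < e"
      obtain t where t: "t \<in> T" "s - e / 2 < t" using less_cSupD[OF Tne, of "s - e / 2"] e by (auto simp: s_def)
      have M: "\<gamma> s \<in> M" "\<gamma> t \<in> M" "\<eta> s \<in> M" using gM hM s t by (auto simp: T_def)
      have "d (\<gamma> s) (\<gamma> t) = \<bar>s - t\<bar>" "d (\<eta> t) (\<eta> s) = \<bar>t - s\<bar>"
        using g(3)[of s t] h(3)[of t s] s t by (auto simp: T_def)
      then show "d (\<gamma> s) (\<eta> s) \<le> 0 + e"
        using triangle[OF M] t s_le[of t] e by (auto simp: T_def)
    qed
    then have go: "\<gamma> s = \<eta> s" using gM hM s nonneg[of "\<gamma> s" "\<eta> s"] by (metis antisym atLeastAtMost_iff zero)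
    let ?o = "\<gamma> s"
    have oM: "?o \<in> M" using gM s by auto
    have dx: "d ?o x = d z x - s" "d ?o y = d z y - s"
      using g(3)[of s "d z x"] h(3)[of s "d z y"] s g0 go by auto
    have seg: "geodesic_segment M d (f s) (f l) (f ` {s..l})"
      if f: "lipschitz_path M d z u l f" "d (f s) u = l - s" "s \<le> l" for f l u
    proof -
      have "d (f (a + s)) (f (b + s)) \<le> b - a" if "0 \<le> a" "a \<le> b" "b \<le> l - s" for a b
        using lipschitz_pathD[OF f(1), of "a + s" "b + s"] that s by auto
      then have "lipschitz_path M d (f s) (f l) (l - s) (\<lambda>t. f (t + s))"
        using f s unfolding lipschitz_path_def by auto
      moreover have "d (f s) (f l) = l - s" using f by (auto simp: lipschitz_path_def)
      moreover have "(\<lambda>t. f (t + s)) ` {0..l - s} = f ` {s..l}"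
      proof (intro equalityI subsetI)
        fix p assume "p \<in> f ` {s..l}"
        then obtain t where "t \<in> {s..l}" "p = f t" by auto
        then show "p \<in> (\<lambda>t. f (t + s)) ` {0..l - s}" by (intro image_eqI[of _ _ "t - s"]) auto
      qed auto
      ultimately show ?thesis using lipschitz_path_segment by metis
    qed
    have S1: "geodesic_segment M d ?o x (\<gamma> ` {s..d z x})" using seg[OF g(1)] dx s g0 by simp
    have S2: "geodesic_segment M d ?o y (\<eta> ` {s..d z y})" using seg[OF h(1)] dx s g0 go by simp
    \<comment> \<open>Parameters are distances from \<open>z\<close>, so a common point has the same
      parameter on both sides and hence belongs to \<open>T\<close>.\<close>
    have int: "\<eta> ` {s..d z y} \<inter> \<gamma> ` {s..d z x} = {?o}"
    proof (intro equalityI subsetI)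
      fix p assume "p \<in> \<eta> ` {s..d z y} \<inter> \<gamma> ` {s..d z x}"
      then obtain t t' where t: "t \<in> {s..d z x}" "t' \<in> {s..d z y}" "p = \<gamma> t" "p = \<eta> t'" by auto
      then have "t = t'" using eq[of t t'] s by auto
      then have "t \<in> T" using t s by (auto simp: T_def)
      then have "t = s" using s_le[of t] t by auto
      then show "p \<in> {?o}" using t by simp
    next
      fix p assume "p \<in> {?o}"
      then show "p \<in> \<eta> ` {s..d z y} \<inter> \<gamma> ` {s..d z x}"
        using go s imageI[of s "{s..d z x}" \<gamma>] imageI[of s "{s..d z y}" \<eta>] by auto
    qed
    have "geodesic_segment M d y x (\<eta> ` {s..d z y} \<union> \<gamma> ` {s..d z x})"
      by (rule concat[OF oM X(2,1) geodesic_segment_sym[OF S2] S1 int])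
    then have "A = \<eta> ` {s..d z y} \<union> \<gamma> ` {s..d z x}"
      using uniq[OF X(1,2) A geodesic_segment_sym] by blast
    then show ?thesis using g(2) h(2) s by auto
  qed
  have nb: "E \<subseteq> M \<Longrightarrow> E \<subseteq> F \<Longrightarrow> E \<subseteq> closed_nbhd M d 0 F" for E F
    by (auto simp: closed_nbhd_def intro!: bexI)
  show ?thesis
    unfolding hyperbolic_space_def
  proof (intro conjI ballI allI impI)
    note real_tree_ex_segment[OF tree]
    then show "geodesic_space M d"
      unfolding geodesic_space_def by (intro conjI ballI Metric_space_axioms)
    fix x y z A B C
    assume X: "x \<in> M" "y \<in> M" "z \<in> M"
      and "geodesic_segment M d x y A \<and> geodesic_segment M d y z B \<and> geodesic_segment M d z x C"
    then have A: "geodesic_segment M d x y A" and B: "geodesic_segment M d y z B" and C: "geodesic_segment M d z x C"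
      by auto
    show "A \<subseteq> closed_nbhd M d 0 (B \<union> C)"
      by (rule nb[OF geodesic_segment_endpoints(3)[OF A] side[OF X A B C]])
    show "B \<subseteq> closed_nbhd M d 0 (C \<union> A)"
      by (rule nb[OF geodesic_segment_endpoints(3)[OF B] side[OF X(2,3,1) B C A]])
    show "C \<subseteq> closed_nbhd M d 0 (A \<union> B)"
      by (rule nb[OF geodesic_segment_endpoints(3)[OF C] side[OF X(3,1,2) C A B]])
  qed
qed

text \<open>Uniqueness of segments is slimness with constant 0 of the degenerate triangle
  \<open>x\<close>, \<open>y\<close>, \<open>y\<close>. For concatenation, the two segments from
  \<open>x\<close> coincide at the distance given by the Gromov product of \<open>y\<close> and
  \<open>z\<close>; as they meet only in \<open>x\<close>, this product is 0 and the lengths add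
  up.\<close>

lemma four_point_imp_real_tree:
  assumes geo: "geodesic_space M d" and fp: "four_point M d 0"
  shows "real_tree M d"
  unfolding real_tree_def
proof (intro conjI ballI allI impI)
  show "Metric_space M d" by (rule Metric_space_axioms)
  have sub: "A \<subseteq> B" if X: "x \<in> M" "y \<in> M" and A: "geodesic_segment M d x y A" and B: "geodesic_segment M d x y B"
    for x y A B
  proof -
    have "A \<subseteq> closed_nbhd M d (4 * 0) ({y} \<union> B)"
      by (rule four_point_slim_side[OF fp X X(2) A geodesic_segment_trivial[OF X(2)] geodesic_segment_sym[OF B]])
    moreover have "p \<in> B" if p: "p \<in> M" "q \<in> {y} \<union> B" "d p q \<le> 0" for p q
    proof -
      have qM: "q \<in> B" using p geodesic_segment_endpoints[OF B] by auto
      then have "q \<in> M" using geodesic_segment_endpoints(3)[OF B] by auto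
      then have "p = q" using p nonneg[of p q] zero[of p q] by (simp add: antisym)
      then show ?thesis using qM by simp
    qed
    ultimately show ?thesis by (auto simp: closed_nbhd_def)
  qed
  show "\<exists>!A. geodesic_segment M d x y A" if "x \<in> M" "y \<in> M" for x y
    using geo that sub by (fastforce simp: geodesic_space_def)
  fix x y z A B
  assume X: "x \<in> M" "y \<in> M" "z \<in> M"
    and "geodesic_segment M d y x A \<and> geodesic_segment M d x z B \<and> A \<inter> B = {x}"
  then have A: "geodesic_segment M d y x A" and B: "geodesic_segment M d x z B" and int: "A \<inter> B = {x}" by auto
  \<comment> \<open>The Gromov product of \<open>y\<close> and \<open>z\<close> at \<open>x\<close>,
    which is the length of the common leg of the tripod.\<close>
  define t where "t = (d x y + d x z - d y z) / 2"
  have t: "0 \<le> t" "t \<le> d x y" "t \<le> d x z"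
    using triangle[OF X(2,1,3)] triangle[OF X(1,3,2)] triangle[OF X(1,2,3)] by (auto simp: t_def commute)
  obtain p where p: "p \<in> A" "d x p = t" "d p y = d x y - t"
    using geodesic_segment_point[OF geodesic_segment_sym[OF A] t(1,2)] by blast
  obtain q where q: "q \<in> B" "d x q = t" "d q z = d x z - t"
    using geodesic_segment_point[OF B t(1,3)] by blast
  have M: "p \<in> M" "q \<in> M" using p q geodesic_segment_endpoints(3)[OF A] geodesic_segment_endpoints(3)[OF B] by auto
  have "d p z + d x y \<le> max (d p x + d z y) (d p y + d z x) + 2 * 0" by (rule four_pointD[OF fp M(1) X(3,1,2)])
  moreover have "2 * t = d x y + d x z - d y z" by (simp add: t_def)
  then have "d z y = d x y + d x z - 2 * t" by (simp add: commute)
  ultimately have pz: "d p z \<le> d x z - t" using p by (auto simp: commute max_def split: if_splits)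
  have "d p q + d x z \<le> max (d p x + d q z) (d p z + d q x) + 2 * 0" by (rule four_pointD[OF fp M X(1,3)])
  then have "d p q \<le> 0" using pz p q by (auto simp: commute max_def split: if_splits)
  then have "p = q" using M nonneg[of p q] zero[of p q] by (simp add: antisym)
  then have "p = x" using int p q by auto
  then have "t = 0" using p X by simp
  then have "d y z = d y x + d x z" by (simp add: t_def commute)
  moreover obtain \<gamma> \<eta> where g: "lipschitz_path M d y x (d y x) \<gamma>" "A = \<gamma> ` {0..d y x}"
    and h: "lipschitz_path M d x z (d x z) \<eta>" "B = \<eta> ` {0..d x z}"
    using segment_lipschitz_path[OF A] segment_lipschitz_path[OF B] by metis
  ultimately show "geodesic_segment M d y z (A \<union> B)"
    using lipschitz_path_segment[OF lipschitz_path_join(1)[OF g(1) h(1)]] lipschitz_path_join(2)[OF g(1) h(1)] by simp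
qed

end

text \<open>A path in a real tree contains the segment between its endpoints: a point \<open>p\<close> of the segment off the
  path would separate the endpoints, since points with positive Gromov product at \<open>p\<close> form open classes.\<close>

lemma real_tree_bilipschitz:
  assumes tree: "real_tree M d" and geo: "geodesic_space M d'" and L: "0 < L"
    and d'd: "\<And>x y. x \<in> M \<Longrightarrow> y \<in> M \<Longrightarrow> d' x y \<le> L * d x y"
    and dd': "\<And>x y. x \<in> M \<Longrightarrow> y \<in> M \<Longrightarrow> d x y \<le> L * d' x y"
  shows "real_tree M d'"
proof -
  interpret d: Metric_space M d using tree by (simp add: real_tree_def)
  interpret d': Metric_space M d' using geo by (simp add: geodesic_space_def)
  have fp: "four_point M d 0" using d.slim_imp_four_point[OF d.real_tree_imp_slim[OF tree]] by simp
  have same: "A' = A"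
    if X: "x \<in> M" "y \<in> M" and A: "geodesic_segment M d x y A" and A': "geodesic_segment M d' x y A'" for x y A A'
  proof -
    let ?l = "d' x y"
    obtain g' where g': "lipschitz_path M d' x y ?l g'" "A' = g' ` {0..?l}"
      "\<And>s t. s \<in> {0..?l} \<Longrightarrow> t \<in> {0..?l} \<Longrightarrow> d' (g' s) (g' t) = \<bar>s - t\<bar>"
      using d'.segment_lipschitz_path[OF A'] by metis
    have g'M: "t \<in> {0..?l} \<Longrightarrow> g' t \<in> M" for t using g'(1) by (auto simp: lipschitz_path_def)
    have g'0: "g' 0 = x" "g' ?l = y" using g'(1) by (auto simp: lipschitz_path_def)
    obtain g where g: "lipschitz_path M d x y (d x y) g" "A = g ` {0..d x y}"
      "\<And>s t. s \<in> {0..d x y} \<Longrightarrow> t \<in> {0..d x y} \<Longrightarrow> d (g s) (g t) = \<bar>s - t\<bar>"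
      using d.segment_lipschitz_path[OF A] by metis
    have gM: "t \<in> {0..d x y} \<Longrightarrow> g t \<in> M" for t using g(1) by (auto simp: lipschitz_path_def)
    have g0: "g 0 = x" "g (d x y) = y" using g(1) by (auto simp: lipschitz_path_def)
    have sub: "A \<subseteq> A'"
    proof
      fix p assume p: "p \<in> A"
      show "p \<in> A'"
      proof (rule ccontr)
        assume np: "p \<notin> A'"
        have pM: "p \<in> M" using p d.geodesic_segment_endpoints(3)[OF A] by auto
        have pos: "0 < d p (g' t)" if "t \<in> {0..?l}" for t
          using np g'(2) that d.mdist_pos_eq[OF pM g'M[OF that]] by auto
        \<comment> \<open>\<open>f t\<close> says that \<open>x\<close> and \<open>g' t\<close> have
          positive Gromov product at \<open>p\<close>, in other words lie on the same side of
          \<open>p\<close>. It holds at 0, fails at \<open>?l\<close> and is locally constant,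
          against the connectedness of the interval.\<close>
        define f where "f t \<longleftrightarrow> d x (g' t) < d p x + d p (g' t)" for t
        have step: "f u" if f: "f t" and t: "t \<in> {0..?l}" and u: "u \<in> {0..?l}"
          and tu: "d (g' t) (g' u) < d p (g' t)" for t u
        proof -
          have "d p (g' t) + d x (g' u) \<le> max (d p x + d (g' t) (g' u)) (d p (g' u) + d (g' t) x) + 2 * 0"
            by (rule four_pointD[OF fp pM g'M[OF t] X(1) g'M[OF u]])
          then show ?thesis
            using f tu pos[OF t] pos[OF u] unfolding f_def by (auto simp: d.commute max_def split: if_splits)
        qed
        have "f 0 = f ?l"
        proof (rule connected_local_const[of "{0..?l}"])
          show "\<forall>a\<in>{0..?l}. eventually (\<lambda>b. f a = f b) (at a within {0..?l})"
          proof
            fix a assume a: "a \<in> {0..?l}"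
            define e where "e = d p (g' a) / (2 * L)"
            have e: "e > 0" using pos[OF a] L by (simp add: e_def)
            show "eventually (\<lambda>b. f a = f b) (at a within {0..?l})"
              unfolding eventually_at
            proof (intro exI[of _ e] conjI ballI impI e)
              fix b assume b: "b \<in> {0..?l}" "b \<noteq> a \<and> dist b a < e"
              have "d (g' a) (g' b) \<le> L * d' (g' a) (g' b)" using dd' g'M a b by auto
              also have "\<dots> = L * \<bar>a - b\<bar>" using g'(3)[OF a b(1)] by simp
              also have "\<dots> < L * e" using b L by (auto simp: dist_real_def)
              also have "\<dots> = d p (g' a) / 2" using L by (simp add: e_def)
              finally have ab: "d (g' a) (g' b) < d p (g' a) / 2" .
              have "d p (g' a) \<le> d p (g' b) + d (g' a) (g' b)"
                using d.triangle[OF pM g'M[OF b(1)] g'M[OF a]] by (simp add: d.commute)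
              then have "d (g' a) (g' b) < d p (g' b)" using ab by linarith
              moreover have "d (g' a) (g' b) < d p (g' a)" using ab pos[OF a] by linarith
              ultimately show "f a = f b"
                using step[of a b] step[of b a] a b by (auto simp: d.commute)
            qed
          qed
        qed auto
        moreover have "f 0" using pos[of 0] g'0 X by (simp add: f_def d.commute)
        moreover have "\<not> f ?l" using d.geodesic_segment_dist[OF A p] g'0 by (simp add: f_def d.commute)
        ultimately show False by simp
      qed
    qed
    have "A' \<subseteq> A"
    proof
      fix p assume "p \<in> A'"
      then obtain t where t: "t \<in> {0..?l}" "p = g' t" using g'(2) by auto
      have "\<exists>u. u \<in> {0..?l} \<and> g' u = g s" if "s \<in> {0..d x y}" for s
      proof -
        have "g s \<in> g' ` {0..?l}" using sub g(2) g'(2) that by blast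
        then show ?thesis by force
      qed
      \<comment> \<open>For the other inclusion, \<open>h s\<close> is the time at which
        \<open>g'\<close> visits \<open>g s\<close>. It is Lipschitz and runs from 0 to
        \<open>?l\<close>, so it takes every value \<open>t\<close>.\<close>
      then obtain h where h: "\<And>s. s \<in> {0..d x y} \<Longrightarrow> h s \<in> {0..?l} \<and> g' (h s) = g s" by metis
      have inj: "u = v" if "u \<in> {0..?l}" "v \<in> {0..?l}" "g' u = g' v" for u v
        using g'(3)[OF that(1,2)] that(3) g'M[OF that(2)] by simp
      have h0: "h 0 = 0" "h (d x y) = ?l"
        using h[of 0] h[of "d x y"] inj[of "h 0" 0] inj[of "h (d x y)" ?l] g0 g'0 by auto
      have "L-lipschitz_on {0..d x y} h"
      proof (rule lipschitz_onI)
        fix s u assume su: "s \<in> {0..d x y}" "u \<in> {0..d x y}"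
        have "dist (h s) (h u) = d' (g s) (g u)" using g'(3)[of "h s" "h u"] h su by (simp add: dist_real_def)
        also have "\<dots> \<le> L * d (g s) (g u)" using d'd gM su by auto
        finally show "dist (h s) (h u) \<le> L * dist s u" using g(3)[OF su] by (simp add: dist_real_def)
      qed (use L in simp)
      then have "continuous_on {0..d x y} h" by (rule lipschitz_on_continuous_on)
      then obtain s where "0 \<le> s" "s \<le> d x y" "h s = t"
        using IVT'[of h 0 t "d x y"] h0 t by auto
      then show "p \<in> A" using h[of s] g(2) t by auto
    qed
    then show ?thesis using sub by blast
  qed
  have exd: "\<exists>A. geodesic_segment M d x y A" if "x \<in> M" "y \<in> M" for x y
    by (rule real_tree_ex_segment[OF tree that])
  have exd': "\<exists>A. geodesic_segment M d' x y A" if "x \<in> M" "y \<in> M" for x y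
    using geo that unfolding geodesic_space_def by blast
  have tr: "geodesic_segment M d x y A" if "x \<in> M" "y \<in> M" "geodesic_segment M d' x y A" for x y A
    using exd[OF that(1,2)] same that by blast
  have uniq: "A = B" if "x \<in> M" "y \<in> M" "geodesic_segment M d x y A" "geodesic_segment M d x y B" for x y A B
    using tree that unfolding real_tree_def by blast
  have concat: "geodesic_segment M d y z (A \<union> B)"
    if "x \<in> M" "y \<in> M" "z \<in> M" "geodesic_segment M d y x A" "geodesic_segment M d x z B" "A \<inter> B = {x}" for x y z A B
    using tree that unfolding real_tree_def by blast
  show ?thesis
    unfolding real_tree_def
  proof (intro conjI ballI allI impI)
    show "Metric_space M d'" by (rule d'.Metric_space_axioms)
    show "\<exists>!A. geodesic_segment M d' x y A" if "x \<in> M" "y \<in> M" for x y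
    proof (rule ex_ex1I[OF exd'[OF that]])
      fix A B assume A: "geodesic_segment M d' x y A" and B: "geodesic_segment M d' x y B"
      show "A = B" by (rule uniq[OF that tr[OF that A] tr[OF that B]])
    qed
    fix x y z A B assume X: "x \<in> M" "y \<in> M" "z \<in> M"
      and AB: "geodesic_segment M d' y x A \<and> geodesic_segment M d' x z B \<and> A \<inter> B = {x}"
    have "geodesic_segment M d y z (A \<union> B)"
      by (rule concat[OF X tr[OF X(2,1)] tr[OF X(1,3)]]) (use AB in auto)
    moreover obtain C where C: "geodesic_segment M d' y z C" using exd' X by blast
    ultimately have "C = A \<union> B" using same[OF X(2,3) _ C] by blast
    then show "geodesic_segment M d' y z (A \<union> B)" using C by simp
  qed
qed

section \<open>The Cayley graph\<close>

lemma (in Metric_space) lipschitz_path_reverse: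
  assumes "lipschitz_path M d x y l \<gamma>"
  shows "lipschitz_path M d y x l (\<lambda>t. \<gamma> (l - t))"
proof -
  have "d (\<gamma> (l - s)) (\<gamma> (l - t)) \<le> t - s" if "0 \<le> s" "s \<le> t" "t \<le> l" for s t
    using lipschitz_pathD[OF assms, of "l - t" "l - s"] that commute by simp
  then show ?thesis using assms by (auto simp: lipschitz_path_def)
qed

lemma (in Metric_space) lipschitz_path_ex_join:
  "\<exists>\<gamma>. lipschitz_path M d x y a \<gamma> \<Longrightarrow> \<exists>\<gamma>. lipschitz_path M d y z b \<gamma> \<Longrightarrow> \<exists>\<gamma>. lipschitz_path M d x z (a + b) \<gamma>"
  using lipschitz_path_join(1) by blast

section \<open>The path metric of the Cayley graph is a geodesic metric\<close>

context word_group
begin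

abbreviation "pts \<equiv> cayley_points G S"
abbreviation "cdist \<equiv> cayley_dist G S"

text \<open>The closed edge as one map, clamped outside the unit interval and with its ends
  identified with vertices, so that a path along an edge is a single formula.\<close>

definition edge_point :: "'a \<Rightarrow> 'a \<Rightarrow> real \<Rightarrow> 'a cayley_point" where
  "edge_point g s t = (if t \<le> 0 then Vertex g else if 1 \<le> t then Vertex (g \<otimes> s) else EdgePt g s t)"

lemma vertex_in: "g \<in> carrier G \<Longrightarrow> Vertex g \<in> pts"
  by (simp add: cayley_points_def)

lemma Vertex_in_iff: "Vertex g \<in> pts \<longleftrightarrow> g \<in> carrier G"
  by (auto simp: cayley_points_def)

lemma EdgePt_in_iff: "EdgePt g s t \<in> pts \<longleftrightarrow> g \<in> carrier G \<and> s \<in> S \<and> 0 < t \<and> t < 1"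
  by (auto simp: cayley_points_def)

lemma exits_props:
  "p \<in> pts \<Longrightarrow> (u, a) \<in> exits G p \<Longrightarrow> u \<in> carrier G \<and> 0 \<le> a \<and> a \<le> 1"
  using S_carrier by (cases p) (auto simp: Vertex_in_iff EdgePt_in_iff)

lemma ex_exit: "\<exists>u a. (u, a) \<in> exits G p"
  by (cases p) auto

lemma finite_exits: "finite (exits G p)"
  by (cases p) auto

lemma dst_generator: "g \<in> carrier G \<Longrightarrow> s \<in> S \<Longrightarrow> dst g (g \<otimes> s) \<le> 1"
  using dst_mult_right[of g s] len_letter[of s] S_carrier by auto

text \<open>Used to glue two shortest paths at a common point that they reach and leave through
  different exits.\<close>

lemma exits_two:
  assumes "p \<in> pts" "(u, a) \<in> exits G p" "(v, b) \<in> exits G p"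
  shows "real (dst u v) \<le> a + b"
proof (cases p)
  case (Vertex g)
  then show ?thesis using assms by (auto simp: Vertex_in_iff d_self)
next
  case (EdgePt g s t)
  then have g: "g \<in> carrier G" "s \<in> carrier G" "s \<in> S" "0 < t" "t < 1"
    using assms S_carrier by (auto simp: EdgePt_in_iff)
  have "dst g (g \<otimes> s) \<le> 1" "dst (g \<otimes> s) g \<le> 1"
    using dst_generator[OF g(1,3)] d_sym[of g "g \<otimes> s"] g by auto
  then show ?thesis using assms EdgePt g by (auto simp: d_self)
qed

lemma exits_shift:
  assumes "(v, b) \<in> exits G (EdgePt g s t)"
  shows "\<exists>b'. (v, b') \<in> exits G (EdgePt g s t') \<and> b' \<le> b + \<bar>t - t'\<bar>"
  using assms by auto

definition candidates :: "'a cayley_point \<Rightarrow> 'a cayley_point \<Rightarrow> real set" where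
  "candidates p q = {a + real (dst u v) + b | u a v b. (u, a) \<in> exits G p \<and> (v, b) \<in> exits G q} \<union>
     {\<bar>t - t'\<bar> | g s t t'. p = EdgePt g s t \<and> q = EdgePt g s t'}"

lemma cdist_Min: "p \<in> pts \<Longrightarrow> q \<in> pts \<Longrightarrow> cdist p q = Min (candidates p q)"
  by (simp add: cayley_dist_def candidates_def)

lemma finite_candidates: "finite (candidates p q)"
proof -
  have "{a + real (dst u v) + b | u a v b. (u, a) \<in> exits G p \<and> (v, b) \<in> exits G q} \<subseteq>
      (\<lambda>((u, a), (v, b)). a + real (dst u v) + b) ` (exits G p \<times> exits G q)" by force
  moreover have "{\<bar>t - t'\<bar> | g s t t'. p = EdgePt g s t \<and> q = EdgePt g s t'} \<subseteq>
      {\<bar>(case p of EdgePt g s t \<Rightarrow> t | _ \<Rightarrow> 0) - (case q of EdgePt g s t \<Rightarrow> t | _ \<Rightarrow> 0)\<bar>}" by auto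
  ultimately show ?thesis
    unfolding candidates_def by (meson finite_SigmaI finite_exits finite_imageI finite_UnI finite_subset finite.intros)
qed

lemma cdist_le_exit:
  assumes "p \<in> pts" "q \<in> pts" "(u, a) \<in> exits G p" "(v, b) \<in> exits G q"
  shows "cdist p q \<le> a + real (dst u v) + b"
  unfolding cdist_Min[OF assms(1,2)] by (rule Min_le[OF finite_candidates]) (use assms in \<open>auto simp: candidates_def\<close>)

lemma cdist_le_edge:
  assumes "EdgePt g s t \<in> pts" "EdgePt g s t' \<in> pts"
  shows "cdist (EdgePt g s t) (EdgePt g s t') \<le> \<bar>t - t'\<bar>"
  unfolding cdist_Min[OF assms] by (rule Min_le[OF finite_candidates]) (use assms in \<open>auto simp: candidates_def\<close>)

lemma cdist_cases:
  assumes "p \<in> pts" "q \<in> pts"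
  obtains u a v b where "(u, a) \<in> exits G p" "(v, b) \<in> exits G q" "cdist p q = a + real (dst u v) + b"
  | g s t t' where "p = EdgePt g s t" "q = EdgePt g s t'" "cdist p q = \<bar>t - t'\<bar>"
proof -
  obtain u a v b where "(u, a) \<in> exits G p" "(v, b) \<in> exits G q" using ex_exit by metis
  then have "candidates p q \<noteq> {}" by (auto simp: candidates_def)
  then have "cdist p q \<in> candidates p q" unfolding cdist_Min[OF assms] by (rule Min_in[OF finite_candidates])
  then show ?thesis unfolding candidates_def using that by blast
qed

lemma cdist_nonneg: "0 \<le> cdist p q"
proof (cases "p \<in> pts \<and> q \<in> pts")
  case True
  then have pq: "p \<in> pts" "q \<in> pts" by auto
  show ?thesis
    by (rule cdist_cases[OF pq]) (use exits_props[OF pq(1)] exits_props[OF pq(2)] in \<open>force+\<close>)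
qed (auto simp: cayley_dist_def)

lemma cdist_commute: "cdist p q = cdist q p"
proof (cases "p \<in> pts \<and> q \<in> pts")
  case True
  have "cdist p q \<le> cdist q p" if pq: "p \<in> pts" "q \<in> pts" for p q
  proof (rule cdist_cases[OF pq(2,1)])
    fix u a v b assume e: "(u, a) \<in> exits G q" "(v, b) \<in> exits G p" "cdist q p = a + real (dst u v) + b"
    then have "dst u v = dst v u" using exits_props pq by (intro d_sym) blast+
    then show "cdist p q \<le> cdist q p" using cdist_le_exit[OF pq e(2,1)] e by simp
  next
    fix g s t t' assume "q = EdgePt g s t" "p = EdgePt g s t'" "cdist q p = \<bar>t - t'\<bar>"
    then show "cdist p q \<le> cdist q p" using cdist_le_edge[of g s t' t] pq by auto
  qed
  then show ?thesis using True by (simp add: antisym)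
qed (auto simp: cayley_dist_def)

lemma cdist_zero: "p \<in> pts \<Longrightarrow> q \<in> pts \<Longrightarrow> cdist p q = 0 \<longleftrightarrow> p = q"
proof
  assume pq: "p \<in> pts" "q \<in> pts"
  have exit0: "p = Vertex u" if "p \<in> pts" "(u, a) \<in> exits G p" "a = 0" for p u a
    using that by (cases p) (auto simp: EdgePt_in_iff)
  show "p = q" if z: "cdist p q = 0"
  proof (rule cdist_cases[OF pq])
    fix u a v b assume e: "(u, a) \<in> exits G p" "(v, b) \<in> exits G q" "cdist p q = a + real (dst u v) + b"
    have uv: "u \<in> carrier G" "v \<in> carrier G" "0 \<le> a" "0 \<le> b"
      using exits_props[OF pq(1) e(1)] exits_props[OF pq(2) e(2)] by auto
    then have "a = 0" "b = 0" "real (dst u v) = 0" using e z by linarith+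
    then show "p = q" using exit0[OF pq(1) e(1)] exit0[OF pq(2) e(2)] d_eq[OF uv(1,2)] by simp
  qed (use z in auto)
  assume "p = q"
  have "cdist p p \<le> 0"
  proof (cases p)
    case (Vertex g)
    then show ?thesis using cdist_le_exit[of p p g 0 g 0] pq by (auto simp: Vertex_in_iff d_self)
  next
    case (EdgePt g s t)
    then show ?thesis using cdist_le_edge[of g s t t] pq by auto
  qed
  then show "cdist p q = 0" using cdist_nonneg[of p p] \<open>p = q\<close> by simp
qed

text \<open>If both distances are taken through exits, \<open>exits_two\<close> joins them at
  \<open>q\<close>. If one of them stays inside an edge, \<open>exits_shift\<close> moves the exit
  of the other path along that edge; two distances inside an edge belong to the same edge.\<close>

lemma cdist_triangle:
  assumes p: "p \<in> pts" and q: "q \<in> pts" and r: "r \<in> pts"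
  shows "cdist p r \<le> cdist p q + cdist q r"
proof (rule cdist_cases[OF p q])
  fix u a v b assume 1: "(u, a) \<in> exits G p" "(v, b) \<in> exits G q" "cdist p q = a + real (dst u v) + b"
  show ?thesis
  proof (rule cdist_cases[OF q r])
    fix v' b' w c assume 2: "(v', b') \<in> exits G q" "(w, c) \<in> exits G r" "cdist q r = b' + real (dst v' w) + c"
    have X: "u \<in> carrier G" "v \<in> carrier G" "v' \<in> carrier G" "w \<in> carrier G"
      using exits_props[OF p 1(1)] exits_props[OF q 1(2)] exits_props[OF q 2(1)] exits_props[OF r 2(2)] by auto
    have "real (dst v v') \<le> b + b'" by (rule exits_two[OF q 1(2) 2(1)])
    moreover have "dst u w \<le> dst u v + dst v v' + dst v' w" using d_tri[OF X(1,2,4)] d_tri[OF X(2,3,4)] by linarith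
    ultimately show ?thesis using cdist_le_exit[OF p r 1(1) 2(2)] 1(3) 2(3) by linarith
  next
    fix g s t t' assume 2: "q = EdgePt g s t" "r = EdgePt g s t'" "cdist q r = \<bar>t - t'\<bar>"
    obtain b' where "(v, b') \<in> exits G r" "b' \<le> b + \<bar>t - t'\<bar>"
      using exits_shift[of v b g s t t'] 1(2) 2(1,2) by auto
    then show ?thesis using cdist_le_exit[OF p r 1(1)] 1(3) 2(3) by fastforce
  qed
next
  fix g s t t' assume 1: "p = EdgePt g s t" "q = EdgePt g s t'" "cdist p q = \<bar>t - t'\<bar>"
  show ?thesis
  proof (rule cdist_cases[OF q r])
    fix v b w c assume 2: "(v, b) \<in> exits G q" "(w, c) \<in> exits G r" "cdist q r = b + real (dst v w) + c"
    obtain b' where "(v, b') \<in> exits G p" "b' \<le> b + \<bar>t' - t\<bar>"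
      using exits_shift[of v b g s t' t] 2(1) 1(1,2) by auto
    then show ?thesis using cdist_le_exit[OF p r _ 2(2)] 1(3) 2(3) by fastforce
  next
    fix g' s' t1 t2 assume 2: "q = EdgePt g' s' t1" "r = EdgePt g' s' t2" "cdist q r = \<bar>t1 - t2\<bar>"
    then show ?thesis using 1 cdist_le_edge[of g s t t2] p r by auto
  qed
qed

sublocale cayley: Metric_space pts cdist
  by unfold_locales (use cdist_nonneg cdist_commute cdist_zero cdist_triangle in auto)

lemma cdist_vertices: "g \<in> carrier G \<Longrightarrow> h \<in> carrier G \<Longrightarrow> cdist (Vertex g) (Vertex h) = real (dst g h)"
  by (auto simp: cayley_dist_def Vertex_in_iff)

lemma edge_point_in: "g \<in> carrier G \<Longrightarrow> s \<in> S \<Longrightarrow> edge_point g s t \<in> pts"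
  using S_carrier by (auto simp: edge_point_def Vertex_in_iff EdgePt_in_iff)

lemma edge_point_lipschitz:
  assumes g: "g \<in> carrier G" and s: "s \<in> S" and t: "0 \<le> a" "a \<le> b" "b \<le> 1"
  shows "cdist (edge_point g s a) (edge_point g s b) \<le> b - a"
proof -
  have sc: "s \<in> carrier G" using s S_carrier by auto
  note P = edge_point_in[OF g s, of a] edge_point_in[OF g s, of b]
  have gs: "real (dst g (g \<otimes> s)) \<le> 1" using dst_generator[OF g s] by simp
  consider "b \<le> 0" | "a \<ge> 1" | "a \<le> 0" "1 \<le> b" | "a \<le> 0" "0 < b" "b < 1" | "0 < a" "a < 1" "1 \<le> b"
    | "0 < a" "a < 1" "0 < b" "b < 1" using t by linarith
  then show ?thesis
  proof cases
    case 1
    then have "a = b" using t by auto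
    then show ?thesis using cdist_zero[OF P] by simp
  next
    case 2
    then have "a = b" using t by auto
    then show ?thesis using cdist_zero[OF P] by simp
  next
    case 3
    then show ?thesis using gs g sc t by (simp add: edge_point_def cdist_vertices)
  next
    case 4
    then show ?thesis using cdist_le_exit[OF P, of g 0 g b] t g by (simp add: edge_point_def d_self)
  next
    case 5
    then show ?thesis using cdist_le_exit[OF P, of "g \<otimes> s" "1 - a" "g \<otimes> s" 0] t g sc by (simp add: edge_point_def d_self)
  next
    case 6
    then show ?thesis using cdist_le_edge[of g s a b] P t by (auto simp: edge_point_def)
  qed
qed

lemma edge_path:
  assumes "g \<in> carrier G" "s \<in> S" "0 \<le> a" "a \<le> b" "b \<le> 1"
  shows "\<exists>\<gamma>. lipschitz_path pts cdist (edge_point g s a) (edge_point g s b) (b - a) \<gamma>"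
proof -
  have "cdist (edge_point g s (t + a)) (edge_point g s (u + a)) \<le> u - t" if "0 \<le> t" "t \<le> u" "u \<le> b - a" for t u
    using edge_point_lipschitz[OF assms(1,2), of "t + a" "u + a"] that assms by simp
  then show ?thesis
    using assms edge_point_in[OF assms(1,2)] unfolding lipschitz_path_def
    by (intro exI[of _ "\<lambda>t. edge_point g s (t + a)"]) auto
qed

lemma exit_path:
  assumes "p \<in> pts" "(u, a) \<in> exits G p"
  shows "\<exists>\<gamma>. lipschitz_path pts cdist p (Vertex u) a \<gamma>"
proof (cases p)
  case (Vertex g)
  then have "lipschitz_path pts cdist p (Vertex u) a (\<lambda>_. p)" using assms by (auto simp: lipschitz_path_def)
  then show ?thesis by blast
next
  case (EdgePt g s t)
  then have g: "g \<in> carrier G" "s \<in> S" "0 < t" "t < 1" using assms by (auto simp: EdgePt_in_iff)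
  have e: "edge_point g s 0 = Vertex g" "edge_point g s t = p" "edge_point g s 1 = Vertex (g \<otimes> s)"
    using g EdgePt by (auto simp: edge_point_def)
  consider "u = g" "a = t" | "u = g \<otimes> s" "a = 1 - t" using assms EdgePt by auto
  then show ?thesis
  proof cases
    case 1
    obtain \<gamma> where "lipschitz_path pts cdist (Vertex g) p (t - 0) \<gamma>"
      using edge_path[OF g(1,2), of 0 t] g e by auto
    from cayley.lipschitz_path_reverse[OF this] show ?thesis using 1 by auto
  next
    case 2
    then show ?thesis using edge_path[OF g(1,2), of t 1] g e by auto
  qed
qed

lemma letter_path:
  assumes g: "g \<in> carrier G" and a: "a \<in> A"
  shows "\<exists>\<gamma>. lipschitz_path pts cdist (Vertex g) (Vertex (g \<otimes> a)) 1 \<gamma>"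
proof -
  have edge: "\<exists>\<gamma>. lipschitz_path pts cdist (Vertex h) (Vertex (h \<otimes> s)) 1 \<gamma>" if "h \<in> carrier G" "s \<in> S" for h s
    using edge_path[OF that, of 0 1] by (simp add: edge_point_def)
  show ?thesis
  proof (cases "a \<in> S")
    case True
    then show ?thesis using edge g by blast
  next
    case False
    then obtain s where s: "s \<in> S" "a = inv s" using a by auto
    have sc: "s \<in> carrier G" using s S_carrier by auto
    have "g \<otimes> inv s \<otimes> s = g" using g sc by (simp add: m_assoc)
    then obtain \<gamma> where "lipschitz_path pts cdist (Vertex (g \<otimes> a)) (Vertex g) 1 \<gamma>"
      using edge[of "g \<otimes> inv s" s] g s sc by auto
    then show ?thesis using cayley.lipschitz_path_reverse by blast
  qed
qed

lemma vertex_path: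
  assumes "g \<in> carrier G" "set w \<subseteq> A"
  shows "\<exists>\<gamma>. lipschitz_path pts cdist (Vertex g) (Vertex (g \<otimes> ev w)) (real (length w)) \<gamma>"
  using assms
proof (induction w arbitrary: g)
  case Nil
  then have "lipschitz_path pts cdist (Vertex g) (Vertex (g \<otimes> ev [])) 0 (\<lambda>_. Vertex g)"
    by (auto simp: lipschitz_path_def Vertex_in_iff)
  then show ?case by auto
next
  case (Cons a w)
  have a: "a \<in> A" "a \<in> carrier G" "set w \<subseteq> A" "ev w \<in> carrier G"
    using Cons.prems letters_carrier ev_closed[of w] by auto
  have "\<exists>\<gamma>. lipschitz_path pts cdist (Vertex g) (Vertex (g \<otimes> a \<otimes> ev w)) (1 + real (length w)) \<gamma>"
    using cayley.lipschitz_path_ex_join[OF letter_path[OF Cons.prems(1) a(1)]] Cons.IH[of "g \<otimes> a"] Cons.prems a by auto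
  then show ?case using a Cons.prems by (simp add: m_assoc)
qed

text \<open>Each formula in the minimum is the length of an actual path made of parts of edges and a
  geodesic word. The one attaining the minimum has the distance as its length and is therefore a
  geodesic.\<close>

lemma cayley_geodesic: "geodesic_space pts cdist"
  unfolding geodesic_space_def
proof (intro conjI ballI cayley.Metric_space_axioms)
  fix p q assume pq: "p \<in> pts" "q \<in> pts"
  have "\<exists>\<gamma>. lipschitz_path pts cdist p q (cdist p q) \<gamma>"
  proof (rule cdist_cases[OF pq])
    fix u a v b assume e: "(u, a) \<in> exits G p" "(v, b) \<in> exits G q" "cdist p q = a + real (dst u v) + b"
    have uv: "u \<in> carrier G" "v \<in> carrier G" using exits_props[OF pq(1) e(1)] exits_props[OF pq(2) e(2)] by auto
    obtain w where w: "set w \<subseteq> A" "ev w = inv u \<otimes> v" "length w = dst u v"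
      using ex_geodesic_word[of "inv u \<otimes> v"] uv by (auto simp: word_dist_def)
    have "u \<otimes> ev w = v" using w uv by (simp add: m_assoc[symmetric])
    then have "\<exists>\<gamma>. lipschitz_path pts cdist (Vertex u) (Vertex v) (real (dst u v)) \<gamma>"
      using vertex_path[OF uv(1) w(1)] w by simp
    moreover have "\<exists>\<gamma>. lipschitz_path pts cdist (Vertex v) q b \<gamma>"
      using exit_path[OF pq(2) e(2)] cayley.lipschitz_path_reverse by blast
    ultimately show ?thesis
      unfolding e(3)
      using cayley.lipschitz_path_ex_join[OF cayley.lipschitz_path_ex_join[OF exit_path[OF pq(1) e(1)]]] by blast
  next
    fix g s t t' assume e: "p = EdgePt g s t" "q = EdgePt g s t'" "cdist p q = \<bar>t - t'\<bar>"
    then have g: "g \<in> carrier G" "s \<in> S" "0 < t" "t < 1" "0 < t'" "t' < 1" using pq by (auto simp: EdgePt_in_iff)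
    then have ep: "edge_point g s t = p" "edge_point g s t' = q" using e by (auto simp: edge_point_def)
    show ?thesis
    proof (cases "t \<le> t'")
      case True
      then show ?thesis using edge_path[OF g(1,2), of t t'] g ep e(3) by auto
    next
      case False
      then obtain \<gamma> where "lipschitz_path pts cdist q p (t - t') \<gamma>"
        using edge_path[OF g(1,2), of t' t] g ep by auto
      from cayley.lipschitz_path_reverse[OF this] show ?thesis using e(3) False by auto
    qed
  qed
  then show "\<exists>A. geodesic_segment pts cdist p q A" using cayley.lipschitz_path_segment by blast
qed

lemma near_vertex:
  assumes "p \<in> pts"
  shows "\<exists>u\<in>carrier G. cdist p (Vertex u) \<le> 1"
proof -
  obtain u a where e: "(u, a) \<in> exits G p" using ex_exit by blast
  then have u: "u \<in> carrier G" "a \<le> 1" using exits_props[OF assms] by auto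
  have "cdist p (Vertex u) \<le> a + real (dst u u) + 0"
    by (rule cdist_le_exit[OF assms vertex_in[OF u(1)] e]) simp
  then have "cdist p (Vertex u) \<le> 1" using u by (simp add: d_self)
  then show ?thesis using u(1) by blast
qed

text \<open>Moving each of the four points to a vertex within distance 1 changes every distance by
  at most 2, and each of the compared sums by at most 4, hence the summand 4. The factor 4 is the
  price of passing to slim triangles.\<close>

lemma four_point_hyperbolic_group:
  assumes fp: "\<And>x y z w. x \<in> carrier G \<Longrightarrow> y \<in> carrier G \<Longrightarrow> z \<in> carrier G \<Longrightarrow> w \<in> carrier G \<Longrightarrow>
    dst x y + dst z w \<le> dst x z + dst y w + 2 * C \<or> dst x y + dst z w \<le> dst x w + dst y z + 2 * C"
  shows "hyperbolic_group_with G S (4 * (real C + 4))"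
proof -
  have "four_point pts cdist (real C + 4)"
    unfolding four_point_def
  proof (intro ballI)
    fix x y z w assume X: "x \<in> pts" "y \<in> pts" "z \<in> pts" "w \<in> pts"
    obtain f where f: "\<And>p. p \<in> pts \<Longrightarrow> f p \<in> carrier G \<and> cdist p (Vertex (f p)) \<le> 1"
      using near_vertex by metis
    have comp: "\<bar>cdist p q - real (dst (f p) (f q))\<bar> \<le> 2" if "p \<in> pts" "q \<in> pts" for p q
    proof -
      have V: "Vertex (f p) \<in> pts" "Vertex (f q) \<in> pts" using f that vertex_in by auto
      have "cdist (Vertex (f p)) (Vertex (f q)) = real (dst (f p) (f q))" using f that by (intro cdist_vertices) auto
      moreover have "cdist p q \<le> cdist p (Vertex (f p)) + cdist (Vertex (f p)) (Vertex (f q)) + cdist q (Vertex (f q))"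
        using cdist_triangle[OF that(1) V(1) that(2)] cdist_triangle[OF V that(2)] cdist_commute[of q] by simp
      moreover have "cdist (Vertex (f p)) (Vertex (f q)) \<le> cdist p (Vertex (f p)) + cdist p q + cdist q (Vertex (f q))"
        using cdist_triangle[OF V(1) that(1) V(2)] cdist_triangle[OF that V(2)] cdist_commute[of p] by simp
      ultimately show ?thesis using f[OF that(1)] f[OF that(2)] by linarith
    qed
    have "real (dst (f x) (f y) + dst (f z) (f w)) \<le> real (dst (f x) (f z) + dst (f y) (f w) + 2 * C) \<or>
      real (dst (f x) (f y) + dst (f z) (f w)) \<le> real (dst (f x) (f w) + dst (f y) (f z) + 2 * C)"
      using fp[of "f x" "f y" "f z" "f w"] f X unfolding of_nat_le_iff by blast
    then show "cdist x y + cdist z w \<le> max (cdist x z + cdist y w) (cdist x w + cdist y z) + 2 * (real C + 4)"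
      using comp[OF X(1,2)] comp[OF X(3,4)] comp[OF X(1,3)] comp[OF X(2,4)] comp[OF X(1,4)] comp[OF X(2,3)]
      by (auto simp: max_def abs_le_iff)
  qed
  from cayley.four_point_imp_slim[OF cayley_geodesic this] show ?thesis
    unfolding hyperbolic_group_with_def using is_group generating by blast
qed

lemma hyperbolic_group_four_point:
  assumes "hyperbolic_group_with G S \<delta>" "x \<in> carrier G" "y \<in> carrier G" "z \<in> carrier G" "w \<in> carrier G"
  shows "real (dst x y) + real (dst z w) \<le>
    max (real (dst x z) + real (dst y w)) (real (dst x w) + real (dst y z)) + 2 * (3 * \<delta>)"
proof -
  have "four_point pts cdist (3 * \<delta>)"
    using assms cayley.slim_imp_four_point by (simp add: hyperbolic_group_with_def)
  from four_pointD[OF this vertex_in[OF assms(2)] vertex_in[OF assms(3)] vertex_in[OF assms(4)] vertex_in[OF assms(5)]]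
  show ?thesis using assms by (simp add: cdist_vertices)
qed

end

section \<open>Ultrafilters\<close>

text \<open>Finer filters are smaller in the order of filters, so ultrafilters are the minimal
  proper ones and Zorn's lemma is used with the order reversed. A chain has a proper infimum because
  its members form a base of it. Lying below \<open>sequentially\<close> excludes principal
  filters.\<close>

lemma ex_nonprincipal_ultrafilter: "\<exists>\<omega>. nonprincipal_ultrafilter \<omega>"
proof -
  define \<A> :: "nat filter set" where "\<A> = {F. F \<noteq> bot \<and> F \<le> sequentially}"
  define P :: "nat filter \<Rightarrow> nat filter \<Rightarrow> bool" where "P F F' \<longleftrightarrow> F' \<le> F" for F F'
  have "\<exists>m\<in>\<A>. \<forall>a\<in>\<A>. P m a \<longrightarrow> a = m"
  proof (rule predicate_Zorn)
    show "partial_order_on \<A> (relation_of P \<A>)"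
      by (rule partial_order_on_relation_ofI) (auto simp: P_def)
    fix C assume "C \<in> Chains (relation_of P \<A>)"
    then have C: "C \<subseteq> \<A>" "\<And>F F'. F \<in> C \<Longrightarrow> F' \<in> C \<Longrightarrow> F \<le> F' \<or> F' \<le> F"
      by (auto simp: Chains_def relation_of_def P_def)
    show "\<exists>u\<in>\<A>. \<forall>a\<in>C. P a u"
    proof (cases "C = {}")
      case True
      then show ?thesis by (intro bexI[of _ sequentially]) (auto simp: \<A>_def)
    next
      case False
      have "eventually Q (Inf C) \<longleftrightarrow> (\<exists>b\<in>C. eventually Q b)" for Q
      proof (rule eventually_Inf_base[OF False])
        fix F F' assume "F \<in> C" "F' \<in> C"
        then show "\<exists>x\<in>C. x \<le> inf F F'" using C(2)[of F F'] by (auto intro: bexI[of _ F] bexI[of _ F'])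
      qed
      from this[of "\<lambda>_. False"] have "Inf C \<noteq> bot"
        using C(1) by (auto simp: \<A>_def trivial_limit_def)
      moreover obtain F where "F \<in> C" using False by auto
      then have "Inf C \<le> sequentially" using C(1) by (auto simp: \<A>_def intro: Inf_lower2)
      ultimately show ?thesis by (auto simp: \<A>_def P_def intro!: bexI[of _ "Inf C"] Inf_lower)
    qed
  qed
  then obtain \<omega> where \<omega>: "\<omega> \<noteq> bot" "\<omega> \<le> sequentially" "\<And>F. F \<noteq> bot \<Longrightarrow> F \<le> \<omega> \<Longrightarrow> F = \<omega>"
    by (auto simp: \<A>_def P_def intro: order_trans)
  have "eventually Q \<omega> \<or> eventually (\<lambda>n. \<not> Q n) \<omega>" for Q
  proof (cases "inf \<omega> (principal {n. Q n}) = bot")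
    case True
    then have "eventually (\<lambda>_. False) (inf \<omega> (principal {n. Q n}))" by simp
    then show ?thesis unfolding eventually_inf_principal by simp
  next
    case False
    then have "inf \<omega> (principal {n. Q n}) = \<omega>" using \<omega>(3) by simp
    then have "\<omega> \<le> principal {n. Q n}" by (metis inf.cobounded2)
    then show ?thesis by (simp add: le_principal)
  qed
  moreover have "\<omega> \<noteq> principal {n}" for n
  proof
    assume eq: "\<omega> = principal {n}"
    have "eventually (\<lambda>k. Suc n \<le> k) \<omega>" using \<omega>(2) eventually_ge_at_top filter_leD by blast
    then show False unfolding eq eventually_principal by auto
  qed
  ultimately show ?thesis using \<omega>(1) by (auto simp: nonprincipal_ultrafilter_def)
qed

text \<open>An ultrafilter that contains a singleton is principal, so here the complement of every
  point is a member, and with finitely many of them every tail.\<close>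

lemma nonprincipal_ultrafilter_le_sequentially:
  assumes "nonprincipal_ultrafilter \<omega>"
  shows "\<omega> \<le> sequentially"
proof -
  have ultra: "eventually Q \<omega> \<or> eventually (\<lambda>n. \<not> Q n) \<omega>" for Q
    using assms by (auto simp: nonprincipal_ultrafilter_def)
  have ne: "eventually (\<lambda>k. k \<noteq> n) \<omega>" for n
  proof (rule ccontr)
    assume "\<not> eventually (\<lambda>k. k \<noteq> n) \<omega>"
    then have n: "eventually (\<lambda>k. k = n) \<omega>" using ultra[of "\<lambda>k. k \<noteq> n"] by simp
    have "eventually Q \<omega> \<longleftrightarrow> Q n" for Q
    proof
      assume "eventually Q \<omega>"
      then have "eventually (\<lambda>k. Q n) \<omega>" using n by (rule eventually_elim2) simp
      then show "Q n" using assms by (simp add: eventually_const nonprincipal_ultrafilter_def)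
    next
      assume "Q n"
      then show "eventually Q \<omega>" using n by (auto elim: eventually_mono)
    qed
    then have "\<omega> = principal {n}" by (simp add: filter_eq_iff eventually_principal)
    then show False using assms by (simp add: nonprincipal_ultrafilter_def)
  qed
  have "eventually (\<lambda>k. N \<le> k) \<omega>" for N
  proof -
    have "eventually (\<lambda>k. \<forall>n\<in>{..<N}. k \<noteq> n) \<omega>" by (rule eventually_ball_finite) (use ne in auto)
    then show ?thesis by (rule eventually_mono) (auto simp: not_less[symmetric])
  qed
  note ge = this
  show ?thesis
  proof (rule filter_leI)
    fix P :: "nat \<Rightarrow> bool" assume "eventually P sequentially"
    then obtain N where "\<And>n. N \<le> n \<Longrightarrow> P n" by (auto simp: eventually_sequentially)
    then show "eventually P \<omega>" by (rule eventually_mono[OF ge[of N]])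
  qed
qed

text \<open>Compactness gives a cluster point, and along an ultrafilter a cluster point is a
  limit.\<close>

lemma ultrafilter_bounded_tendsto:
  fixes f :: "nat \<Rightarrow> real"
  assumes \<omega>: "nonprincipal_ultrafilter \<omega>" and f: "\<And>n. f n \<in> {a..b}"
  shows "\<exists>l. (f \<longlongrightarrow> l) \<omega>"
proof -
  have "filtermap f \<omega> \<noteq> bot" using \<omega> by (simp add: nonprincipal_ultrafilter_def filtermap_bot_iff)
  moreover have "eventually (\<lambda>x. x \<in> {a..b}) (filtermap f \<omega>)" using f by (simp add: eventually_filtermap)
  ultimately obtain l where l: "inf (nhds l) (filtermap f \<omega>) \<noteq> bot"
    using compact_Icc[of a b] unfolding compact_filter by blast
  have "(f \<longlongrightarrow> l) \<omega>"
  proof (rule topological_tendstoI)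
    fix U assume U: "open U" "l \<in> U"
    show "eventually (\<lambda>n. f n \<in> U) \<omega>"
    proof (rule ccontr)
      assume "\<not> eventually (\<lambda>n. f n \<in> U) \<omega>"
      then have "eventually (\<lambda>n. f n \<notin> U) \<omega>" using \<omega> unfolding nonprincipal_ultrafilter_def by blast
      then have "eventually (\<lambda>x. x \<notin> U) (filtermap f \<omega>)" by (simp add: eventually_filtermap)
      moreover have "eventually (\<lambda>x. x \<in> U) (nhds l)" using U by (rule eventually_nhds_in_open)
      ultimately have "eventually (\<lambda>_. False) (inf (nhds l) (filtermap f \<omega>))"
        unfolding eventually_inf by blast
      then show False using l by (simp add: trivial_limit_def[symmetric] eventually_False)
    qed
  qed
  then show ?thesis ..
qed

section \<open>Asymptotic cones\<close>

locale asymptotic_cone = word_group +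
  fixes \<omega> :: "nat filter" and d :: "nat \<Rightarrow> real"
  assumes ultra: "nonprincipal_ultrafilter \<omega>" and scaling: "scaling_sequence d"
begin

abbreviation "CS \<equiv> cone_sequences G S d"
abbreviation "CP \<equiv> cone_points G S \<omega> d"
abbreviation "CD \<equiv> cone_dist G S \<omega> d"

definition scaled :: "(nat \<Rightarrow> 'a) \<Rightarrow> (nat \<Rightarrow> 'a) \<Rightarrow> nat \<Rightarrow> real" where
  "scaled g h n = real (dst (g n) (h n)) / d n"

definition limit_dist :: "(nat \<Rightarrow> 'a) \<Rightarrow> (nat \<Rightarrow> 'a) \<Rightarrow> real" where
  "limit_dist g h = Lim \<omega> (scaled g h)"

definition cone_class :: "(nat \<Rightarrow> 'a) \<Rightarrow> (nat \<Rightarrow> 'a) set" where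
  "cone_class g = cone_rel G S \<omega> d `` {g}"

lemma d_pos: "0 < d n"
  using scaling by (simp add: scaling_sequence_def)

lemma nontrivial: "\<omega> \<noteq> bot"
  using ultra by (simp add: nonprincipal_ultrafilter_def)

lemma d_at_top: "filterlim d at_top \<omega>"
proof -
  have "filterlim d at_top sequentially"
    unfolding filterlim_at_top
  proof
    fix Z
    have "mono d" "\<not> bdd_above (range d)" using scaling by (auto simp: scaling_sequence_def)
    then obtain N where "Z < d N" unfolding bdd_above_def by (auto simp: not_le)
    then have "\<And>n. N \<le> n \<Longrightarrow> Z \<le> d n" using \<open>mono d\<close> by (meson less_imp_le monoD order_trans)
    then show "eventually (\<lambda>n. Z \<le> d n) sequentially" by (auto simp: eventually_sequentially)
  qed
  then show ?thesis
    by (rule filterlim_mono[OF _ order_refl nonprincipal_ultrafilter_le_sequentially[OF ultra]])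
qed

lemma inverse_d_tendsto: "((\<lambda>n. c / d n) \<longlongrightarrow> 0) \<omega>"
  using tendsto_divide_0[OF tendsto_const filterlim_at_top_imp_at_infinity[OF d_at_top]] .

lemma CS_closed: "g \<in> CS \<Longrightarrow> g n \<in> carrier G"
  by (simp add: cone_sequences_def)

lemma CS_bound: "g \<in> CS \<Longrightarrow> \<exists>C. \<forall>n. real (len (g n)) \<le> C * d n"
proof -
  assume g: "g \<in> CS"
  then obtain C where "\<And>n. real (dst \<one> (g n)) / d n \<le> C" by (auto simp: cone_sequences_def)
  then have "\<And>n. real (dst \<one> (g n)) \<le> C * d n" using d_pos by (simp add: pos_divide_le_eq)
  then show ?thesis using CS_closed[OF g] by (auto simp: dst_one)
qed

lemma CS_I:
  assumes "\<And>n. g n \<in> carrier G" "\<And>n. real (len (g n)) \<le> C * d n"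
  shows "g \<in> CS"
  unfolding cone_sequences_def using assms d_pos by (auto simp: dst_one pos_divide_le_eq intro!: exI[of _ C])

lemma scaled_tendsto:
  assumes "g \<in> CS" "h \<in> CS"
  shows "(scaled g h \<longlongrightarrow> limit_dist g h) \<omega>"
proof -
  obtain B C where B: "\<And>n. real (len (g n)) \<le> B * d n" and C: "\<And>n. real (len (h n)) \<le> C * d n"
    using CS_bound assms by metis
  have "scaled g h n \<in> {0..B + C}" for n
  proof -
    have X: "g n \<in> carrier G" "h n \<in> carrier G" using CS_closed assms by auto
    have "dst (g n) (h n) \<le> len (g n) + len (h n)"
      using d_tri[OF X(1) one_closed X(2)] d_sym[OF X(1) one_closed] X by (simp add: dst_one)
    then have "real (dst (g n) (h n)) \<le> (B + C) * d n" using B[of n] C[of n] by (simp add: algebra_simps)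
    then show ?thesis using d_pos[of n] by (simp add: scaled_def pos_divide_le_eq)
  qed
  then obtain l where "(scaled g h \<longlongrightarrow> l) \<omega>"
    using ultrafilter_bounded_tendsto[OF ultra, of "scaled g h"] by blast
  moreover from this have "limit_dist g h = l"
    unfolding limit_dist_def by (rule tendsto_Lim[OF nontrivial])
  ultimately show ?thesis by simp
qed

lemma limit_dist_eq: "(scaled g h \<longlongrightarrow> r) \<omega> \<Longrightarrow> limit_dist g h = r"
  using tendsto_Lim[OF nontrivial] by (simp add: limit_dist_def)

lemma limit_dist_nonneg: "g \<in> CS \<Longrightarrow> h \<in> CS \<Longrightarrow> 0 \<le> limit_dist g h"
  by (rule tendsto_lowerbound[OF scaled_tendsto _ nontrivial])
    (auto simp: scaled_def d_pos less_imp_le intro!: always_eventually)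

lemma limit_dist_sym: "g \<in> CS \<Longrightarrow> h \<in> CS \<Longrightarrow> limit_dist g h = limit_dist h g"
proof -
  assume "g \<in> CS" "h \<in> CS"
  then have "scaled g h = scaled h g" using d_sym CS_closed by (auto simp: scaled_def fun_eq_iff)
  then show ?thesis by (simp add: limit_dist_def)
qed

lemma limit_dist_self: "g \<in> CS \<Longrightarrow> limit_dist g g = 0"
proof -
  assume "g \<in> CS"
  then have "scaled g g = (\<lambda>_. 0)" using d_self CS_closed by (auto simp: scaled_def fun_eq_iff)
  then show ?thesis by (intro limit_dist_eq) simp
qed

lemma limit_dist_triangle:
  assumes "f \<in> CS" "g \<in> CS" "h \<in> CS"
  shows "limit_dist f h \<le> limit_dist f g + limit_dist g h"
proof (rule tendsto_le[OF nontrivial tendsto_add[OF scaled_tendsto scaled_tendsto] scaled_tendsto])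
  have "scaled f h n \<le> scaled f g n + scaled g h n" for n
    using d_tri[of "f n" "g n" "h n"] CS_closed assms d_pos[of n]
    by (simp add: scaled_def add_divide_distrib[symmetric] divide_right_mono less_imp_le)
  then show "\<forall>\<^sub>F n in \<omega>. scaled f h n \<le> scaled f g n + scaled g h n" by simp
qed (use assms in auto)

lemma cone_rel_iff: "(g, h) \<in> cone_rel G S \<omega> d \<longleftrightarrow> g \<in> CS \<and> h \<in> CS \<and> limit_dist g h = 0"
  using scaled_tendsto[of g h] limit_dist_eq[of g h] by (auto simp: cone_rel_def scaled_def[abs_def])

lemma cone_class_iff: "h \<in> cone_class g \<longleftrightarrow> g \<in> CS \<and> h \<in> CS \<and> limit_dist g h = 0"
  by (simp add: cone_class_def cone_rel_iff)

lemma CP_eq: "CP = cone_class ` CS"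
  by (auto simp: cone_points_def quotient_def cone_class_def)

lemma limit_dist_cong:
  assumes "g' \<in> cone_class g" "h' \<in> cone_class h"
  shows "limit_dist g' h' = limit_dist g h"
proof -
  have X: "g \<in> CS" "g' \<in> CS" "h \<in> CS" "h' \<in> CS" and z: "limit_dist g g' = 0" "limit_dist h h' = 0"
    using assms by (auto simp: cone_class_iff)
  show ?thesis
    using limit_dist_triangle[OF X(2,1,4)] limit_dist_triangle[OF X(1,3,4)]
      limit_dist_triangle[OF X(1,2,3)] limit_dist_triangle[OF X(2,4,3)]
      limit_dist_sym[OF X(1,2)] limit_dist_sym[OF X(3,4)] z by linarith
qed

lemma cone_class_self: "g \<in> CS \<Longrightarrow> g \<in> cone_class g"
  by (simp add: cone_class_iff limit_dist_self)

lemma CD_class: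
  assumes "g \<in> CS" "h \<in> CS"
  shows "CD (cone_class g) (cone_class h) = limit_dist g h"
proof -
  have "(THE r. \<forall>g'\<in>cone_class g. \<forall>h'\<in>cone_class h. ((\<lambda>n. real (dst (g' n) (h' n)) / d n) \<longlongrightarrow> r) \<omega>) = limit_dist g h"
  proof (rule the_equality)
    show "\<forall>g'\<in>cone_class g. \<forall>h'\<in>cone_class h. ((\<lambda>n. real (dst (g' n) (h' n)) / d n) \<longlongrightarrow> limit_dist g h) \<omega>"
    proof (intro ballI)
      fix g' h' assume gh: "g' \<in> cone_class g" "h' \<in> cone_class h"
      then have "(scaled g' h' \<longlongrightarrow> limit_dist g' h') \<omega>" by (intro scaled_tendsto) (auto simp: cone_class_iff)
      then show "((\<lambda>n. real (dst (g' n) (h' n)) / d n) \<longlongrightarrow> limit_dist g h) \<omega>"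
        unfolding limit_dist_cong[OF gh] scaled_def[abs_def] .
    qed
    fix r assume "\<forall>g'\<in>cone_class g. \<forall>h'\<in>cone_class h. ((\<lambda>n. real (dst (g' n) (h' n)) / d n) \<longlongrightarrow> r) \<omega>"
    then have "(scaled g h \<longlongrightarrow> r) \<omega>"
      using cone_class_self assms unfolding scaled_def[abs_def] by blast
    then show "r = limit_dist g h" using limit_dist_eq by simp
  qed
  moreover have "cone_class g \<in> CP" "cone_class h \<in> CP" using assms by (auto simp: CP_eq)
  ultimately show ?thesis by (simp add: cone_dist_def)
qed

lemma cone_class_eq_iff: "g \<in> CS \<Longrightarrow> h \<in> CS \<Longrightarrow> cone_class g = cone_class h \<longleftrightarrow> limit_dist g h = 0"
proof
  assume gh: "g \<in> CS" "h \<in> CS"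
  show "limit_dist g h = 0" if "cone_class g = cone_class h"
    using cone_class_self[OF gh(2)] that by (auto simp: cone_class_iff)
  assume z: "limit_dist g h = 0"
  show "cone_class g = cone_class h"
  proof (intro equalityI subsetI)
    fix f assume "f \<in> cone_class g"
    then show "f \<in> cone_class h"
      using limit_dist_cong[of f g h h] cone_class_self[OF gh(2)] gh z limit_dist_sym[of f h]
      by (auto simp: cone_class_iff)
  next
    fix f assume "f \<in> cone_class h"
    then show "f \<in> cone_class g"
      using limit_dist_cong[of g g f h] cone_class_self[OF gh(1)] gh z by (auto simp: cone_class_iff)
  qed
qed

sublocale cone: Metric_space CP CD
proof
  show "0 \<le> CD A B" for A B
  proof (cases "A \<in> CP \<and> B \<in> CP")
    case True
    then show ?thesis by (auto simp: CP_eq CD_class limit_dist_nonneg)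
  qed (auto simp: cone_dist_def)
  show "CD A B = CD B A" for A B
  proof (cases "A \<in> CP \<and> B \<in> CP")
    case True
    then show ?thesis by (auto simp: CP_eq CD_class limit_dist_sym)
  qed (auto simp: cone_dist_def)
  show "CD A B = 0 \<longleftrightarrow> A = B" if "A \<in> CP" "B \<in> CP" for A B
  proof -
    obtain g h where "g \<in> CS" "h \<in> CS" "A = cone_class g" "B = cone_class h"
      using \<open>A \<in> CP\<close> \<open>B \<in> CP\<close> by (auto simp: CP_eq)
    then show ?thesis by (simp add: CD_class cone_class_eq_iff)
  qed
  show "CD A C \<le> CD A B + CD B C" if "A \<in> CP" "B \<in> CP" "C \<in> CP" for A B C
    using that by (auto simp: CP_eq CD_class limit_dist_triangle)
qed

lemma limit_dist_le:
  assumes "g \<in> CS" "h \<in> CS" "\<And>n. real (dst (g n) (h n)) \<le> r * d n + c"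
  shows "limit_dist g h \<le> r"
proof -
  have "((\<lambda>n. r + c / d n) \<longlongrightarrow> r + 0) \<omega>" by (intro tendsto_add tendsto_const inverse_d_tendsto)
  moreover have "scaled g h n \<le> r + c / d n" for n
    using assms(3)[of n] d_pos[of n] by (simp add: scaled_def field_simps)
  ultimately show ?thesis
    using tendsto_le[OF nontrivial _ scaled_tendsto[OF assms(1,2)]] by fastforce
qed

text \<open>A geodesic of the cone is the limit of word geodesics from \<open>g n\<close> to
  \<open>h n\<close>, followed up to time \<open>t * d n\<close>.\<close>

lemma cone_geodesic: "geodesic_space CP CD"
  unfolding geodesic_space_def
proof (intro conjI ballI cone.Metric_space_axioms)
  fix P Q assume "P \<in> CP" "Q \<in> CP"
  then obtain g h where gh: "g \<in> CS" "h \<in> CS" "P = cone_class g" "Q = cone_class h" by (auto simp: CP_eq)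
  let ?l = "\<lambda>n. dst (g n) (h n)"
  have "\<exists>p. path p (?l n) \<and> p 0 = g n \<and> p (?l n) = h n" for n
    using word_geodesic CS_closed gh by blast
  then obtain p where p: "\<And>n. path (p n) (?l n)" "\<And>n. p n 0 = g n" "\<And>n. p n (?l n) = h n" by metis
  \<comment> \<open>The length of the \<open>n\<close>th geodesic is \<open>?L * d n\<close> only in
    the limit, so the time is cut off at its end. At \<open>t = ?L\<close> the point reached may
    differ from \<open>h n\<close>, but after scaling the difference tends to 0.\<close>
  define i where "i t n = min (?l n) (nat \<lfloor>t * d n\<rfloor>)" for t n
  define q where "q t n = p n (i t n)" for t n
  have qX: "q t n \<in> carrier G" for t n using path_in[OF p(1)] by (simp add: q_def i_def)
  obtain B C where B: "\<And>n. real (len (g n)) \<le> B * d n" and C: "\<And>n. real (len (h n)) \<le> C * d n"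
    using CS_bound gh by metis
  have qCS: "q t \<in> CS" for t
  proof (rule CS_I[where C = "2 * B + C"])
    show "q t n \<in> carrier G" for n by (rule qX)
    fix n
    have X: "g n \<in> carrier G" "h n \<in> carrier G" using CS_closed gh by auto
    have "dst (g n) (q t n) \<le> ?l n" using path_dist[OF p(1), of 0 "i t n" n] p(2) by (simp add: q_def i_def)
    then have "len (q t n) \<le> 2 * len (g n) + len (h n)"
      using d_tri[OF one_closed X(1) qX[of t n]] d_tri[OF X(1) one_closed X(2)] d_sym[OF X(1) one_closed]
        dst_one[OF X(1)] dst_one[OF X(2)] dst_one[OF qX[of t n]] by linarith
    then have "real (len (q t n)) \<le> 2 * real (len (g n)) + real (len (h n))" by linarith
    then show "real (len (q t n)) \<le> (2 * B + C) * d n" using B[of n] C[of n] by (simp add: algebra_simps)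
  qed
  let ?L = "limit_dist g h"
  have q0: "q 0 = g" using p(2) by (auto simp: q_def i_def fun_eq_iff)
  have qL: "limit_dist (q ?L) h = 0"
  proof -
    have "((\<lambda>n. max 0 (scaled g h n - ?L + 1 / d n)) \<longlongrightarrow> max 0 (?L - ?L + 0)) \<omega>"
      by (intro tendsto_intros scaled_tendsto gh inverse_d_tendsto)
    moreover have "scaled (q ?L) h n \<le> max 0 (scaled g h n - ?L + 1 / d n)" for n
    proof -
      have "dst (q ?L n) (h n) + i ?L n \<le> ?l n"
        using path_dist[OF p(1), of "i ?L n" "?l n" n] p(3) by (simp add: q_def i_def)
      moreover have "?L * d n \<le> real (nat \<lfloor>?L * d n\<rfloor>) + 1" by linarith
      ultimately have "real (dst (q ?L n) (h n)) \<le> max 0 (real (?l n) - ?L * d n + 1)"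
        by (auto simp: i_def min_def max_def split: if_splits)
      then have "scaled (q ?L) h n \<le> max 0 (real (?l n) - ?L * d n + 1) / d n"
        using d_pos[of n] by (simp add: scaled_def divide_right_mono less_imp_le)
      also have "\<dots> = max 0 (scaled g h n - ?L + 1 / d n)"
        using d_pos[of n] by (simp add: scaled_def max_def field_simps)
      finally show ?thesis .
    qed
    ultimately have "limit_dist (q ?L) h \<le> 0"
      using tendsto_le[OF nontrivial _ scaled_tendsto[OF qCS gh(2)]] by fastforce
    then show ?thesis using limit_dist_nonneg[OF qCS gh(2)] by (simp add: antisym)
  qed
  \<comment> \<open>The constant 1 accounts for rounding the times down; it vanishes after division
    by \<open>d n\<close>.\<close>
  have lip: "limit_dist (q s) (q t) \<le> t - s" if st: "0 \<le> s" "s \<le> t" for s t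
  proof (rule limit_dist_le[OF qCS qCS, where c = 1])
    fix n
    have m: "s * d n \<le> t * d n" using st d_pos[of n] by (simp add: mult_right_mono less_imp_le)
    then have fl: "nat \<lfloor>s * d n\<rfloor> \<le> nat \<lfloor>t * d n\<rfloor>" by (intro nat_mono floor_mono)
    then have "dst (q s n) (q t n) + i s n \<le> i t n"
      using path_dist[OF p(1), of "i s n" "i t n" n] by (auto simp: q_def i_def)
    then have "real (dst (q s n) (q t n)) \<le> real (nat \<lfloor>t * d n\<rfloor>) - real (nat \<lfloor>s * d n\<rfloor>)"
      using fl by (auto simp: i_def min_def split: if_splits)
    moreover have "0 \<le> s * d n" using st d_pos[of n] by (simp add: less_imp_le)
    ultimately show "real (dst (q s n) (q t n)) \<le> (t - s) * d n + 1" using m by (simp add: algebra_simps) linarith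
  qed
  have "lipschitz_path CP CD P Q ?L (\<lambda>t. cone_class (q t))"
    unfolding lipschitz_path_def
    using limit_dist_nonneg[OF gh(1,2)] qCS lip q0 qL gh cone_class_eq_iff[OF qCS gh(2)]
    by (auto simp: CD_class CP_eq)
  moreover have "CD P Q = ?L" using gh by (simp add: CD_class)
  ultimately show "\<exists>A. geodesic_segment CP CD P Q A" using cone.lipschitz_path_segment by blast
qed

end

section \<open>Balls satisfying the four-point condition and cones that are trees\<close>

context word_group
begin

definition lacunary_scales :: bool where
  "lacunary_scales \<longleftrightarrow> (\<forall>m L. \<exists>D\<ge>L. hyperbolic_in_ball G S D (m * D))"

lemma lacunary_scales_imp_real_tree:
  assumes "lacunary_scales"
  shows "\<exists>d. scaling_sequence d \<and> (\<forall>\<omega>. nonprincipal_ultrafilter \<omega> \<longrightarrow> cone_is_real_tree G S \<omega> d)"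
proof -
  \<comment> \<open>With \<open>d n = (n + 1) * D n\<close> the constant \<open>D n\<close> is
    \<open>o(d n)\<close>, while the radius \<open>(n + 1)^2 * D n = (n + 1) * d n\<close>
    eventually exceeds every multiple of \<open>d n\<close>. So any four sequences of the cone end
    up in the good balls, whichever ultrafilter is taken.\<close>
  define good where "good n D \<longleftrightarrow> 1 \<le> D \<and> hyperbolic_in_ball G S D ((n + 1)^2 * D)" for n D :: nat
  have ex: "\<exists>D\<ge>L. good n D" for n L
    using assms[unfolded lacunary_scales_def, rule_format, where m = "(n + 1)^2" and L = "max 1 L"]
    by (auto simp: good_def)
  obtain D where D: "\<And>n. good n (D n)" "\<And>n. D n \<le> D (Suc n)"
    using dependent_nat_choice[of good "\<lambda>n D D'. D \<le> D'"] ex by metis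
  define d where "d n = real ((n + 1) * D n)" for n
  have pos: "0 < d n" for n using D(1)[of n] unfolding d_def of_nat_0_less_iff good_def by simp
  have scal: "scaling_sequence d"
    unfolding scaling_sequence_def
  proof (intro conjI allI pos)
    show "mono d"
      unfolding mono_iff_le_Suc d_def of_nat_le_iff by (intro allI mult_le_mono D(2)) simp
    show "\<not> bdd_above (range d)"
    proof
      assume "bdd_above (range d)"
      then obtain M where M: "\<And>n. d n \<le> M" by (auto simp: bdd_above_def)
      obtain n where n: "M < real n" using reals_Archimedean2 by blast
      have "(n + 1) * 1 \<le> (n + 1) * D n" using D(1)[of n] by (intro mult_le_mono) (auto simp: good_def)
      then have "real ((n + 1) * 1) \<le> d n" unfolding d_def of_nat_le_iff .
      then show False using M[of n] n by simp
    qed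
  qed
  have "cone_is_real_tree G S \<omega> d" if \<omega>: "nonprincipal_ultrafilter \<omega>" for \<omega>
  proof -
    interpret asymptotic_cone G S \<omega> d by unfold_locales (use \<omega> scal in auto)
    have "limit_dist x y + limit_dist z w \<le> max (limit_dist x z + limit_dist y w) (limit_dist x w + limit_dist y z)"
      if X: "x \<in> CS" "y \<in> CS" "z \<in> CS" "w \<in> CS" for x y z w
    proof -
      have "eventually (\<lambda>n. real (len (g n)) \<le> real ((n + 1)^2 * D n)) \<omega>" if g: "g \<in> CS" for g
      proof -
        obtain C where C: "\<And>n. real (len (g n)) \<le> C * d n" using CS_bound[OF g] by blast
        obtain N where N: "C < real N" using reals_Archimedean2 by blast
        have "eventually (\<lambda>n. N \<le> n) \<omega>"
          using nonprincipal_ultrafilter_le_sequentially[OF \<omega>] eventually_ge_at_top filter_leD by blast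
        then show ?thesis
        proof (rule eventually_mono)
          fix n assume n: "N \<le> n"
          have "C * d n \<le> real (n + 1) * d n" using N n pos[of n] by (intro mult_right_mono) auto
          also have "\<dots> = real ((n + 1)^2 * D n)"
            unfolding d_def of_nat_mult[symmetric] power2_eq_square mult.assoc ..
          finally show "real (len (g n)) \<le> real ((n + 1)^2 * D n)" using C[of n] by linarith
        qed
      qed
      note ev = this[OF X(1)] this[OF X(2)] this[OF X(3)] this[OF X(4)]
      have ineq: "eventually (\<lambda>n. scaled x y n + scaled z w n \<le>
          max (scaled x z n + scaled y w n) (scaled x w n + scaled y z n) + 2 * inverse (real (Suc n))) \<omega>"
        using ev
      proof eventually_elim
        case (elim n)
        have C: "x n \<in> carrier G" "y n \<in> carrier G" "z n \<in> carrier G" "w n \<in> carrier G" using CS_closed X by auto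
        have "hyperbolic_in_ball G S (D n) ((n + 1)^2 * D n)" using D(1)[of n] by (simp add: good_def)
        from hyperbolic_in_ballD[OF this C] elim
        have "dst (x n) (y n) + dst (z n) (w n) \<le> dst (x n) (z n) + dst (y n) (w n) + 2 * D n \<or>
          dst (x n) (y n) + dst (z n) (w n) \<le> dst (x n) (w n) + dst (y n) (z n) + 2 * D n"
          unfolding of_nat_le_iff by blast
        then have "real (dst (x n) (y n)) + real (dst (z n) (w n)) \<le>
          max (real (dst (x n) (z n)) + real (dst (y n) (w n))) (real (dst (x n) (w n)) + real (dst (y n) (z n))) + 2 * real (D n)"
          by linarith
        then have "(real (dst (x n) (y n)) + real (dst (z n) (w n))) / d n \<le>
          (max (real (dst (x n) (z n)) + real (dst (y n) (w n))) (real (dst (x n) (w n)) + real (dst (y n) (z n)))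
            + 2 * real (D n)) / d n"
          using pos[of n] by (intro divide_right_mono) auto
        moreover have "real (D n) / d n = inverse (real (Suc n))"
        proof -
          have "real (D n) \<noteq> 0" using D(1)[of n] by (simp add: good_def)
          moreover have "d n = real (Suc n) * real (D n)" by (simp only: d_def of_nat_mult Suc_eq_plus1)
          ultimately show ?thesis by (simp add: inverse_eq_divide del: of_nat_Suc)
        qed
        moreover have "max a b / d n = max (a / d n) (b / d n)" for a b
          using pos[of n] by (simp add: max_def divide_le_cancel)
        ultimately show ?case
          unfolding scaled_def by (simp add: add_divide_distrib)
      qed
      have "((\<lambda>n. inverse (real (Suc n))) \<longlongrightarrow> 0) \<omega>"
        using LIMSEQ_inverse_real_of_nat nonprincipal_ultrafilter_le_sequentially[OF \<omega>]
        by (rule tendsto_mono[rotated])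
      then have "((\<lambda>n. max (scaled x z n + scaled y w n) (scaled x w n + scaled y z n) + 2 * inverse (real (Suc n))) \<longlongrightarrow>
          max (limit_dist x z + limit_dist y w) (limit_dist x w + limit_dist y z) + 2 * 0) \<omega>"
        by (intro tendsto_intros scaled_tendsto X)
      from tendsto_le[OF nontrivial this tendsto_add[OF scaled_tendsto[OF X(1,2)] scaled_tendsto[OF X(3,4)]] ineq]
      show ?thesis by simp
    qed
    then have "four_point CP CD 0" by (auto simp: four_point_def CP_eq CD_class)
    then show ?thesis
      unfolding cone_is_real_tree_def by (rule cone.four_point_imp_real_tree[OF cone_geodesic])
  qed
  then show ?thesis using scal by blast
qed

lemma real_tree_imp_lacunary_scales:
  assumes "nonprincipal_ultrafilter \<omega>" "scaling_sequence d" "cone_is_real_tree G S \<omega> d"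
  shows "lacunary_scales"
proof (rule ccontr)
  assume "\<not> lacunary_scales"
  then obtain m L where no: "\<And>D. L \<le> D \<Longrightarrow> \<not> hyperbolic_in_ball G S D (m * D)"
    by (auto simp: lacunary_scales_def)
  interpret asymptotic_cone G S \<omega> d by unfold_locales (use assms in auto)
  \<comment> \<open>At least \<open>L\<close>, so that the condition fails; at least
    \<open>d n\<close>, so that after scaling the failure is by at least 2; and at most a multiple
    of \<open>d n\<close>, so that the bad quadruples define points of the cone.\<close>
  define D where "D n = L + nat \<lceil>d n\<rceil>" for n
  have "\<exists>x y z w. x \<in> carrier G \<and> y \<in> carrier G \<and> z \<in> carrier G \<and> w \<in> carrier G \<and>
     len x \<le> m * D n \<and> len y \<le> m * D n \<and> len z \<le> m * D n \<and> len w \<le> m * D n \<and>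
     dst x z + dst y w + 2 * D n < dst x y + dst z w \<and> dst x w + dst y z + 2 * D n < dst x y + dst z w" for n
    using no[of "D n"] unfolding hyperbolic_in_ball_def D_def not_le by (auto simp: not_le)
  then obtain x y z w where X: "\<And>n. x n \<in> carrier G" "\<And>n. y n \<in> carrier G" "\<And>n. z n \<in> carrier G" "\<And>n. w n \<in> carrier G"
    and le: "\<And>n. len (x n) \<le> m * D n" "\<And>n. len (y n) \<le> m * D n" "\<And>n. len (z n) \<le> m * D n" "\<And>n. len (w n) \<le> m * D n"
    and bad: "\<And>n. dst (x n) (z n) + dst (y n) (w n) + 2 * D n < dst (x n) (y n) + dst (z n) (w n)"
      "\<And>n. dst (x n) (w n) + dst (y n) (z n) + 2 * D n < dst (x n) (y n) + dst (z n) (w n)"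
    by metis
  have dd: "d 0 \<le> d n" for n using assms(2) by (auto simp: scaling_sequence_def mono_def)
  define K where "K = real m * ((real L + 1) / d 0 + 1)"
  have mD: "real (m * D n) \<le> K * d n" for n
  proof -
    have "real (D n) \<le> real L + 1 + d n" using d_pos[of n] by (simp add: D_def) linarith
    also have "\<dots> \<le> ((real L + 1) / d 0) * d n + d n"
    proof -
      have "real L + 1 = ((real L + 1) / d 0) * d 0" using d_pos[of 0] by simp
      also have "\<dots> \<le> ((real L + 1) / d 0) * d n" using dd[of n] d_pos[of 0] by (intro mult_left_mono) auto
      finally show ?thesis by simp
    qed
    finally have "real m * real (D n) \<le> real m * (((real L + 1) / d 0) * d n + d n)" by (intro mult_left_mono) auto
    then show ?thesis by (simp add: K_def algebra_simps)
  qed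
  have "real (len g) \<le> K * d n" if "len g \<le> m * D n" for g n
    using mD[of n] that by linarith
  then have CSs: "x \<in> CS" "y \<in> CS" "z \<in> CS" "w \<in> CS"
    using X le by (auto intro!: CS_I[of _ K])
  have Dd: "d n \<le> real (D n)" for n unfolding D_def by linarith
  have b1: "limit_dist x z + limit_dist y w + 2 \<le> limit_dist x y + limit_dist z w"
  proof (rule tendsto_le[OF nontrivial tendsto_add[OF scaled_tendsto scaled_tendsto]
        tendsto_add[OF tendsto_add[OF scaled_tendsto scaled_tendsto] tendsto_const]])
    have "scaled x z n + scaled y w n + 2 \<le> scaled x y n + scaled z w n" for n
    proof -
      have "real (dst (x n) (z n)) + real (dst (y n) (w n)) + 2 * d n \<le> real (dst (x n) (y n)) + real (dst (z n) (w n))"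
        using bad(1)[of n] Dd[of n] by linarith
      from divide_right_mono[OF this less_imp_le[OF d_pos[of n]]] show ?thesis
        using d_pos[of n] by (simp add: scaled_def add_divide_distrib)
    qed
    then show "\<forall>\<^sub>F n in \<omega>. scaled x z n + scaled y w n + 2 \<le> scaled x y n + scaled z w n" by simp
  qed (use CSs in auto)
  have b2: "limit_dist x w + limit_dist y z + 2 \<le> limit_dist x y + limit_dist z w"
  proof (rule tendsto_le[OF nontrivial tendsto_add[OF scaled_tendsto scaled_tendsto]
        tendsto_add[OF tendsto_add[OF scaled_tendsto scaled_tendsto] tendsto_const]])
    have "scaled x w n + scaled y z n + 2 \<le> scaled x y n + scaled z w n" for n
    proof -
      have "real (dst (x n) (w n)) + real (dst (y n) (z n)) + 2 * d n \<le> real (dst (x n) (y n)) + real (dst (z n) (w n))"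
        using bad(2)[of n] Dd[of n] by linarith
      from divide_right_mono[OF this less_imp_le[OF d_pos[of n]]] show ?thesis
        using d_pos[of n] by (simp add: scaled_def add_divide_distrib)
    qed
    then show "\<forall>\<^sub>F n in \<omega>. scaled x w n + scaled y z n + 2 \<le> scaled x y n + scaled z w n" by simp
  qed (use CSs in auto)
  have "four_point CP CD (3 * 0)"
    using cone.slim_imp_four_point[OF cone.real_tree_imp_slim] assms(3) by (simp add: cone_is_real_tree_def)
  moreover have "cone_class x \<in> CP" "cone_class y \<in> CP" "cone_class z \<in> CP" "cone_class w \<in> CP"
    using CSs by (auto simp: CP_eq)
  ultimately have "limit_dist x y + limit_dist z w \<le>
      max (limit_dist x z + limit_dist y w) (limit_dist x w + limit_dist y z) + 2 * (3 * 0)"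
    using four_pointD[of CP CD "3 * 0" "cone_class x" "cone_class y" "cone_class z" "cone_class w"] CSs
    by (simp add: CD_class)
  then show False using b1 b2 by linarith
qed

lemma length_comparison:
  assumes "finite_generating_set G T"
  shows "\<exists>K. \<forall>g\<in>carrier G. len g \<le> K * word_length G T g"
proof -
  interpret T: word_group G T by unfold_locales (rule assms)
  have fin: "finite (letters G T)" using assms by (simp add: finite_generating_set_def)
  define K where "K = Max (insert 0 (len ` letters G T))"
  have K: "len a \<le> K" if "a \<in> letters G T" for a unfolding K_def using fin that by (intro Max_ge) auto
  have "len (ev w) \<le> K * length w" if "set w \<subseteq> letters G T" for w
    using that
  proof (induction w)
    case (Cons a w)
    then have "len (a \<otimes> ev w) \<le> len a + len (ev w)"
      using T.letters_carrier T.ev_closed[of w] by (intro len_mult) auto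
    then show ?case using Cons K[of a] by auto
  qed (simp add: len_one)
  then show ?thesis using T.ex_geodesic_word by metis
qed

lemma cone_is_real_tree_generators:
  assumes T: "finite_generating_set G T" and \<omega>: "nonprincipal_ultrafilter \<omega>" and d: "scaling_sequence d"
    and tree: "cone_is_real_tree G T \<omega> d"
  shows "cone_is_real_tree G S \<omega> d"
proof -
  interpret T: word_group G T by unfold_locales (rule T)
  interpret C: asymptotic_cone G S \<omega> d by unfold_locales (use \<omega> d in auto)
  interpret CT: asymptotic_cone G T \<omega> d by unfold_locales (use \<omega> d in auto)
  obtain K1 where K1: "\<And>g. g \<in> carrier G \<Longrightarrow> len g \<le> K1 * word_length G T g" using length_comparison[OF T] by blast
  obtain K2 where K2: "\<And>g. g \<in> carrier G \<Longrightarrow> word_length G T g \<le> K2 * len g"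
    using T.length_comparison[OF generating] by blast
  \<comment> \<open>One positive constant for both directions, as required by
    \<open>real_tree_bilipschitz\<close>.\<close>
  define K where "K = real (K1 + K2 + 1)"
  have le: "real (len g) \<le> K * real (word_length G T g)" "real (word_length G T g) \<le> K * real (len g)"
    if "g \<in> carrier G" for g
  proof -
    have "len g \<le> (K1 + K2 + 1) * word_length G T g" using K1[OF that] by (simp add: algebra_simps)
    then show "real (len g) \<le> K * real (word_length G T g)" unfolding K_def of_nat_mult[symmetric] of_nat_le_iff .
    have "word_length G T g \<le> (K1 + K2 + 1) * len g" using K2[OF that] by (simp add: algebra_simps)
    then show "real (word_length G T g) \<le> K * real (len g)" unfolding K_def of_nat_mult[symmetric] of_nat_le_iff .
  qed
  have K: "0 < K" by (simp add: K_def)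
  have CS_eq: "cone_sequences G S d = cone_sequences G T d"
  proof (intro equalityI subsetI)
    fix g assume g: "g \<in> cone_sequences G S d"
    obtain B where B: "\<And>n. real (len (g n)) \<le> B * d n" using C.CS_bound[OF g] by blast
    show "g \<in> cone_sequences G T d"
    proof (rule CT.CS_I[of _ "K * B"])
      fix n
      have "real (word_length G T (g n)) \<le> K * real (len (g n))" using le C.CS_closed[OF g] by blast
      also have "\<dots> \<le> K * (B * d n)" using B[of n] K by (intro mult_left_mono) auto
      finally show "real (word_length G T (g n)) \<le> K * B * d n" by simp
    qed (rule C.CS_closed[OF g])
  next
    fix g assume g: "g \<in> cone_sequences G T d"
    obtain B where B: "\<And>n. real (word_length G T (g n)) \<le> B * d n" using CT.CS_bound[OF g] by blast
    show "g \<in> cone_sequences G S d"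
    proof (rule C.CS_I[of _ "K * B"])
      fix n
      have "real (len (g n)) \<le> K * real (word_length G T (g n))" using le CT.CS_closed[OF g] by blast
      also have "\<dots> \<le> K * (B * d n)" using B[of n] K by (intro mult_left_mono) auto
      finally show "real (len (g n)) \<le> K * B * d n" by simp
    qed (rule CT.CS_closed[OF g])
  qed
  have scaled_le: "C.scaled g h n \<le> K * CT.scaled g h n" "CT.scaled g h n \<le> K * C.scaled g h n"
    if "g \<in> cone_sequences G S d" "h \<in> cone_sequences G S d" for g h n
  proof -
    have c: "inv (g n) \<otimes> h n \<in> carrier G" using C.CS_closed that by simp
    show "C.scaled g h n \<le> K * CT.scaled g h n" "CT.scaled g h n \<le> K * C.scaled g h n"
      using le[OF c] C.d_pos[of n]
      by (simp_all add: C.scaled_def CT.scaled_def word_dist_def divide_right_mono less_imp_le)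
  qed
  have lim_le: "C.limit_dist g h \<le> K * CT.limit_dist g h" "CT.limit_dist g h \<le> K * C.limit_dist g h"
    if gh: "g \<in> cone_sequences G S d" "h \<in> cone_sequences G S d" for g h
  proof -
    note gh' = gh[unfolded CS_eq]
    show "C.limit_dist g h \<le> K * CT.limit_dist g h"
      by (rule tendsto_le[OF C.nontrivial tendsto_mult[OF tendsto_const CT.scaled_tendsto[OF gh']] C.scaled_tendsto[OF gh]])
        (simp add: scaled_le[OF gh])
    show "CT.limit_dist g h \<le> K * C.limit_dist g h"
      by (rule tendsto_le[OF C.nontrivial tendsto_mult[OF tendsto_const C.scaled_tendsto[OF gh]] CT.scaled_tendsto[OF gh']])
        (simp add: scaled_le[OF gh])
  qed
  have zero: "C.limit_dist g h = 0 \<longleftrightarrow> CT.limit_dist g h = 0"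
    if gh: "g \<in> cone_sequences G S d" "h \<in> cone_sequences G S d" for g h
    using lim_le[OF gh] C.limit_dist_nonneg[OF gh] CT.limit_dist_nonneg[OF gh[unfolded CS_eq]] by auto
  have class_eq: "C.cone_class g = CT.cone_class g" for g
    using zero by (auto simp: set_eq_iff C.cone_class_iff CT.cone_class_iff CS_eq[symmetric])
  have CP: "cone_points G S \<omega> d = cone_points G T \<omega> d"
    unfolding C.CP_eq CT.CP_eq CS_eq class_eq ..
  show ?thesis
    unfolding cone_is_real_tree_def CP
  proof (rule real_tree_bilipschitz[OF tree[unfolded cone_is_real_tree_def] C.cone_geodesic[unfolded CP] K])
    fix x y assume "x \<in> cone_points G T \<omega> d" "y \<in> cone_points G T \<omega> d"
    then obtain g h where gh: "g \<in> cone_sequences G S d" "h \<in> cone_sequences G S d"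
      "x = C.cone_class g" "y = C.cone_class h" by (auto simp: CP[symmetric] C.CP_eq)
    have "cone_dist G S \<omega> d x y = C.limit_dist g h" using gh by (simp add: C.CD_class)
    moreover have "cone_dist G T \<omega> d x y = CT.limit_dist g h"
      using gh CT.CD_class[of g h] by (simp add: class_eq CS_eq)
    ultimately show "cone_dist G S \<omega> d x y \<le> K * cone_dist G T \<omega> d x y"
      "cone_dist G T \<omega> d x y \<le> K * cone_dist G S \<omega> d x y"
      using lim_le[OF gh(1,2)] by auto
  qed
qed

end

section \<open>Direct limits\<close>

lemma (in word_group) epi_generators:
  assumes H: "group H" and f: "f \<in> hom G H" "f ` carrier G = carrier H"
  shows "finite_generating_set H (f ` S)"
proof -
  interpret gh: group_hom G H f by (intro group_hom.intro group_hom_axioms.intro is_group H f)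
  show ?thesis
    using generating f gh.generate_img[of S] by (auto simp: finite_generating_set_def)
qed

text \<open>Words map letter by letter and lift letter by letter, so the metric of \<open>H\<close>
  is the quotient metric: lengths do not grow under \<open>f\<close>, and every element has a
  preimage of its own length. Such minimal preimages are what later turns injectivity on a ball into
  isometry.\<close>

lemma (in word_group) hom_length:
  assumes H: "word_group H T" and f: "f \<in> hom G H" "f ` S = T"
  shows "g \<in> carrier G \<Longrightarrow> word_length H T (f g) \<le> len g"
    and "h \<in> carrier H \<Longrightarrow> \<exists>g\<in>carrier G. f g = h \<and> len g = word_length H T h"
proof -
  interpret H: word_group H T by (rule H)
  interpret gh: group_hom G H f by (intro group_hom.intro group_hom_axioms.intro is_group H.is_group f)
  have letters: "f ` A = letters H T"
  proof -
    have "f ` (\<lambda>s. inv s) ` S = (\<lambda>s. inv\<^bsub>H\<^esub> s) ` f ` S"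
      unfolding image_image by (rule image_cong) (use S_carrier in auto)
    then show ?thesis using f(2) by (auto simp: image_Un)
  qed
  have ev: "f (ev w) = eval_word H (map f w)" if "set w \<subseteq> A" for w
    using that
  proof (induction w)
    case (Cons a w)
    then have "a \<in> carrier G" "ev w \<in> carrier G" using letters_carrier ev_closed[of w] by auto
    then show ?case using Cons by simp
  qed simp
  have le: "word_length H T (f (ev w)) \<le> length w" if "set w \<subseteq> A" for w
  proof -
    have "set (map f w) \<subseteq> letters H T" unfolding letters[symmetric] set_map using that by (rule image_mono)
    from H.len_le[OF this] show ?thesis using ev[OF that] by simp
  qed
  show 1: "word_length H T (f g) \<le> len g" if "g \<in> carrier G" for g
    using ex_geodesic_word[OF that] le by metis
  show "\<exists>g\<in>carrier G. f g = h \<and> len g = word_length H T h" if h: "h \<in> carrier H"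
  proof -
    obtain v where v: "set v \<subseteq> letters H T" "eval_word H v = h" "length v = word_length H T h"
      using H.ex_geodesic_word[OF h] by blast
    have "\<exists>w. set w \<subseteq> A \<and> map f w = v"
      using v(1) unfolding letters[symmetric]
    proof (induction v)
      case (Cons b v)
      then obtain w a where "set w \<subseteq> A" "map f w = v" "a \<in> A" "f a = b" by auto
      then show ?case by (intro exI[of _ "a # w"]) auto
    qed simp
    then obtain w where w: "set w \<subseteq> A" "map f w = v" by blast
    have c: "ev w \<in> carrier G" by (rule ev_closed[OF w(1)])
    have fw: "f (ev w) = h" using ev[OF w(1)] w v by simp
    have "length w = word_length H T h" using w(2) v(3) by (metis length_map)
    then have "len (ev w) = word_length H T h" using len_le[OF w(1)] 1[OF c] fw by simp
    then show ?thesis using c fw by blast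
  qed
qed

section \<open>Direct limits of sequences of epimorphisms\<close>

locale group_sequence =
  fixes H :: "nat \<Rightarrow> 'b monoid" and \<alpha> :: "nat \<Rightarrow> 'b \<Rightarrow> 'b"
  assumes groups: "\<And>i. group (H i)" and epis: "\<And>i. \<alpha> i \<in> epi (H i) (H (Suc i))"
begin

abbreviation "tr \<equiv> transition \<alpha>"
abbreviation "dl \<equiv> direct_limit_rel H \<alpha>"

lemma tr_refl: "tr i i = id"
  by (cases i) auto

lemma tr_Suc: "i \<le> j \<Longrightarrow> tr i (Suc j) = \<alpha> j \<circ> tr i j"
  by simp

lemma tr_hom_surj:
  assumes "i \<le> j"
  shows "tr i j \<in> hom (H i) (H j) \<and> tr i j ` carrier (H i) = carrier (H j)"
  using assms
proof (induction j rule: dec_induct)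
  case base
  show ?case by (simp add: tr_refl hom_def)
next
  case (step j)
  have \<alpha>: "\<alpha> j \<in> hom (H j) (H (Suc j))" "\<alpha> j ` carrier (H j) = carrier (H (Suc j))"
    using epis[of j] by (auto simp: epi_def)
  show ?case
    unfolding tr_Suc[OF step(1)] image_comp[symmetric] conjunct2[OF step.IH]
    using hom_compose[OF conjunct1[OF step.IH] \<alpha>(1)] \<alpha>(2) by (rule conjI)
qed

lemma tr_closed: "i \<le> j \<Longrightarrow> x \<in> carrier (H i) \<Longrightarrow> tr i j x \<in> carrier (H j)"
  using tr_hom_surj by blast

lemma tr_mult: "i \<le> j \<Longrightarrow> x \<in> carrier (H i) \<Longrightarrow> y \<in> carrier (H i) \<Longrightarrow>
    tr i j (x \<otimes>\<^bsub>H i\<^esub> y) = tr i j x \<otimes>\<^bsub>H j\<^esub> tr i j y"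
  using hom_mult[OF conjunct1[OF tr_hom_surj]] .

lemma tr_tr:
  assumes "i \<le> j" "j \<le> k"
  shows "tr j k (tr i j x) = tr i k x"
  using assms(2)
proof (induction k rule: dec_induct)
  case base
  then show ?case by (simp add: tr_refl)
next
  case (step k)
  then show ?case using assms(1) by (simp add: tr_Suc del: transition.simps)
qed

lemma tr_eq_later: "i \<le> k \<Longrightarrow> j \<le> k \<Longrightarrow> k \<le> l \<Longrightarrow> tr i k x = tr j k y \<Longrightarrow> tr i l x = tr j l y"
  using tr_tr[of i k l x] tr_tr[of j k l y] by (simp del: transition.simps)

lemma dl_iff: "((i, x), (j, y)) \<in> dl \<longleftrightarrow> x \<in> carrier (H i) \<and> y \<in> carrier (H j) \<and>
    (\<exists>k. i \<le> k \<and> j \<le> k \<and> tr i k x = tr j k y)"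
  by (simp add: direct_limit_rel_def)

lemma dl_equiv: "equiv (SIGMA i:UNIV. carrier (H i)) dl"
proof (rule equivI)
  show "dl \<subseteq> (SIGMA i:UNIV. carrier (H i)) \<times> (SIGMA i:UNIV. carrier (H i))"
    by (auto simp: dl_iff)
  show "refl_on (SIGMA i:UNIV. carrier (H i)) dl" by (auto simp: refl_on_def dl_iff)
  show "sym dl" by (auto simp: sym_def dl_iff)
  show "trans dl"
  proof (rule transI)
    fix p q r assume "(p, q) \<in> dl" "(q, r) \<in> dl"
    then obtain i x j y l z where pqr: "p = (i, x)" "q = (j, y)" "r = (l, z)"
      and 1: "((i, x), (j, y)) \<in> dl" "((j, y), (l, z)) \<in> dl" by (metis surj_pair)
    then obtain k k' where k: "i \<le> k" "j \<le> k" "tr i k x = tr j k y" "j \<le> k'" "l \<le> k'" "tr j k' y = tr l k' z"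
      by (auto simp: dl_iff)
    have "tr i (max k k') x = tr j (max k k') y" by (rule tr_eq_later[OF k(1,2) _ k(3)]) simp
    also have "\<dots> = tr l (max k k') z" by (rule tr_eq_later[OF k(4,5) _ k(6)]) simp
    finally show "(p, r) \<in> dl" using 1 k unfolding pqr dl_iff by (auto intro!: exI[of _ "max k k'"])
  qed
qed

definition cls :: "nat \<Rightarrow> 'b \<Rightarrow> (nat \<times> 'b) set" where
  "cls i x = dl `` {(i, x)}"

lemma cls_eq_iff:
  assumes "x \<in> carrier (H i)" "y \<in> carrier (H j)"
  shows "cls i x = cls j y \<longleftrightarrow> (\<exists>k. i \<le> k \<and> j \<le> k \<and> tr i k x = tr j k y)"
  using eq_equiv_class_iff[OF dl_equiv, of "(i, x)" "(j, y)"] assms by (simp add: cls_def dl_iff)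

lemma limit_carrier: "carrier (direct_limit H \<alpha>) = {cls i x | i x. x \<in> carrier (H i)}"
  by (auto simp: direct_limit_def quotient_def cls_def)

lemma cls_tr:
  assumes "i \<le> j" "x \<in> carrier (H i)"
  shows "cls i x = cls j (tr i j x)"
  unfolding cls_eq_iff[OF assms(2) tr_closed[OF assms]]
  by (rule exI[of _ j]) (simp add: tr_refl assms(1) del: transition.simps)

text \<open>Any representatives of the two classes agree with \<open>x\<close> and \<open>y\<close>
  at a sufficiently late stage, so all the classes in the union coincide.\<close>

lemma limit_mult:
  assumes x: "x \<in> carrier (H i)" and y: "y \<in> carrier (H i)"
  shows "cls i x \<otimes>\<^bsub>direct_limit H \<alpha>\<^esub> cls i y = cls i (x \<otimes>\<^bsub>H i\<^esub> y)"
proof -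
  have key: "cls (max j l) (tr j (max j l) u \<otimes>\<^bsub>H (max j l)\<^esub> tr l (max j l) v) = cls i (x \<otimes>\<^bsub>H i\<^esub> y)"
    if uv: "(j, u) \<in> cls i x" "(l, v) \<in> cls i y" for j u l v
  proof -
    obtain k k' where k: "i \<le> k" "j \<le> k" "tr i k x = tr j k u" "u \<in> carrier (H j)"
      "i \<le> k'" "l \<le> k'" "tr i k' y = tr l k' v" "v \<in> carrier (H l)"
      using uv by (auto simp: cls_def dl_iff)
    let ?m = "max j l" and ?K = "max k k'"
    have le: "j \<le> ?m" "l \<le> ?m" "?m \<le> ?K" "i \<le> ?K" "k \<le> ?K" "k' \<le> ?K" using k by auto
    have c: "tr j ?m u \<in> carrier (H ?m)" "tr l ?m v \<in> carrier (H ?m)" using tr_closed le k by auto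
    have "tr ?m ?K (tr j ?m u \<otimes>\<^bsub>H ?m\<^esub> tr l ?m v) = tr j ?K u \<otimes>\<^bsub>H ?K\<^esub> tr l ?K v"
      using tr_mult[OF le(3) c] tr_tr[OF le(1,3)] tr_tr[OF le(2,3)] by simp
    also have "\<dots> = tr i ?K x \<otimes>\<^bsub>H ?K\<^esub> tr i ?K y"
      using tr_eq_later[OF k(1,2) le(5) k(3)] tr_eq_later[OF k(5,6) le(6) k(7)] by simp
    also have "\<dots> = tr i ?K (x \<otimes>\<^bsub>H i\<^esub> y)" using tr_mult[OF le(4) x y] by simp
    finally show ?thesis
      using cls_eq_iff[of _ ?m _ i] c x y le monoid.m_closed[OF group.is_monoid[OF groups]] by blast
  qed
  have ne: "(i, x) \<in> cls i x" "(i, y) \<in> cls i y" using x y by (auto simp: cls_def dl_iff)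
  have "cls i x \<otimes>\<^bsub>direct_limit H \<alpha>\<^esub> cls i y = (\<Union>(j, u)\<in>cls i x. \<Union>(l, v)\<in>cls i y.
      cls (max j l) (tr j (max j l) u \<otimes>\<^bsub>H (max j l)\<^esub> tr l (max j l) v))"
    by (simp add: direct_limit_def cls_def)
  also have "\<dots> = (\<Union>p\<in>cls i x. \<Union>q\<in>cls i y. cls i (x \<otimes>\<^bsub>H i\<^esub> y))"
    using key by (intro SUP_cong refl) (auto split: prod.splits)
  also have "\<dots> = cls i (x \<otimes>\<^bsub>H i\<^esub> y)" using ne by blast
  finally show ?thesis .
qed

lemma limit_iso:
  assumes hom: "\<And>i. \<phi> i \<in> hom (H i) G" and surj: "\<phi> 0 ` carrier (H 0) = carrier G"
    and eq: "\<And>i x y. x \<in> carrier (H i) \<Longrightarrow> y \<in> carrier (H i) \<Longrightarrow>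
      \<phi> i x = \<phi> i y \<longleftrightarrow> (\<exists>k\<ge>i. tr i k x = tr i k y)"
    and comp: "\<And>i x. x \<in> carrier (H i) \<Longrightarrow> \<phi> (Suc i) (\<alpha> i x) = \<phi> i x"
  shows "direct_limit H \<alpha> \<cong> G"
proof -
  have tr: "\<phi> j (tr i j x) = \<phi> i x" if "i \<le> j" "x \<in> carrier (H i)" for i j x
    using that(1)
  proof (induction j rule: dec_induct)
    case base
    then show ?case by (simp add: tr_refl)
  next
    case (step j)
    then show ?case using comp[OF tr_closed[OF step(1) that(2)]] by (simp add: tr_Suc del: transition.simps)
  qed
  define \<psi> where "\<psi> C = (case (SOME p. p \<in> C) of (i, x) \<Rightarrow> \<phi> i x)" for C
  have \<psi>: "\<psi> (cls i x) = \<phi> i x" if x: "x \<in> carrier (H i)" for i x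
  proof -
    have "(i, x) \<in> cls i x" using x by (auto simp: cls_def dl_iff)
    then have "(SOME p. p \<in> cls i x) \<in> cls i x" by (rule someI)
    then obtain j y where jy: "(SOME p. p \<in> cls i x) = (j, y)" "(j, y) \<in> cls i x" by (metis surj_pair)
    then obtain k where k: "y \<in> carrier (H j)" "i \<le> k" "j \<le> k" "tr i k x = tr j k y" by (auto simp: cls_def dl_iff)
    have "\<phi> j y = \<phi> i x" using tr[OF k(2) x] tr[OF k(3,1)] k(4) by simp
    then show ?thesis using jy by (simp add: \<psi>_def)
  qed
  have common: "\<exists>k x' y'. x' \<in> carrier (H k) \<and> y' \<in> carrier (H k) \<and> cls i x = cls k x' \<and> cls j y = cls k y'"
    if "x \<in> carrier (H i)" "y \<in> carrier (H j)" for i x j y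
    using cls_tr[of i "max i j" x] cls_tr[of j "max i j" y] tr_closed[of i "max i j" x] tr_closed[of j "max i j" y] that
    by auto
  have "\<psi> \<in> iso (direct_limit H \<alpha>) G"
  proof (rule isoI)
    show "\<psi> \<in> hom (direct_limit H \<alpha>) G"
    proof (rule homI)
      show "\<psi> A \<in> carrier G" if "A \<in> carrier (direct_limit H \<alpha>)" for A
        using that hom \<psi> hom_in_carrier by (fastforce simp: limit_carrier)
      fix A B assume "A \<in> carrier (direct_limit H \<alpha>)" "B \<in> carrier (direct_limit H \<alpha>)"
      then obtain k x y where xy: "x \<in> carrier (H k)" "y \<in> carrier (H k)" "A = cls k x" "B = cls k y"
        unfolding limit_carrier using common by blast
      then show "\<psi> (A \<otimes>\<^bsub>direct_limit H \<alpha>\<^esub> B) = \<psi> A \<otimes>\<^bsub>G\<^esub> \<psi> B"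
        using limit_mult[OF xy(1,2)] \<psi> hom_mult[OF hom xy(1,2)] monoid.m_closed[OF group.is_monoid[OF groups] xy(1,2)]
        by simp
    qed
    show "bij_betw \<psi> (carrier (direct_limit H \<alpha>)) (carrier G)"
      unfolding bij_betw_def
    proof
      show "inj_on \<psi> (carrier (direct_limit H \<alpha>))"
      proof (rule inj_onI)
        fix A B assume AB: "A \<in> carrier (direct_limit H \<alpha>)" "B \<in> carrier (direct_limit H \<alpha>)" "\<psi> A = \<psi> B"
        then obtain k x y where xy: "x \<in> carrier (H k)" "y \<in> carrier (H k)" "A = cls k x" "B = cls k y"
          unfolding limit_carrier using common by blast
        then have "\<exists>l\<ge>k. tr k l x = tr k l y" using AB \<psi> eq by simp
        then show "A = B" using xy cls_eq_iff by auto
      qed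
      show "\<psi> ` carrier (direct_limit H \<alpha>) = carrier G"
      proof (intro equalityI subsetI)
        fix g assume "g \<in> \<psi> ` carrier (direct_limit H \<alpha>)"
        then show "g \<in> carrier G" using hom \<psi> hom_in_carrier by (fastforce simp: limit_carrier)
      next
        fix g assume "g \<in> carrier G"
        then obtain x where "x \<in> carrier (H 0)" "g = \<phi> 0 x" using surj by blast
        then show "g \<in> \<psi> ` carrier (direct_limit H \<alpha>)"
          using \<psi> by (auto simp: limit_carrier intro!: image_eqI[of _ _ "cls 0 x"])
      qed
    qed
  qed
  then show ?thesis by (auto simp: is_iso_def)
qed

lemma limit_maps:
  assumes "direct_limit H \<alpha> \<cong> G"
  obtains \<phi> where "\<And>i. \<phi> i \<in> hom (H i) G" "\<And>i. \<phi> i ` carrier (H i) = carrier G"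
    "\<And>i j x. i \<le> j \<Longrightarrow> x \<in> carrier (H i) \<Longrightarrow> \<phi> j (tr i j x) = \<phi> i x"
    "\<And>i x y. x \<in> carrier (H i) \<Longrightarrow> y \<in> carrier (H i) \<Longrightarrow> \<phi> i x = \<phi> i y \<Longrightarrow> \<exists>k\<ge>i. tr i k x = tr i k y"
proof -
  obtain \<psi> where \<psi>: "\<psi> \<in> iso (direct_limit H \<alpha>) G" using assms by (auto simp: is_iso_def)
  then have hom: "\<psi> \<in> hom (direct_limit H \<alpha>) G" and bij: "bij_betw \<psi> (carrier (direct_limit H \<alpha>)) (carrier G)"
    by (auto simp: iso_def)
  define \<phi> where "\<phi> i x = \<psi> (cls i x)" for i x
  have cc: "x \<in> carrier (H i) \<Longrightarrow> cls i x \<in> carrier (direct_limit H \<alpha>)" for i x by (auto simp: limit_carrier)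
  show ?thesis
  proof (rule that[of \<phi>])
    show "\<phi> i \<in> hom (H i) G" for i
      by (rule homI) (use hom cc limit_mult hom_mult[OF hom] hom_in_carrier[OF hom] in \<open>auto simp: \<phi>_def limit_mult[symmetric]\<close>)
    show tr: "\<phi> j (tr i j x) = \<phi> i x" if "i \<le> j" "x \<in> carrier (H i)" for i j x
      using cls_tr[OF that] by (simp add: \<phi>_def)
    show "\<phi> i ` carrier (H i) = carrier G" for i
    proof (intro equalityI subsetI)
      fix g assume "g \<in> \<phi> i ` carrier (H i)"
      then show "g \<in> carrier G" using cc hom_in_carrier[OF hom] by (auto simp: \<phi>_def)
    next
      fix g assume "g \<in> carrier G"
      then obtain A where "A \<in> carrier (direct_limit H \<alpha>)" "g = \<psi> A" using bij by (auto simp: bij_betw_def)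
      then obtain j x where x: "x \<in> carrier (H j)" "g = \<phi> j x" by (auto simp: limit_carrier \<phi>_def)
      have "tr j (max i j) x \<in> tr i (max i j) ` carrier (H i)"
        using tr_hom_surj[of i "max i j"] tr_closed[of j "max i j" x] x by auto
      then obtain y where y: "y \<in> carrier (H i)" "tr i (max i j) y = tr j (max i j) x" by auto
      then have "\<phi> i y = g" using tr[of i "max i j" y] tr[of j "max i j" x] x by simp
      then show "g \<in> \<phi> i ` carrier (H i)" using y by blast
    qed
    fix i x y assume xy: "x \<in> carrier (H i)" "y \<in> carrier (H i)" "\<phi> i x = \<phi> i y"
    then have "cls i x = cls i y" using bij cc by (auto simp: \<phi>_def bij_betw_def dest: inj_onD)
    then show "\<exists>k\<ge>i. tr i k x = tr i k y" using cls_eq_iff xy by auto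
  qed
qed

end

section \<open>Comparison of balls in the limit with balls in the sequence\<close>

lemma (in word_group) dst_hom:
  assumes H: "word_group H T" and f: "f \<in> hom G H" and xy: "x \<in> carrier G" "y \<in> carrier G"
  shows "word_dist H T (f x) (f y) = word_length H T (f (inv x \<otimes> y))"
proof -
  interpret H: word_group H T by (rule H)
  interpret gh: group_hom G H f by (intro group_hom.intro group_hom_axioms.intro is_group H.is_group f)
  show ?thesis using xy by (simp add: word_dist_def)
qed

text \<open>The hypothesis relates \<open>\<delta> i\<close> to the injectivity radius of
  \<open>\<alpha> i\<close> alone, whereas the map from \<open>H i\<close> to the limit is the
  composite of all later maps. The stage \<open>i\<close> must therefore be chosen so that all later
  radii are large compared with \<open>\<delta> i\<close>.\<close>

lemma limit_of_hyperbolic_imp_lacunary_scales: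
  fixes G :: "('a, 'm) monoid_scheme"
  assumes G: "group G" and lim: "lacunary_limit_of_hyperbolic TYPE('b) G"
  shows "\<exists>T. finite_generating_set G T \<and> word_group.lacunary_scales G T"
proof -
  obtain H :: "nat \<Rightarrow> 'b monoid" and S \<alpha> \<delta> where
    hyp: "\<And>i. hyperbolic_group_with (H i) (S i) (\<delta> i)" and epi: "\<And>i. \<alpha> i \<in> epi (H i) (H (Suc i))"
    and gens: "\<And>i. \<alpha> i ` S i = S (Suc i)" and iso: "direct_limit H \<alpha> \<cong> G"
    and small: "\<And>\<epsilon>. \<epsilon> > 0 \<Longrightarrow> \<forall>\<^sub>F i in sequentially. ereal (\<delta> i) \<le> ereal \<epsilon> * injectivity_radius (H i) (S i) (\<alpha> i)"
    using lim unfolding lacunary_limit_of_hyperbolic_def by blast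
  interpret H: word_group "H i" "S i" for i
    using hyp[of i] by (auto simp: hyperbolic_group_with_def word_group_def word_group_axioms_def)
  interpret group_sequence H \<alpha> by (intro group_sequence.intro H.is_group epi)
  obtain \<phi> where \<phi>: "\<And>i. \<phi> i \<in> hom (H i) G" "\<And>i. \<phi> i ` carrier (H i) = carrier G"
    "\<And>i j x. i \<le> j \<Longrightarrow> x \<in> carrier (H i) \<Longrightarrow> \<phi> j (tr i j x) = \<phi> i x"
    "\<And>i x y. x \<in> carrier (H i) \<Longrightarrow> y \<in> carrier (H i) \<Longrightarrow> \<phi> i x = \<phi> i y \<Longrightarrow> \<exists>k\<ge>i. tr i k x = tr i k y"
    using limit_maps[OF iso] by metis
  define T where "T = \<phi> 0 ` S 0"
  have trS: "tr i j ` S i = S j" if "i \<le> j" for i j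
    using that
  proof (induction j rule: dec_induct)
    case (step j)
    then show ?case using gens[of j] unfolding tr_Suc[OF step(1)] image_comp[symmetric] by simp
  qed (simp add: tr_refl)
  have T: "\<phi> i ` S i = T" for i
  proof -
    have "\<phi> i ` S i = \<phi> i ` tr 0 i ` S 0" using trS[of 0 i] by simp
    also have "\<dots> = T" unfolding T_def image_image
      by (rule image_cong) (use \<phi>(3)[of 0 i] H.S_carrier[of 0] in auto)
    finally show ?thesis .
  qed
  have fgT: "finite_generating_set G T" unfolding T_def by (rule H.epi_generators[OF G \<phi>(1,2)])
  interpret G: word_group G T by (intro word_group.intro G word_group_axioms.intro fgT)
  have wgG: "word_group G T" by unfold_locales
  have wgH: "word_group (H i) (S i)" for i by unfold_locales
  note phi_len = H.hom_length(1)[OF wgG \<phi>(1) T]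
  note phi_lift = H.hom_length(2)[OF wgG \<phi>(1) T]
  note tr_len = H.hom_length(1)[OF wgH conjunct1[OF tr_hom_surj] trS]
  have four: "G.dst (\<phi> i x) (\<phi> i y) + G.dst (\<phi> i z) (\<phi> i w) \<le> G.dst (\<phi> i x) (\<phi> i z) + G.dst (\<phi> i y) (\<phi> i w) + 2 * C \<or>
      G.dst (\<phi> i x) (\<phi> i y) + G.dst (\<phi> i z) (\<phi> i w) \<le> G.dst (\<phi> i x) (\<phi> i w) + G.dst (\<phi> i y) (\<phi> i z) + 2 * C"
    if X: "x \<in> carrier (H i)" "y \<in> carrier (H i)" "z \<in> carrier (H i)" "w \<in> carrier (H i)"
      and eq: "\<And>u v. u \<in> {x, y, z, w} \<Longrightarrow> v \<in> {x, y, z, w} \<Longrightarrow> G.dst (\<phi> i u) (\<phi> i v) = H.dst i u v"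
      and C: "3 * \<delta> i \<le> real C" for i x y z w C
    using H.hyperbolic_group_four_point[OF hyp X] C eq[of x y] eq[of z w] eq[of x z] eq[of y w] eq[of x w] eq[of y z]
    by (auto simp: max_def split: if_splits)
  have "G.lacunary_scales"
    unfolding G.lacunary_scales_def
  proof (intro allI)
    fix m L
    \<comment> \<open>If \<open>\<delta>\<close> stays bounded along a subsequence, all of
      \<open>G\<close> satisfies the condition with one constant. Otherwise \<open>\<delta>\<close>
      tends to infinity, and then \<open>L \<le> D\<close> holds when \<open>D\<close> is about
      \<open>3 * \<delta> i\<close> for a late \<open>i\<close>.\<close>
    show "\<exists>D\<ge>L. hyperbolic_in_ball G T D (m * D)"
    proof (cases "\<exists>B. \<forall>i0. \<exists>i\<ge>i0. \<delta> i \<le> B")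
      case True
      \<comment> \<open>On a finite set of points the word metric of \<open>G\<close> agrees with that of \<open>H i\<close> for all large \<open>i\<close>.\<close>
      then obtain B where B: "\<And>i0. \<exists>i\<ge>i0. \<delta> i \<le> B" by blast
      define D where "D = max L (nat \<lceil>3 * B\<rceil>)"
      \<comment> \<open>A preimage \<open>h\<close> of \<open>\<phi> 0 g\<close> of least length
        becomes equal to \<open>g\<close> at some stage, and from there on \<open>g\<close> has the
        length of its image in \<open>G\<close>.\<close>
      have stable: "\<exists>k. \<forall>i\<ge>k. G.dst (\<phi> 0 x) (\<phi> 0 y) = H.dst i (tr 0 i x) (tr 0 i y)"
        if xy: "x \<in> carrier (H 0)" "y \<in> carrier (H 0)" for x y
      proof -
        define g where "g = inv\<^bsub>H 0\<^esub> x \<otimes>\<^bsub>H 0\<^esub> y"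
        have g: "g \<in> carrier (H 0)" using xy by (simp add: g_def)
        have "\<phi> 0 g \<in> carrier G" using \<phi>(1) g hom_in_carrier by fastforce
        then obtain h where h: "h \<in> carrier (H 0)" "\<phi> 0 h = \<phi> 0 g" "H.len 0 h = G.len (\<phi> 0 g)"
          using phi_lift[of "\<phi> 0 g" 0] by auto
        obtain k where k: "tr 0 k h = tr 0 k g" using \<phi>(4)[OF h(1) g h(2)] by auto
        have "G.dst (\<phi> 0 x) (\<phi> 0 y) = H.dst i (tr 0 i x) (tr 0 i y)" if "k \<le> i" for i
        proof -
          have "tr 0 i h = tr 0 i g" using tr_eq_later[OF _ _ \<open>k \<le> i\<close> k] by simp
          then have "H.len i (tr 0 i g) \<le> G.len (\<phi> 0 g)" using tr_len[of 0 i h] h by simp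
          moreover have "G.len (\<phi> 0 g) \<le> H.len i (tr 0 i g)"
            using phi_len[OF tr_closed[OF _ g], of i] \<phi>(3)[of 0 i g] g by simp
          ultimately show ?thesis
            using H.dst_hom[OF wgG \<phi>(1) xy] H.dst_hom[OF wgH conjunct1[OF tr_hom_surj] xy, of i] by (simp add: g_def)
        qed
        then show ?thesis by blast
      qed
      have "hyperbolic_in_ball G T D (m * D)"
        unfolding hyperbolic_in_ball_def
      proof (intro ballI impI)
        fix x y z w assume xyzw: "x \<in> carrier G" "y \<in> carrier G" "z \<in> carrier G" "w \<in> carrier G"
        define f where "f = inv_into (carrier (H 0)) (\<phi> 0)"
        have f: "f g \<in> carrier (H 0)" "\<phi> 0 (f g) = g" if "g \<in> carrier G" for g
          using inv_into_into[of g "\<phi> 0" "carrier (H 0)"] f_inv_into_f[of g "\<phi> 0" "carrier (H 0)"] \<phi>(2)[of 0] that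
          by (simp_all add: f_def)
        define x' y' z' w' where "x' = f x" and "y' = f y" and "z' = f z" and "w' = f w"
        have X: "x' \<in> carrier (H 0)" "y' \<in> carrier (H 0)" "z' \<in> carrier (H 0)" "w' \<in> carrier (H 0)"
          and eq: "x = \<phi> 0 x'" "y = \<phi> 0 y'" "z = \<phi> 0 z'" "w = \<phi> 0 w'"
          using f xyzw by (simp_all add: x'_def y'_def z'_def w'_def)
        define k where
          "k u v = (SOME k. \<forall>i\<ge>k. G.dst (\<phi> 0 u) (\<phi> 0 v) = H.dst i (tr 0 i u) (tr 0 i v))" for u v
        have k: "G.dst (\<phi> 0 u) (\<phi> 0 v) = H.dst i (tr 0 i u) (tr 0 i v)"
          if "u \<in> carrier (H 0)" "v \<in> carrier (H 0)" "k u v \<le> i" for u v i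
          using someI_ex[OF stable[OF that(1,2)]] that(3) unfolding k_def by blast
        define K where "K = Max ((\<lambda>(u, v). k u v) ` ({x', y', z', w'} \<times> {x', y', z', w'}))"
        have K: "k u v \<le> K" if "u \<in> {x', y', z', w'}" "v \<in> {x', y', z', w'}" for u v
          unfolding K_def by (rule Max_ge) (use that in auto)
        obtain i where i: "K \<le> i" "\<delta> i \<le> B" using B by blast
        have phi: "\<phi> i (tr 0 i u) = \<phi> 0 u" if "u \<in> carrier (H 0)" for u using \<phi>(3) that by simp
        have "3 * \<delta> i \<le> real D" using i(2) unfolding D_def by linarith
        moreover have "G.dst (\<phi> i u) (\<phi> i v) = H.dst i u v"
          if "u \<in> {tr 0 i x', tr 0 i y', tr 0 i z', tr 0 i w'}" "v \<in> {tr 0 i x', tr 0 i y', tr 0 i z', tr 0 i w'}" for u v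
        proof -
          obtain u' v' where uv: "u' \<in> {x', y', z', w'}" "v' \<in> {x', y', z', w'}" "u = tr 0 i u'" "v = tr 0 i v'"
            using \<open>u \<in> _\<close> \<open>v \<in> _\<close> by blast
          then have "u' \<in> carrier (H 0)" "v' \<in> carrier (H 0)" using X by auto
          then show ?thesis using k[of u' v' i] K[OF uv(1,2)] i uv phi by simp
        qed
        ultimately show "G.dst x y + G.dst z w \<le> G.dst x z + G.dst y w + 2 * D \<or>
            G.dst x y + G.dst z w \<le> G.dst x w + G.dst y z + 2 * D"
          using four[of "tr 0 i x'" i "tr 0 i y'" "tr 0 i z'" "tr 0 i w'" D] tr_closed[of 0 i] X
          by (simp add: phi eq)
      qed
      then show ?thesis by (intro exI[of _ D] conjI) (simp_all add: D_def)
    next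
      case False
      have large: "\<exists>i0. \<forall>i\<ge>i0. B < \<delta> i" for B
      proof (rule ccontr)
        assume "\<not> ?thesis"
        then have "\<forall>i0. \<exists>i\<ge>i0. \<delta> i \<le> B" by (meson not_le)
        then show False using False by blast
      qed
      define r where "r i = injectivity_radius (H i) (S i) (\<alpha> i)" for i
      \<comment> \<open>The target is a radius \<open>2 * m * D\<close>, which is at most
        \<open>8 * (m + 1) * \<delta> i\<close> because \<open>D\<close> is at most
        \<open>4 * \<delta> i\<close>. Another factor 2 is lost in the choice of
        \<open>i\<close>.\<close>
      define \<epsilon> where "\<epsilon> = 1 / (16 * (real m + 1))"
      have \<epsilon>: "\<epsilon> > 0" by (simp add: \<epsilon>_def)
      obtain i1 where i1: "\<And>i. i1 \<le> i \<Longrightarrow> ereal (\<delta> i) \<le> ereal \<epsilon> * r i"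
        using small[OF \<epsilon>] by (auto simp: eventually_sequentially r_def)
      obtain i2 where i2: "\<And>i. i2 \<le> i \<Longrightarrow> real L + 1 < \<delta> i" using large by blast
      define i0 where "i0 = max i1 i2"
      have r1: "ereal (1 / \<epsilon>) \<le> r i" if "i0 \<le> i" for i
      proof -
        have "1 \<le> \<delta> i" using i2[of i] that by (simp add: i0_def)
        then have "ereal 1 \<le> ereal (\<delta> i)" by simp
        also have "\<dots> \<le> ereal \<epsilon> * r i" using i1[of i] that by (simp add: i0_def)
        finally show ?thesis using \<epsilon> by (cases "r i") (auto simp: field_simps)
      qed
      \<comment> \<open>The radii need not be monotone. A stage \<open>i\<close> with
        \<open>r i\<close> less than twice the infimum satisfies
        \<open>\<delta> i \<le> \<epsilon> * r i < 2 * \<epsilon> * I\<close>, and \<open>I\<close>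
        bounds all later radii from below.\<close>
      define I where "I = (INF i\<in>{i0..}. r i)"
      have I_le: "I \<le> r i" if "i0 \<le> i" for i unfolding I_def using that by (intro INF_lower) simp
      have I_pos: "ereal (1 / \<epsilon>) \<le> I" unfolding I_def by (rule INF_greatest) (simp add: r1)
      \<comment> \<open>For such an \<open>i\<close> the composite of all maps after \<open>H i\<close> is injective on a ball of radius comparable to \<open>r i\<close>.\<close>
      have "\<exists>i\<ge>i0. \<forall>j\<ge>i. ereal (8 * (real m + 1) * \<delta> i) < r j"
      proof (cases "I = \<infinity>")
        case True
        have "ereal (8 * (real m + 1) * \<delta> i0) < r j" if "i0 \<le> j" for j
          using I_le[OF that] True by simp
        then show ?thesis by blast
      next
        case False
        then obtain I' where I': "I = ereal I'" "1 / \<epsilon> \<le> I'" using I_pos by (cases I) auto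
        have "0 < I'" using I'(2) \<epsilon> by (smt (verit) divide_pos_pos)
        then have "I < ereal (2 * I')" using I' by simp
        then obtain i where i: "i0 \<le> i" "r i < ereal (2 * I')" unfolding I_def INF_less_iff by auto
        have "r i \<noteq> -\<infinity>" using I_le[OF i(1)] I' by auto
        then obtain ri where ri: "r i = ereal ri" "ri < 2 * I'" using i(2) by (cases "r i") auto
        have "\<delta> i \<le> \<epsilon> * ri" using i1[of i] i(1) ri by (simp add: i0_def)
        then have "8 * (real m + 1) * \<delta> i \<le> ri / 2" by (simp add: \<epsilon>_def field_simps)
        then have "8 * (real m + 1) * \<delta> i < I'" using ri by simp
        then have "ereal (8 * (real m + 1) * \<delta> i) < r j" if "i \<le> j" for j
          using I_le[of j] I' i(1) that by (metis less_le_trans le_trans less_ereal.simps(1))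
        then show ?thesis using i(1) by blast
      qed
      then obtain i where i: "i0 \<le> i" "\<And>j. i \<le> j \<Longrightarrow> ereal (8 * (real m + 1) * \<delta> i) < r j" by blast
      define D where "D = nat \<lceil>3 * \<delta> i\<rceil>"
      have \<delta>L: "real L + 1 < \<delta> i" using i2[of i] i(1) by (simp add: i0_def)
      have D: "3 * \<delta> i \<le> real D" "real D \<le> 4 * \<delta> i" "L \<le> D"
        unfolding D_def using \<delta>L by linarith+
      have rad: "real (2 * m * D) \<le> 8 * (real m + 1) * \<delta> i"
      proof -
        have "real m * real D \<le> real m * (4 * \<delta> i)" using D(2) by (intro mult_left_mono) auto
        then show ?thesis using \<delta>L by (simp add: algebra_simps)
      qed
      have inj: "inj_on (\<alpha> j) {h \<in> carrier (H j). H.len j h \<le> 2 * m * D}" if "i \<le> j" for j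
      proof -
        have "ereal (real (2 * m * D)) \<le> ereal (8 * (real m + 1) * \<delta> i)" using rad by simp
        also have "\<dots> < r j" by (rule i(2)[OF that])
        finally obtain n where n: "real (2 * m * D) < real n" "inj_on (\<alpha> j) {h \<in> carrier (H j). H.len j h \<le> n}"
          unfolding r_def injectivity_radius_def less_Sup_iff by auto
        have "2 * m * D \<le> n" using n(1) unfolding of_nat_less_iff by simp
        then have "{h \<in> carrier (H j). H.len j h \<le> 2 * m * D} \<subseteq> {h \<in> carrier (H j). H.len j h \<le> n}"
          by (auto intro: order_trans)
        then show ?thesis by (rule inj_on_subset[OF n(2)])
      qed
      have tr_inj: "tr i k x = tr i k y \<longrightarrow> x = y"
        if xy: "x \<in> carrier (H i)" "y \<in> carrier (H i)" "H.len i x \<le> 2 * m * D" "H.len i y \<le> 2 * m * D"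
          and ik: "i \<le> k" for x y k
        using ik
      proof (induction k rule: dec_induct)
        case base
        show ?case by (simp add: tr_refl)
      next
        case (step k)
        have "tr i k u \<in> {h \<in> carrier (H k). H.len k h \<le> 2 * m * D}"
          if "u \<in> carrier (H i)" "H.len i u \<le> 2 * m * D" for u
          using tr_closed[OF step(1) that(1)] tr_len[OF step(1) step(1) that(1)] that(2) by simp
        then have "\<alpha> k (tr i k x) = \<alpha> k (tr i k y) \<longrightarrow> tr i k x = tr i k y"
          using inj[OF step(1)] xy unfolding inj_on_def by blast
        then show ?case using step.IH unfolding tr_Suc[OF step(1)] by simp
      qed
      have phi_inj: "x = y" if xy: "x \<in> carrier (H i)" "y \<in> carrier (H i)" "H.len i x \<le> 2 * m * D" "H.len i y \<le> 2 * m * D"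
        and "\<phi> i x = \<phi> i y" for x y
        using \<phi>(4)[OF xy(1,2) that(5)] tr_inj[OF xy] by blast
      \<comment> \<open>The element \<open>g\<close> and a preimage of \<open>\<phi> i g\<close> of
        least length both lie in the ball of radius \<open>2 * m * D\<close>, on which
        \<open>\<phi> i\<close> is injective; so they coincide.\<close>
      have isom: "G.dst (\<phi> i u) (\<phi> i v) = H.dst i u v"
        if uv: "u \<in> carrier (H i)" "v \<in> carrier (H i)" "H.len i u \<le> m * D" "H.len i v \<le> m * D" for u v
      proof -
        define g where "g = inv\<^bsub>H i\<^esub> u \<otimes>\<^bsub>H i\<^esub> v"
        have g: "g \<in> carrier (H i)" using uv by (simp add: g_def)
        have gl: "H.len i g \<le> 2 * m * D"
          using H.len_mult[of "inv\<^bsub>H i\<^esub> u" i v] H.len_inv[of u i] uv by (simp add: g_def)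
        have "\<phi> i g \<in> carrier G" using \<phi>(1) g hom_in_carrier by fastforce
        then obtain h where h: "h \<in> carrier (H i)" "\<phi> i h = \<phi> i g" "H.len i h = G.len (\<phi> i g)"
          using phi_lift[of "\<phi> i g" i] by auto
        have "H.len i h \<le> H.len i g" using h(3) phi_len[OF g] by simp
        then have "h = g" using phi_inj[OF h(1) g _ gl h(2)] gl by simp
        then show ?thesis using h H.dst_hom[OF wgG \<phi>(1) uv(1,2)] by (simp add: g_def word_dist_def)
      qed
      have "hyperbolic_in_ball G T D (m * D)"
        unfolding hyperbolic_in_ball_def
      proof (intro ballI impI)
        fix x y z w assume X: "x \<in> carrier G" "y \<in> carrier G" "z \<in> carrier G" "w \<in> carrier G"
          and le: "G.len x \<le> m * D \<and> G.len y \<le> m * D \<and> G.len z \<le> m * D \<and> G.len w \<le> m * D"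
        obtain f where f: "\<And>g. g \<in> carrier G \<Longrightarrow> f g \<in> carrier (H i) \<and> \<phi> i (f g) = g \<and> H.len i (f g) = G.len g"
          using phi_lift[of _ i] by metis
        have "\<And>u. u \<in> {f x, f y, f z, f w} \<Longrightarrow> u \<in> carrier (H i) \<and> H.len i u \<le> m * D" using f X le by auto
        then have "\<And>u v. u \<in> {f x, f y, f z, f w} \<Longrightarrow> v \<in> {f x, f y, f z, f w} \<Longrightarrow> G.dst (\<phi> i u) (\<phi> i v) = H.dst i u v"
          using isom by blast
        then show "G.dst x y + G.dst z w \<le> G.dst x z + G.dst y w + 2 * D \<or>
            G.dst x y + G.dst z w \<le> G.dst x w + G.dst y z + 2 * D"
          using four[of "f x" i "f y" "f z" "f w" D] f X D(1) by simp
      qed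
      then show ?thesis using D(3) by blast
    qed
  qed
  then show ?thesis using fgT by blast
qed

text \<open>Stage \<open>i\<close> is the quotient of the words by all relations visible at scale
  \<open>20 * D i\<close>. Increasing the scale adds relations, which gives the epimorphisms, and
  every relation of \<open>G\<close> is visible from some stage on.\<close>

lemma (in word_group) lacunary_scales_imp_limit_of_hyperbolic:
  assumes scales: "lacunary_scales" and inf: "infinite (UNIV :: 'c set)"
  shows "lacunary_limit_of_hyperbolic TYPE('c) G"
proof -
  \<comment> \<open>The factor \<open>400000\<close> is what \<open>hyperbolic_word_quotient\<close>
    needs; the factor \<open>i + 1\<close> makes the radius large compared with
    \<open>D\<close>.\<close>
  define good where "good i D \<longleftrightarrow> 1 \<le> D \<and> hyperbolic_in_ball G S D ((i + 1) * 400000 * D)" for i D :: nat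
  have ex: "\<exists>D\<ge>L. good i D" for i L
    using scales[unfolded lacunary_scales_def, rule_format, where m = "(i + 1) * 400000" and L = "max 1 L"]
    by (auto simp: good_def)
  \<comment> \<open>Strict growth gives \<open>i \<le> D i\<close>, so relations of every length
    appear eventually.\<close>
  obtain D where D: "\<And>i. good i (D i)" "\<And>i. Suc (D i) \<le> D (Suc i)"
    using dependent_nat_choice[of good "\<lambda>i D D'. Suc D \<le> D'"] ex by metis
  define R where "R i = (i + 1) * 400000 * D i" for i
  \<comment> \<open>All classes at all scales are encoded together: they are countably many, so a
    single injection into \<open>'c\<close> serves every stage.\<close>
  define \<C> where "\<C> = (\<Union>N. (\<lambda>w. moves N `` {w}) ` lists A)"
  have "finite A" using generating by (simp add: finite_generating_set_def)
  then have "countable (lists A)" by (intro countable_lists countable_finite)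
  then have "countable \<C>" unfolding \<C>_def by (intro countable_UN countable_image) auto
  obtain f :: "nat \<Rightarrow> 'c" where f: "inj f" using infinite_countable_subset[OF inf] by blast
  define enc where "enc = f \<circ> to_nat_on \<C>"
  have "inj_on enc \<C>"
    unfolding enc_def using f inj_on_to_nat_on[OF \<open>countable \<C>\<close>] by (auto intro: comp_inj_on inj_on_subset)
  then have enc: "inj_on enc ((\<lambda>w. moves N `` {w}) ` lists A)" for N
    by (rule inj_on_subset) (auto simp: \<C>_def)
  interpret Q: hyperbolic_word_quotient G S enc "D i" "R i" for i
  proof unfold_locales
    show "1 \<le> D i" "hyperbolic_in_ball G S (D i) (R i)" using D(1)[of i] by (auto simp: good_def R_def)
    show "400000 * D i \<le> R i" by (simp add: R_def)
    show "inj_on enc ((\<lambda>w. moves (20 * D i) `` {w}) ` lists A)" by (rule enc)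
  qed
  define \<alpha> where "\<alpha> i x = Q.cl (Suc i) (Q.rep i x)" for i x
  have Dmono: "D i \<le> D j" if "i \<le> j" for i j
    by (rule lift_Suc_mono_le[of D, OF _ that]) (rule Suc_leD[OF D(2)])
  have Dge: "i \<le> D i" for i
  proof (induction i)
    case (Suc i)
    then show ?case using D(2)[of i] by linarith
  qed simp
  have \<alpha>_cl: "\<alpha> i (Q.cl i w) = Q.cl (Suc i) w" if w: "set w \<subseteq> A" for i w
  proof -
    note r = Q.rep[OF Q.cl_carrier[OF w], of i]
    then have "(Q.rep i (Q.cl i w), w) \<in> moves (20 * D i)" using Q.cl_eq w by blast
    then have "(Q.rep i (Q.cl i w), w) \<in> moves (20 * D (Suc i))"
      using Dmono[of i "Suc i"] by (intro moves_mono[of "20 * D i" "20 * D (Suc i)"]) auto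
    then show ?thesis using Q.cl_eq[of _ w "Suc i"] r w by (simp add: \<alpha>_def)
  qed
  have epi: "\<alpha> i \<in> epi (Q.Q i) (Q.Q (Suc i))" for i
    unfolding epi_def
  proof (intro CollectI conjI)
    show "\<alpha> i \<in> hom (Q.Q i) (Q.Q (Suc i))"
      by (rule homI) (auto simp: Q.carrier_Q Q.mult_Q \<alpha>_cl)
    show "\<alpha> i ` carrier (Q.Q i) = carrier (Q.Q (Suc i))"
      unfolding Q.carrier_Q image_image by (rule image_cong) (auto simp: \<alpha>_cl)
  qed
  interpret seq: group_sequence Q.Q \<alpha> by (intro group_sequence.intro Q.group_Q epi)
  have tr_cl: "seq.tr i j (Q.cl i w) = Q.cl j w" if "i \<le> j" and w: "set w \<subseteq> A" for i j w
    using that(1)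
  proof (induction j rule: dec_induct)
    case base
    then show ?case by (simp add: seq.tr_refl)
  next
    case (step j)
    then show ?case using \<alpha>_cl[OF w] by (simp add: seq.tr_Suc del: transition.simps)
  qed
  have iso: "direct_limit Q.Q \<alpha> \<cong> G"
  proof (rule seq.limit_iso[where \<phi> = Q.proj])
    show "Q.proj i \<in> hom (Q.Q i) G" for i by (rule Q.proj_hom)
    show "Q.proj 0 ` carrier (Q.Q 0) = carrier G"
    proof (intro equalityI subsetI)
      fix g assume "g \<in> Q.proj 0 ` carrier (Q.Q 0)"
      then show "g \<in> carrier G" using hom_in_carrier[OF Q.proj_hom] by blast
    next
      fix g assume "g \<in> carrier G"
      then obtain w where "set w \<subseteq> A" "ev w = g" using ex_word by blast
      then show "g \<in> Q.proj 0 ` carrier (Q.Q 0)"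
        using Q.proj_cl[of w 0] Q.cl_carrier[of w 0] by (metis imageI)
    qed
    show "Q.proj (Suc i) (\<alpha> i x) = Q.proj i x" if "x \<in> carrier (Q.Q i)" for i x
      using that by (auto simp: Q.carrier_Q \<alpha>_cl Q.proj_cl)
    fix i x y assume "x \<in> carrier (Q.Q i)" "y \<in> carrier (Q.Q i)"
    then obtain u v where u: "set u \<subseteq> A" "x = Q.cl i u" and v: "set v \<subseteq> A" "y = Q.cl i v"
      by (auto simp: Q.carrier_Q)
    show "Q.proj i x = Q.proj i y \<longleftrightarrow> (\<exists>k\<ge>i. seq.tr i k x = seq.tr i k y)"
    proof
      assume "Q.proj i x = Q.proj i y"
      then have e: "ev u = ev v" using u v Q.proj_cl by simp
      \<comment> \<open>From this stage on, replacing the whole word \<open>u\<close> by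
        \<open>v\<close> is one move.\<close>
      define k where "k = max i (max (length u) (length v))"
      have "length u \<le> 20 * D k" "length v \<le> 20 * D k" using Dge[of k] by (auto simp: k_def)
      then have "(u, v) \<in> moves (20 * D k)" using move_short[of "[]" "[]" u v "20 * D k"] u v e by simp
      then have "Q.cl k u = Q.cl k v" using Q.cl_eq u v by blast
      then show "\<exists>k\<ge>i. seq.tr i k x = seq.tr i k y"
        using tr_cl[of i k] u v by (intro exI[of _ k]) (auto simp: k_def)
    next
      assume "\<exists>k\<ge>i. seq.tr i k x = seq.tr i k y"
      then obtain k where "i \<le> k" "Q.cl k u = Q.cl k v" using tr_cl u v by auto
      then have "(u, v) \<in> moves (20 * D k)" using Q.cl_eq u v by blast
      then show "Q.proj i x = Q.proj i y" using moves_eval[of u v] u v Q.proj_cl by simp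
    qed
  qed
  have hyp: "hyperbolic_group_with (Q.Q i) (Q.gens i) (4 * (real (1000 * D i) + 4))" for i
    by (rule Q.Q.four_point_hyperbolic_group[OF Q.Q.global_four_point])
  have gens: "\<alpha> i ` Q.gens i = Q.gens (Suc i)" for i
    unfolding Q.gens_def image_image by (rule image_cong) (auto simp: \<alpha>_cl)
  have proj_\<alpha>: "Q.proj (Suc i) (\<alpha> i x) = Q.proj i x" if "x \<in> carrier (Q.Q i)" for i x
    using that by (auto simp: Q.carrier_Q \<alpha>_cl Q.proj_cl)
  have inj: "ereal (real (R i)) \<le> injectivity_radius (Q.Q i) (Q.gens i) (\<alpha> i)" for i
  proof -
    have "inj_on (\<alpha> i) {h \<in> carrier (Q.Q i). word_length (Q.Q i) (Q.gens i) h \<le> R i}"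
    proof (rule inj_onI)
      fix x y assume "x \<in> {h \<in> carrier (Q.Q i). word_length (Q.Q i) (Q.gens i) h \<le> R i}"
        "y \<in> {h \<in> carrier (Q.Q i). word_length (Q.Q i) (Q.gens i) h \<le> R i}" "\<alpha> i x = \<alpha> i y"
      then show "x = y" using Q.proj_inj[of x i y] proj_\<alpha>[of x i] proj_\<alpha>[of y i] by simp
    qed
    then show ?thesis unfolding injectivity_radius_def by (intro Sup_upper) auto
  qed
  \<comment> \<open>The constant is \<open>4000 * D i + 16\<close>, below
    \<open>400000 * D i\<close>, whereas \<open>R i\<close> is \<open>i + 1\<close> times
    \<open>400000 * D i\<close>.\<close>
  have small: "\<forall>\<^sub>F i in sequentially. ereal (4 * (real (1000 * D i) + 4)) \<le>
      ereal \<epsilon> * injectivity_radius (Q.Q i) (Q.gens i) (\<alpha> i)" if \<epsilon>: "\<epsilon> > 0" for \<epsilon>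
  proof -
    obtain n where n: "1 / \<epsilon> < real n" using reals_Archimedean2 by blast
    have "ereal (4 * (real (1000 * D i) + 4)) \<le> ereal \<epsilon> * injectivity_radius (Q.Q i) (Q.gens i) (\<alpha> i)"
      if "n \<le> i" for i
    proof -
      have "1 \<le> \<epsilon> * real (i + 1)"
      proof -
        have "1 / \<epsilon> \<le> real (i + 1)" using n that by simp
        then show ?thesis using \<epsilon> by (simp add: field_simps)
      qed
      then have "1 * (400000 * real (D i)) \<le> \<epsilon> * real (i + 1) * (400000 * real (D i))" by (intro mult_right_mono) auto
      also have "\<dots> = \<epsilon> * real (R i)" by (simp only: R_def of_nat_mult of_nat_numeral mult.assoc)
      finally have "400000 * real (D i) \<le> \<epsilon> * real (R i)" by simp
      moreover have "1 \<le> real (D i)" using D(1)[of i] by (simp add: good_def)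
      ultimately have "4 * (real (1000 * D i) + 4) \<le> \<epsilon> * real (R i)" by simp
      then have "ereal (4 * (real (1000 * D i) + 4)) \<le> ereal \<epsilon> * ereal (real (R i))" by simp
      also have "\<dots> \<le> ereal \<epsilon> * injectivity_radius (Q.Q i) (Q.gens i) (\<alpha> i)"
        using inj \<epsilon> by (intro ereal_mult_left_mono) auto
      finally show ?thesis .
    qed
    then show ?thesis unfolding eventually_sequentially by blast
  qed
  show ?thesis
    unfolding lacunary_limit_of_hyperbolic_def
    by (intro exI[of _ Q.Q] exI[of _ Q.gens] exI[of _ \<alpha>] exI[of _ "\<lambda>i. 4 * (real (1000 * D i) + 4)"]
        conjI allI impI hyp epi gens iso small)
qed

theorem theorem1p1:
  fixes G :: "('a, 'm) monoid_scheme" and S :: "'a set"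
  assumes "group G" and "finite_generating_set G S"
    and "infinite (UNIV :: 'b set)"
  shows "(lacunary_hyperbolic G \<longleftrightarrow>
            (\<exists>d. scaling_sequence d \<and>
               (\<forall>\<omega>. nonprincipal_ultrafilter \<omega> \<longrightarrow> cone_is_real_tree G S \<omega> d))) \<and>
         (lacunary_hyperbolic G \<longleftrightarrow> lacunary_limit_of_hyperbolic TYPE('b) G)"
proof -
  interpret word_group G S by (intro word_group.intro assms(1) word_group_axioms.intro assms(2))
  have scales: "lacunary_scales" if lac: "lacunary_hyperbolic G"
  proof -
    obtain T \<omega> d where T: "finite_generating_set G T" "nonprincipal_ultrafilter \<omega>" "scaling_sequence d"
      "cone_is_real_tree G T \<omega> d" using lac unfolding lacunary_hyperbolic_def by blast
    show ?thesis by (rule real_tree_imp_lacunary_scales[OF T(2,3) cone_is_real_tree_generators[OF T]])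
  qed
  have lacunary: "lacunary_hyperbolic G"
    if "finite_generating_set G T" "scaling_sequence d" "\<And>\<omega>. nonprincipal_ultrafilter \<omega> \<Longrightarrow> cone_is_real_tree G T \<omega> d"
    for T d
  proof -
    obtain \<omega> where "nonprincipal_ultrafilter \<omega>" using ex_nonprincipal_ultrafilter by blast
    then show ?thesis using that assms(1) unfolding lacunary_hyperbolic_def by blast
  qed
  have "lacunary_hyperbolic G" if lim: "lacunary_limit_of_hyperbolic TYPE('b) G"
  proof -
    \<comment> \<open>The limit comes with its own generating set, the image of the first one. As
      \<open>lacunary_hyperbolic\<close> allows any finite generating set, the cones over
      \<open>T\<close> serve as witnesses.\<close>
    obtain T where T: "finite_generating_set G T" "word_group.lacunary_scales G T"
      using limit_of_hyperbolic_imp_lacunary_scales[OF assms(1) lim] by blast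
    interpret T: word_group G T by (intro word_group.intro assms(1) word_group_axioms.intro T(1))
    obtain d where "scaling_sequence d" "\<And>\<omega>. nonprincipal_ultrafilter \<omega> \<Longrightarrow> cone_is_real_tree G T \<omega> d"
      using T.lacunary_scales_imp_real_tree[OF T(2)] by blast
    then show ?thesis by (rule lacunary[OF T(1)])
  qed
  moreover have "lacunary_limit_of_hyperbolic TYPE('b) G" if "lacunary_hyperbolic G"
    by (rule lacunary_scales_imp_limit_of_hyperbolic[OF scales[OF that] assms(3)])
  moreover have "\<exists>d. scaling_sequence d \<and> (\<forall>\<omega>. nonprincipal_ultrafilter \<omega> \<longrightarrow> cone_is_real_tree G S \<omega> d)"
    if "lacunary_hyperbolic G"
    by (rule lacunary_scales_imp_real_tree[OF scales[OF that]])
  moreover have "lacunary_hyperbolic G"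
    if "\<exists>d. scaling_sequence d \<and> (\<forall>\<omega>. nonprincipal_ultrafilter \<omega> \<longrightarrow> cone_is_real_tree G S \<omega> d)"
    using lacunary[OF assms(2)] that by blast
  ultimately show ?thesis by blast
qed

end
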